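(* Let $(R,\mathfrak m)$ be a commutative noetherian local ring such that $\operatorname{gl\,ld} R<\infty$. Let $S$ be a standard graded algebra over $R$ and $C$ a finitely generated graded $S$-module. Then the sequence $(\operatorname{ld}_R C_n)_n$ is eventually constant, where $C_n$ denotes the degree $n$ component of $C$, regarded as an $R$-module.
   Context: A standard graded algebra over $R$ is a commutative $\mathbb N$-graded ring $S=\bigoplus_{n\ge0}S_n$ with $S_0=R$ which is generated as an $R$-algebra by finitely many elements of $S_1$. Graded $S$-modules are $\mathbb Z$-graded. Let $(R,\mathfrak m)$ be a commutative noetherian local ring and $M$ a finitely generated $R$-module with minimal free resolution $F:\ \cdots\to F_i\to F_{i-1}\to\cdots\to F_0\to 0$. For each integer $i\ge 0$ let $\mathcal F^iF$ be the subcomplex of $F$ whose component in homological degree $j$ is $\mathfrak m^{i-j}F_j$, where $\mathfrak m^{p}=R$ for $p\le 0$; it is a subcomplex because $\partial(F)\subseteq \mathfrak mF$. The linear part of $F$ is the complex $\operatorname{lin}^R F=\bigoplus_{i\ge 0}\mathcal F^iF/\mathcal F^{i+1}F$ with the induced differential. It is a complex of graded modules over $\operatorname{gr}_{\mathfrak m}R=\bigoplus_{j\ge0}\mathfrak m^j/\mathfrak m^{j+1}$, with $(\operatorname{lin}^RF)_i=(\operatorname{gr}_{\mathfrak m}F_i)(-i)$, where $\operatorname{gr}_{\mathfrak m}F_i=\bigoplus_{j\ge 0}\mathfrak m^jF_i/\mathfrak m^{j+1}F_i$. The linearity defect of $M$ is $\operatorname{ld}_R M=\sup\{i: H_i(\operatorname{lin}^RF)\ne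 0\}\in\mathbb N\cup\{\infty\}$, with the convention $\operatorname{ld}_R 0=0$. The global linearity defect of $R$ is $\operatorname{gl\,ld}R=\sup\{\operatorname{ld}_RM : M \text{ a finitely generated } R\text{-module}\}$. *)

theory Defs
  imports "HOL-Algebra.Module" "HOL-Algebra.Ring_Divisibility" "HOL-Algebra.Ideal_Product"
    "HOL-Algebra.Generated_Rings" "HOL-Library.Extended_Nat"
begin

text \<open>
  Modules are records of HOL-Algebra's type \<open>('a, 'b) module\<close>. This type extends the ring records,
  so a module record also has fields \<open>mult\<close> and \<open>one\<close>; they play no role and are left unspecified
  in the constructions below.
\<close>

section \<open>Modules\<close>

definition mod_hom ::
  "('a, 'r) ring_scheme \<Rightarrow> ('a, 'b, 'm) module_scheme \<Rightarrow> ('a, 'c, 'n) module_scheme \<Rightarrow> ('b \<Rightarrow> 'c) set"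
  where "mod_hom R M N = {f. f \<in> carrier M \<rightarrow> carrier N
     \<and> (\<forall>x\<in>carrier M. \<forall>y\<in>carrier M. f (x \<oplus>\<^bsub>M\<^esub> y) = f x \<oplus>\<^bsub>N\<^esub> f y)
     \<and> (\<forall>r\<in>carrier R. \<forall>x\<in>carrier M. f (r \<odot>\<^bsub>M\<^esub> x) = r \<odot>\<^bsub>N\<^esub> f x)}"

definition mod_span :: "('a, 'r) ring_scheme \<Rightarrow> ('a, 'b, 'm) module_scheme \<Rightarrow> 'b set \<Rightarrow> 'b set"
  where "mod_span R M A = \<Inter>{N. submodule N R M \<and> A \<subseteq> N}"

definition fin_gen :: "('a, 'r) ring_scheme \<Rightarrow> ('a, 'b, 'm) module_scheme \<Rightarrow> bool"
  where "fin_gen R M \<longleftrightarrow> (\<exists>A. finite A \<and> A \<subseteq> carrier M \<and> mod_span R M A = carrier M)"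

definition ideal_smult ::
  "('a, 'r) ring_scheme \<Rightarrow> 'a set \<Rightarrow> ('a, 'b, 'm) module_scheme \<Rightarrow> 'b set"
  where "ideal_smult R I M = mod_span R M {r \<odot>\<^bsub>M\<^esub> x | r x. r \<in> I \<and> x \<in> carrier M}"

definition quot_mod ::
  "('a, 'b, 'm) module_scheme \<Rightarrow> 'b set \<Rightarrow> ('a, 'b set) module"
  where "quot_mod M N = \<lparr>carrier = a_rcosets\<^bsub>M\<^esub> N, mult = undefined, one = undefined,
     zero = N, add = set_add M, smult = (\<lambda>r X. \<Union>x\<in>X. N +>\<^bsub>M\<^esub> (r \<odot>\<^bsub>M\<^esub> x))\<rparr>"

definition dsum_mod :: "('i \<Rightarrow> ('a, 'b, 'm) module_scheme) \<Rightarrow> ('a, 'i \<Rightarrow> 'b) module"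
  where "dsum_mod M =
    \<lparr>carrier = {x. (\<forall>i. x i \<in> carrier (M i)) \<and> finite {i. x i \<noteq> \<zero>\<^bsub>M i\<^esub>}},
     mult = undefined, one = undefined,
     zero = (\<lambda>i. \<zero>\<^bsub>M i\<^esub>), add = (\<lambda>x y i. x i \<oplus>\<^bsub>M i\<^esub> y i), smult = (\<lambda>r x i. r \<odot>\<^bsub>M i\<^esub> x i)\<rparr>"

text \<open>The free module \<open>R\<^sup>b\<close>; vectors are padded with zeros so that equality is extensional.\<close>

definition free_mod :: "('a, 'r) ring_scheme \<Rightarrow> nat \<Rightarrow> ('a, nat \<Rightarrow> 'a) module"
  where "free_mod R b =
    \<lparr>carrier = {x. (\<forall>i<b. x i \<in> carrier R) \<and> (\<forall>i\<ge>b. x i = \<zero>\<^bsub>R\<^esub>)},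
     mult = undefined, one = undefined,
     zero = (\<lambda>i. \<zero>\<^bsub>R\<^esub>), add = (\<lambda>x y i. x i \<oplus>\<^bsub>R\<^esub> y i), smult = (\<lambda>r x i. r \<otimes>\<^bsub>R\<^esub> x i)\<rparr>"

definition restrict_scalars ::
  "('a \<Rightarrow> 's) \<Rightarrow> ('s, 'b, 'm) module_scheme \<Rightarrow> 'b set \<Rightarrow> ('a, 'b) module"
  where "restrict_scalars \<phi> M N = \<lparr>carrier = N, mult = mult M, one = one M,
     zero = zero M, add = add M, smult = (\<lambda>r x. \<phi> r \<odot>\<^bsub>M\<^esub> x)\<rparr>"


section \<open>Noetherian local rings\<close>

definition noeth_local_ring :: "('a, 'r) ring_scheme \<Rightarrow> 'a set \<Rightarrow> bool"
  where "noeth_local_ring R m \<longleftrightarrow> cring R \<and> noetherian_ring R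
     \<and> maximalideal m R \<and> (\<forall>J. maximalideal J R \<longrightarrow> J = m)"

primrec ideal_pow :: "('a, 'r) ring_scheme \<Rightarrow> 'a set \<Rightarrow> nat \<Rightarrow> 'a set"
  where "ideal_pow R I 0 = carrier R"
  | "ideal_pow R I (Suc n) = ideal_prod R I (ideal_pow R I n)"


section \<open>Complexes and minimal free resolutions\<close>

text \<open>
  A complex \<open>\<dots> \<rightarrow> F\<^sub>2 \<rightarrow> F\<^sub>1 \<rightarrow> F\<^sub>0 \<rightarrow> 0\<close> is given by modules \<open>F j\<close> and maps \<open>d j\<close> from \<open>F j\<close> to
  \<open>F (j - 1)\<close> for \<open>j \<ge> 1\<close>. The map \<open>d 0\<close> is never used: every element of \<open>F 0\<close> is a cycle.
\<close>

definition cycles :: "(nat \<Rightarrow> ('a, 'b, 'm) module_scheme) \<Rightarrow> (nat \<Rightarrow> 'b \<Rightarrow> 'b) \<Rightarrow> nat \<Rightarrow> 'b set"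
  where "cycles F d j = {x \<in> carrier (F j). j = 0 \<or> d j x = \<zero>\<^bsub>F (j - 1)\<^esub>}"

definition boundaries :: "(nat \<Rightarrow> ('a, 'b, 'm) module_scheme) \<Rightarrow> (nat \<Rightarrow> 'b \<Rightarrow> 'b) \<Rightarrow> nat \<Rightarrow> 'b set"
  where "boundaries F d j = d (Suc j) ` carrier (F (Suc j))"

definition homology ::
  "(nat \<Rightarrow> ('a, 'b, 'm) module_scheme) \<Rightarrow> (nat \<Rightarrow> 'b \<Rightarrow> 'b) \<Rightarrow> nat \<Rightarrow> ('a, 'b set) module"
  where "homology F d j = quot_mod ((F j)\<lparr>carrier := cycles F d j\<rparr>) (boundaries F d j)"

text \<open>
  A minimal free resolution, with each \<open>F\<^sub>j\<close> written as \<open>R\<^bsup>b j\<^esup>\<close>, and augmentation \<open>\<epsilon> : F\<^sub>0 \<rightarrow> M\<close>.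
\<close>

definition min_free_res ::
  "('a, 'r) ring_scheme \<Rightarrow> 'a set \<Rightarrow> ('a, 'c, 'm) module_scheme \<Rightarrow>
   (nat \<Rightarrow> nat) \<Rightarrow> (nat \<Rightarrow> (nat \<Rightarrow> 'a) \<Rightarrow> (nat \<Rightarrow> 'a)) \<Rightarrow> ((nat \<Rightarrow> 'a) \<Rightarrow> 'c) \<Rightarrow> bool"
  where "min_free_res R m M b d \<epsilon> \<longleftrightarrow> (let F = (\<lambda>j. free_mod R (b j)) in
       (\<forall>j. d (Suc j) \<in> mod_hom R (F (Suc j)) (F j))
     \<and> \<epsilon> \<in> mod_hom R (F 0) M
     \<and> \<epsilon> ` carrier (F 0) = carrier M
     \<and> {x \<in> carrier (F 0). \<epsilon> x = \<zero>\<^bsub>M\<^esub>} = boundaries F d 0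
     \<and> (\<forall>j. cycles F d (Suc j) = boundaries F d (Suc j))
     \<and> (\<forall>j. boundaries F d j \<subseteq> ideal_smult R m (F j)))"


section \<open>The linear part and the linearity defect\<close>

text \<open>
  \<open>filt R m F i j\<close> is the component in homological degree \<open>j\<close> of the subcomplex \<open>\<F>\<^sup>iF\<close>, that is
  \<open>m\<^bsup>i-j\<^esup>F\<^sub>j\<close>. Truncated subtraction together with \<open>m\<^sup>0 = R\<close> gives the convention \<open>m\<^sup>p = R\<close>
  for \<open>p \<le> 0\<close>.
\<close>

definition filt ::
  "('a, 'r) ring_scheme \<Rightarrow> 'a set \<Rightarrow> (nat \<Rightarrow> ('a, 'b) module) \<Rightarrow> nat \<Rightarrow> nat \<Rightarrow> ('a, 'b) module"
  where "filt R m F i j = (F j)\<lparr>carrier := ideal_smult R (ideal_pow R m (i - j)) (F j)\<rparr>"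

definition filt_quot ::
  "('a, 'r) ring_scheme \<Rightarrow> 'a set \<Rightarrow> (nat \<Rightarrow> ('a, 'b) module) \<Rightarrow> nat \<Rightarrow> nat \<Rightarrow> ('a, 'b set) module"
  where "filt_quot R m F i j = quot_mod (filt R m F i j) (carrier (filt R m F (Suc i) j))"

text \<open>The differential induced on \<open>\<F>\<^sup>iF/\<F>\<^bsup>i+1\<^esup>F\<close>, sending the coset of \<open>x\<close> to the coset of \<open>d x\<close>.\<close>

definition filt_quot_d ::
  "('a, 'r) ring_scheme \<Rightarrow> 'a set \<Rightarrow> (nat \<Rightarrow> ('a, 'b) module) \<Rightarrow> (nat \<Rightarrow> 'b \<Rightarrow> 'b) \<Rightarrow>
   nat \<Rightarrow> nat \<Rightarrow> 'b set \<Rightarrow> 'b set"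
  where "filt_quot_d R m F d i j X =
    (\<Union>x\<in>X. carrier (filt R m F (Suc i) (j - 1)) +>\<^bsub>F (j - 1)\<^esub> d j x)"

definition lin_part ::
  "('a, 'r) ring_scheme \<Rightarrow> 'a set \<Rightarrow> (nat \<Rightarrow> ('a, 'b) module) \<Rightarrow> nat \<Rightarrow> ('a, nat \<Rightarrow> 'b set) module"
  where "lin_part R m F j = dsum_mod (\<lambda>i. filt_quot R m F i j)"

definition lin_part_d ::
  "('a, 'r) ring_scheme \<Rightarrow> 'a set \<Rightarrow> (nat \<Rightarrow> ('a, 'b) module) \<Rightarrow> (nat \<Rightarrow> 'b \<Rightarrow> 'b) \<Rightarrow>
   nat \<Rightarrow> (nat \<Rightarrow> 'b set) \<Rightarrow> (nat \<Rightarrow> 'b set)"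
  where "lin_part_d R m F d j x = (\<lambda>i. filt_quot_d R m F d i j (x i))"

text \<open>
  The supremum of the empty set in \<^typ>\<open>enat\<close> is \<open>0\<close>, so the zero module has linearity defect \<open>0\<close>.
  Minimal free resolutions are unique up to isomorphism, so it does not matter which one is chosen.
\<close>

definition ld :: "('a, 'r) ring_scheme \<Rightarrow> 'a set \<Rightarrow> ('a, 'c, 'm) module_scheme \<Rightarrow> enat"
  where "ld R m M =
    (let (b, d, \<epsilon>) = (SOME (b, d, \<epsilon>). min_free_res R m M b d \<epsilon>);
         F = (\<lambda>j. free_mod R (b j));
         H = homology (lin_part R m F) (lin_part_d R m F d)
     in Sup {enat i | i. carrier (H i) \<noteq> {\<zero>\<^bsub>H i\<^esub>}})"

text \<open>
  HOL cannot quantify over modules with carriers in arbitrary types. The type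
  \<^typ>\<open>(nat \<Rightarrow> 'a) set\<close> contains the cosets in \<open>R\<^sup>n\<close> of every submodule, hence it carries a copy of
  every finitely generated \<open>R\<close>-module, as \<open>fin_gen_representative\<close> below proves. The supremum in
  \<open>gl_ld\<close> therefore runs over all finitely generated modules up to isomorphism.
\<close>

definition gl_ld :: "('a, 'r) ring_scheme \<Rightarrow> 'a set \<Rightarrow> enat"
  where "gl_ld R m =
    Sup {ld R m M | M :: ('a, (nat \<Rightarrow> 'a) set) module. module R M \<and> fin_gen R M}"


lemma transport_module:
  fixes M :: "('a, 'b, 'm) module_scheme"
  assumes M: "module R M" and fg: "fin_gen R M" and inj: "inj_on h (carrier M)"
  shows "\<exists>M' :: ('a, 'c) module. module R M' \<and> fin_gen R M'
    \<and> h \<in> mod_hom R M M' \<and> bij_betw h (carrier M) (carrier M')"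
proof -
  interpret module R M by fact
  define g where "g = inv_into (carrier M) h"
  have g: "g (h x) = x" if "x \<in> carrier M" for x
    using inj that by (simp add: g_def)
  define M' :: "('a, 'c) module" where
    "M' = \<lparr>carrier = h ` carrier M, mult = undefined, one = undefined, zero = h \<zero>\<^bsub>M\<^esub>,
      add = (\<lambda>X Y. h (g X \<oplus>\<^bsub>M\<^esub> g Y)), smult = (\<lambda>r X. h (r \<odot>\<^bsub>M\<^esub> g X))\<rparr>"
  have sel: "carrier M' = h ` carrier M" "\<zero>\<^bsub>M'\<^esub> = h \<zero>\<^bsub>M\<^esub>"
    "\<And>X Y. X \<oplus>\<^bsub>M'\<^esub> Y = h (g X \<oplus>\<^bsub>M\<^esub> g Y)" "\<And>r X. r \<odot>\<^bsub>M'\<^esub> X = h (r \<odot>\<^bsub>M\<^esub> g X)"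
    by (simp_all add: M'_def)
  have ab: "abelian_group M'"
  proof (rule abelian_groupI)
    fix X assume "X \<in> carrier M'"
    then obtain x where x: "x \<in> carrier M" "X = h x" by (auto simp: sel)
    show "\<exists>Y\<in>carrier M'. Y \<oplus>\<^bsub>M'\<^esub> X = \<zero>\<^bsub>M'\<^esub>"
      by (rule bexI[of _ "h (\<ominus>\<^bsub>M\<^esub> x)"]) (use x in \<open>auto simp: sel g M.l_neg\<close>)
  qed (auto simp: sel g M.a_ac)
  have M': "module R M'"
    by (rule moduleI) (auto simp: sel g ab cring_axioms smult_l_distr smult_r_distr smult_assoc1
        is_cring)
  have hom: "h \<in> mod_hom R M M'"
    by (auto simp: mod_hom_def sel g)
  have bij: "bij_betw h (carrier M) (carrier M')"
    using inj by (simp add: sel bij_betw_def)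
  interpret M': module R M' by fact
  from fg obtain A where A: "finite A" "A \<subseteq> carrier M" "mod_span R M A = carrier M"
    by (auto simp: fin_gen_def)
  have "mod_span R M' (h ` A) = carrier M'"
  proof
    show "mod_span R M' (h ` A) \<subseteq> carrier M'"
      unfolding mod_span_def using M'.carrier_is_submodule A(2) sel(1) by blast
    show "carrier M' \<subseteq> mod_span R M' (h ` A)"
      unfolding mod_span_def
    proof (rule Inter_greatest)
      fix N assume "N \<in> {N. submodule N R M' \<and> h ` A \<subseteq> N}"
      then have N: "submodule N R M'" "h ` A \<subseteq> N" by auto
      have Na: "X \<oplus>\<^bsub>M'\<^esub> Y \<in> N" if "X \<in> N" "Y \<in> N" for X Y
        using M'.submoduleE(5)[OF N(1)] that by blast
      have Ns: "r \<odot>\<^bsub>M'\<^esub> X \<in> N" if "X \<in> N" "r \<in> carrier R" for r X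
        using M'.submoduleE(4)[OF N(1)] that by blast
      have "submodule {x \<in> carrier M. h x \<in> N} R M"
      proof (rule submoduleI)
        show "\<zero>\<^bsub>M\<^esub> \<in> {x \<in> carrier M. h x \<in> N}"
          using subgroup.one_closed[OF submodule.axioms(1)[OF N(1)]] by (simp add: sel)
        fix a assume a: "a \<in> {x \<in> carrier M. h x \<in> N}"
        have "(\<ominus>\<^bsub>R\<^esub> \<one>\<^bsub>R\<^esub>) \<odot>\<^bsub>M'\<^esub> h a \<in> N" using a by (intro Ns) auto
        then show "\<ominus>\<^bsub>M\<^esub> a \<in> {x \<in> carrier M. h x \<in> N}"
          using a by (simp add: sel g smult_l_minus)
      next
        fix a b assume "a \<in> {x \<in> carrier M. h x \<in> N}" "b \<in> {x \<in> carrier M. h x \<in> N}"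
        then show "a \<oplus>\<^bsub>M\<^esub> b \<in> {x \<in> carrier M. h x \<in> N}"
          using Na[of "h a" "h b"] by (simp add: sel g)
      next
        fix r a assume "r \<in> carrier R" "a \<in> {x \<in> carrier M. h x \<in> N}"
        then show "r \<odot>\<^bsub>M\<^esub> a \<in> {x \<in> carrier M. h x \<in> N}"
          using Ns[of "h a" r] by (simp add: sel g)
      qed auto
      moreover have "A \<subseteq> {x \<in> carrier M. h x \<in> N}" using A(2) N(2) by auto
      ultimately have "mod_span R M A \<subseteq> {x \<in> carrier M. h x \<in> N}"
        unfolding mod_span_def by blast
      then show "carrier M' \<subseteq> N" using A(3) by (auto simp: sel)
    qed
  qed
  then have "fin_gen R M'"
    unfolding fin_gen_def using A by (intro exI[of _ "h ` A"]) (auto simp: sel)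
  with M' hom bij show ?thesis by blast
qed

lemma fin_gen_representative:
  fixes M :: "('a, 'b, 'm) module_scheme"
  assumes M: "module R M" and fg: "fin_gen R M"
  shows "\<exists>(M' :: ('a, (nat \<Rightarrow> 'a) set) module) h. module R M' \<and> fin_gen R M'
    \<and> h \<in> mod_hom R M M' \<and> bij_betw h (carrier M) (carrier M')"
proof -
  interpret module R M by fact
  from fg obtain A where A: "finite A" "A \<subseteq> carrier M" "mod_span R M A = carrier M"
    by (auto simp: fin_gen_def)
  from finite_imp_nat_seg_image_inj_on[OF A(1)] obtain n and a :: "nat \<Rightarrow> 'b"
    where a: "A = a ` {i. i < n}" by blast
  define F where "F = carrier (free_mod R n)"
  define s where "s c = (\<Oplus>\<^bsub>M\<^esub> i\<in>{i. i < n}. c i \<odot>\<^bsub>M\<^esub> a i)" for c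
  have ac: "a i \<in> carrier M" if "i < n" for i using a A(2) that by auto
  have Fc: "c i \<in> carrier R" if "c \<in> F" for c i
    using that by (cases "i < n") (auto simp: F_def free_mod_def)
  have sc: "s c \<in> carrier M" if "c \<in> F" for c
    unfolding s_def using that by (intro M.finsum_closed) (auto simp: Fc ac)
  have s_smult: "s (\<lambda>i. r \<otimes>\<^bsub>R\<^esub> c i) = r \<odot>\<^bsub>M\<^esub> s c" if "r \<in> carrier R" "c \<in> F" for r c
  proof -
    have "r \<odot>\<^bsub>M\<^esub> s c = (\<Oplus>\<^bsub>M\<^esub> i\<in>{i. i < n}. r \<odot>\<^bsub>M\<^esub> (c i \<odot>\<^bsub>M\<^esub> a i))"
      unfolding s_def using that by (intro finsum_smult_ldistr) (auto simp: Fc ac)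
    also have "\<dots> = s (\<lambda>i. r \<otimes>\<^bsub>R\<^esub> c i)"
      unfolding s_def using that by (intro M.finsum_cong') (auto simp: Fc ac smult_assoc1)
    finally show ?thesis ..
  qed
  have s_add: "s (\<lambda>i. c i \<oplus>\<^bsub>R\<^esub> c' i) = s c \<oplus>\<^bsub>M\<^esub> s c'" if "c \<in> F" "c' \<in> F" for c c'
  proof -
    have "s c \<oplus>\<^bsub>M\<^esub> s c' = (\<Oplus>\<^bsub>M\<^esub> i\<in>{i. i < n}. c i \<odot>\<^bsub>M\<^esub> a i \<oplus>\<^bsub>M\<^esub> c' i \<odot>\<^bsub>M\<^esub> a i)"
      unfolding s_def using that by (intro M.finsum_addf[symmetric]) (auto simp: Fc ac)
    also have "\<dots> = s (\<lambda>i. c i \<oplus>\<^bsub>R\<^esub> c' i)"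
      unfolding s_def using that by (intro M.finsum_cong') (auto simp: Fc ac smult_l_distr)
    finally show ?thesis ..
  qed
  have F_smult: "(\<lambda>i. r \<otimes>\<^bsub>R\<^esub> c i) \<in> F" if "r \<in> carrier R" "c \<in> F" for r c
    using that by (auto simp: F_def free_mod_def)
  have F_add: "(\<lambda>i. c i \<oplus>\<^bsub>R\<^esub> c' i) \<in> F" if "c \<in> F" "c' \<in> F" for c c'
    using that by (auto simp: F_def free_mod_def)
  have F_zero: "(\<lambda>i. \<zero>\<^bsub>R\<^esub>) \<in> F" by (auto simp: F_def free_mod_def)
  have sub: "submodule (s ` F) R M"
  proof (rule submoduleI)
    show "s ` F \<subseteq> carrier M" using sc by auto
    have "s (\<lambda>i. \<zero>\<^bsub>R\<^esub>) = (\<Oplus>\<^bsub>M\<^esub> i\<in>{i. i < n}. \<zero>\<^bsub>M\<^esub>)"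
      unfolding s_def by (intro M.finsum_cong') (auto simp: ac)
    then show "\<zero>\<^bsub>M\<^esub> \<in> s ` F" using F_zero by (metis M.finsum_zero image_eqI)
    fix x assume "x \<in> s ` F"
    then obtain c where c: "c \<in> F" "x = s c" by auto
    have "\<ominus>\<^bsub>M\<^esub> x = (\<ominus>\<^bsub>R\<^esub> \<one>\<^bsub>R\<^esub>) \<odot>\<^bsub>M\<^esub> s c" using c sc by (simp add: smult_l_minus)
    also have "\<dots> = s (\<lambda>i. (\<ominus>\<^bsub>R\<^esub> \<one>\<^bsub>R\<^esub>) \<otimes>\<^bsub>R\<^esub> c i)" using c by (intro s_smult[symmetric]) auto
    finally show "\<ominus>\<^bsub>M\<^esub> x \<in> s ` F" using c F_smult[of "\<ominus>\<^bsub>R\<^esub> \<one>\<^bsub>R\<^esub>" c] by auto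
  next
    fix x y assume "x \<in> s ` F" "y \<in> s ` F"
    then obtain c c' where c: "c \<in> F" "x = s c" "c' \<in> F" "y = s c'" by auto
    then show "x \<oplus>\<^bsub>M\<^esub> y \<in> s ` F" using s_add[of c c'] F_add[of c c'] by (metis image_eqI)
  next
    fix r x assume "r \<in> carrier R" "x \<in> s ` F"
    then obtain c where c: "r \<in> carrier R" "c \<in> F" "x = s c" by auto
    then show "r \<odot>\<^bsub>M\<^esub> x \<in> s ` F" using s_smult[of r c] F_smult[of r c] by (metis image_eqI)
  qed
  have "A \<subseteq> s ` F"
  proof
    fix x assume "x \<in> A"
    then obtain k where k: "k < n" "x = a k" using a by auto
    define e where "e = (\<lambda>i. if i = k then \<one>\<^bsub>R\<^esub> else \<zero>\<^bsub>R\<^esub>)"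
    have e: "e \<in> F" using k by (auto simp: F_def free_mod_def e_def)
    have "s e = (\<Oplus>\<^bsub>M\<^esub> i\<in>{i. i < n}. if k = i then a i else \<zero>\<^bsub>M\<^esub>)"
      unfolding s_def by (intro M.finsum_cong') (auto simp: ac e_def)
    also have "\<dots> = a k" using k ac by (intro M.finsum_singleton) auto
    finally show "x \<in> s ` F" using e k by (metis image_eqI)
  qed
  with sub A(3) have onto: "carrier M \<subseteq> s ` F" unfolding mod_span_def by blast
  have "inj_on (\<lambda>x. {c \<in> F. s c = x}) (carrier M)"
    using onto by (auto simp: inj_on_def)
  from transport_module[OF M fg this] show ?thesis by blast
qed

section \<open>Graded algebras and graded modules\<close>

definition internal_direct_sum :: "('b, 'm) ring_scheme \<Rightarrow> ('i \<Rightarrow> 'b set) \<Rightarrow> bool"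
  where "internal_direct_sum M N \<longleftrightarrow> (\<forall>i. additive_subgroup (N i) M)
     \<and> (\<forall>x\<in>carrier M. \<exists>!c. (\<forall>i. c i \<in> N i) \<and> finite {i. c i \<noteq> \<zero>\<^bsub>M\<^esub>}
          \<and> x = (\<Oplus>\<^bsub>M\<^esub> i\<in>{i. c i \<noteq> \<zero>\<^bsub>M\<^esub>}. c i))"

text \<open>
  \<open>Sg n\<close> is the component \<open>S\<^sub>n\<close>, and \<open>\<phi>\<close> is the structure map of the \<open>R\<close>-algebra \<open>S\<close>, along which
  \<open>R\<close> is identified with \<open>S\<^sub>0\<close>.
\<close>

definition standard_graded_algebra ::
  "('a, 'r) ring_scheme \<Rightarrow> ('s, 't) ring_scheme \<Rightarrow> ('a \<Rightarrow> 's) \<Rightarrow> (nat \<Rightarrow> 's set) \<Rightarrow> bool"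
  where "standard_graded_algebra R S \<phi> Sg \<longleftrightarrow> cring S \<and> internal_direct_sum S Sg
     \<and> (\<forall>i j. \<forall>x\<in>Sg i. \<forall>y\<in>Sg j. x \<otimes>\<^bsub>S\<^esub> y \<in> Sg (i + j))
     \<and> \<phi> \<in> ring_iso R (S\<lparr>carrier := Sg 0\<rparr>)
     \<and> (\<exists>A. finite A \<and> A \<subseteq> Sg 1 \<and> generate_ring S (\<phi> ` carrier R \<union> A) = carrier S)"

definition graded_module ::
  "('s, 't) ring_scheme \<Rightarrow> (nat \<Rightarrow> 's set) \<Rightarrow> ('s, 'c, 'm) module_scheme \<Rightarrow> (int \<Rightarrow> 'c set) \<Rightarrow> bool"
  where "graded_module S Sg C Cg \<longleftrightarrow> module S C \<and> internal_direct_sum C Cg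
     \<and> (\<forall>i n. \<forall>s\<in>Sg i. \<forall>x\<in>Cg n. s \<odot>\<^bsub>C\<^esub> x \<in> Cg (int i + n))"

end

theory Submission
  imports Defs "HOL-Library.Fun_Lexorder"
begin

text \<open>
  Why the theorem holds. Let \<open>F\<close> be a minimal free resolution of a finitely generated module \<open>M\<close>. Exactness
  of the linear part of \<open>F\<close> can be read off from the maps \<open>Tor\<^sub>i(R/m\<^bsup>q+1\<^esup>, M) \<rightarrow> Tor\<^sub>i(R/m\<^sup>q, M)\<close>. If the
  linear part is exact in degree \<open>i \<ge> 1\<close>, these maps vanish for all \<open>q\<close>; if they vanish in the degrees \<open>i\<close>
  and \<open>i + 1\<close>, the linear part is exact in degree \<open>i\<close>. So the linearity defect is the supremum
  of all \<open>i \<ge> 1\<close> for which some of the maps is nonzero (\<open>ld_eq\<close>). In terms of the syzygy module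
  \<open>\<Omega> \<subseteq> F\<^bsub>i-1\<^esub>\<close> the vanishing says that \<open>\<Omega> \<inter> m\<^bsup>q+1\<^esup>F\<^bsub>i-1\<^esub> \<subseteq> m\<^sup>q\<Omega>\<close> for all \<open>q\<close>. It does not depend on the
  free modules used to form the syzygies. Syzygies of the same module are retracts of one another up to
  maps that factor through free modules, and such retracts pass the condition on
  (\<open>stable_retract_syzygy\<close>, \<open>tor_maps_vanish_stable_retract\<close>).

  In large degrees the components \<open>C\<^sub>n\<close> form a graded module over a polynomial ring over \<open>R\<close>, generated in
  its lowest degree. Cover them compatibly by the components \<open>P\<^sub>n\<close> of a free graded module, with kernels
  \<open>\<Omega>\<^sub>n\<close>. The modules \<open>\<Omega>\<^sub>n \<inter> m\<^sup>qP\<^sub>n\<close> are the components of a bigraded submodule for the polynomial ring with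
  further variables of bidegree \<open>(0, 1)\<close> that act as generators of \<open>m\<close>. By a Hilbert basis argument with
  leading coefficients and Dickson's lemma (\<open>eventually_generated\<close>) there is a bound, independent
  of \<open>q\<close>, beyond which \<open>\<Omega>\<^bsub>n+1\<^esub> \<inter> m\<^sup>qP\<^bsub>n+1\<^esub>\<close> is generated by variables times \<open>\<Omega>\<^sub>n \<inter> m\<^sup>qP\<^sub>n\<close>. Two consequences
  follow for large \<open>n\<close>. Vanishing of all maps between the \<open>Tor\<^sub>1\<close> passes from \<open>C\<^sub>n\<close> to \<open>C\<^bsub>n+1\<^esub>\<close>, so it either
  holds for all large \<open>n\<close> or fails for all large \<open>n\<close>. Moreover the \<open>\<Omega>\<^sub>n\<close> again form a graded module of
  the same kind. Dimension shifting therefore gives the same alternative for each \<open>Tor\<^sub>i\<close>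
  (\<open>tor_vanish_eventually_decided\<close>).

  The bounds on \<open>n\<close> depend on \<open>i\<close>. Finiteness of the global linearity defect leaves only finitely many
  \<open>i\<close> to consider, so beyond the largest of the bounds the linearity defect of \<open>C\<^sub>n\<close> is constant.
\<close>

section \<open>Submodules, spans and homomorphisms\<close>

lemma mod_hom_closed: "f \<in> mod_hom R M N \<Longrightarrow> x \<in> carrier M \<Longrightarrow> f x \<in> carrier N"
  and mod_hom_add: "f \<in> mod_hom R M N \<Longrightarrow> x \<in> carrier M \<Longrightarrow> y \<in> carrier M
      \<Longrightarrow> f (x \<oplus>\<^bsub>M\<^esub> y) = f x \<oplus>\<^bsub>N\<^esub> f y"
  and mod_hom_smult: "f \<in> mod_hom R M N \<Longrightarrow> r \<in> carrier R \<Longrightarrow> x \<in> carrier M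
      \<Longrightarrow> f (r \<odot>\<^bsub>M\<^esub> x) = r \<odot>\<^bsub>N\<^esub> f x"
  by (auto simp: mod_hom_def)

lemma mod_homI:
  assumes "\<And>x. x \<in> carrier M \<Longrightarrow> f x \<in> carrier N"
    and "\<And>x y. x \<in> carrier M \<Longrightarrow> y \<in> carrier M \<Longrightarrow> f (x \<oplus>\<^bsub>M\<^esub> y) = f x \<oplus>\<^bsub>N\<^esub> f y"
    and "\<And>r x. r \<in> carrier R \<Longrightarrow> x \<in> carrier M \<Longrightarrow> f (r \<odot>\<^bsub>M\<^esub> x) = r \<odot>\<^bsub>N\<^esub> f x"
  shows "f \<in> mod_hom R M N"
  using assms by (auto simp: mod_hom_def)

lemma mod_hom_into_sub:
  assumes "f \<in> mod_hom R M N" "\<And>x. x \<in> carrier M \<Longrightarrow> f x \<in> U"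
  shows "f \<in> mod_hom R M (N\<lparr>carrier := U\<rparr>)"
  using assms by (auto simp: mod_hom_def)

lemma mod_hom_restrict:
  assumes "f \<in> mod_hom R M N" "U \<subseteq> carrier M"
  shows "f \<in> mod_hom R (M\<lparr>carrier := U\<rparr>) N"
  using assms by (auto simp: mod_hom_def subset_iff)

lemma mod_hom_from_sub:
  assumes "f \<in> mod_hom R M (N\<lparr>carrier := U\<rparr>)" "U \<subseteq> carrier N"
  shows "f \<in> mod_hom R M N"
  using assms by (auto simp: mod_hom_def)

lemma mod_hom_comp:
  assumes "f \<in> mod_hom R M N" "g \<in> mod_hom R N P"
  shows "(\<lambda>x. g (f x)) \<in> mod_hom R M P"
  using assms by (auto simp: mod_hom_def Pi_def)

lemma submodule_carrier: "submodule U R M \<Longrightarrow> U \<subseteq> carrier M"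
  and submodule_zero: "submodule U R M \<Longrightarrow> \<zero>\<^bsub>M\<^esub> \<in> U"
  and submodule_add: "submodule U R M \<Longrightarrow> x \<in> U \<Longrightarrow> y \<in> U \<Longrightarrow> x \<oplus>\<^bsub>M\<^esub> y \<in> U"
  and submodule_smult: "submodule U R M \<Longrightarrow> r \<in> carrier R \<Longrightarrow> x \<in> U \<Longrightarrow> r \<odot>\<^bsub>M\<^esub> x \<in> U"
  and submodule_neg: "submodule U R M \<Longrightarrow> x \<in> U \<Longrightarrow> \<ominus>\<^bsub>M\<^esub> x \<in> U"
  and submodule_minus: "submodule U R M \<Longrightarrow> x \<in> U \<Longrightarrow> y \<in> U \<Longrightarrow> x \<ominus>\<^bsub>M\<^esub> y \<in> U"
  unfolding submodule_def subgroup_def submodule_axioms_def a_minus_def a_inv_def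
  by auto

context module
begin

lemma submodule_intro:
  assumes "H \<subseteq> carrier M" "\<zero>\<^bsub>M\<^esub> \<in> H"
    and "\<And>a b. a \<in> H \<Longrightarrow> b \<in> H \<Longrightarrow> a \<oplus>\<^bsub>M\<^esub> b \<in> H"
    and "\<And>a x. a \<in> carrier R \<Longrightarrow> x \<in> H \<Longrightarrow> a \<odot>\<^bsub>M\<^esub> x \<in> H"
  shows "submodule H R M"
proof (rule submoduleI)
  fix a assume a: "a \<in> H"
  have "\<ominus>\<^bsub>M\<^esub> a = (\<ominus> \<one>) \<odot>\<^bsub>M\<^esub> a"
    using a assms(1) by (simp add: smult_l_minus subset_iff)
  then show "\<ominus>\<^bsub>M\<^esub> a \<in> H" using a assms(4) by simp
qed (use assms in auto)

text \<open>An ideal of scalars contains a power of the maximal ideal as soon as it contains generators of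
  that power; this is how such statements are reduced to generators.\<close>

lemma colon_ideal:
  assumes U: "U \<subseteq> carrier M" and V: "submodule V R M"
  shows "ideal {r \<in> carrier R. \<forall>x\<in>U. r \<odot>\<^bsub>M\<^esub> x \<in> V} R" (is "ideal ?T R")
proof -
  have closed: "s \<otimes> r \<in> ?T" if "r \<in> ?T" "s \<in> carrier R" for r s
    using that U submodule_smult[OF V] by (auto simp: smult_assoc1 subset_iff)
  show ?thesis
  proof (rule idealI)
    show "subgroup ?T (add_monoid R)"
    proof (rule R.add.subgroupI)
      have "\<zero> \<in> ?T" using U submodule_zero[OF V] by (auto simp: subset_iff)
      then show "?T \<noteq> {}" by blast
      fix r assume r: "r \<in> ?T"
      then show "\<ominus> r \<in> ?T" using closed[of r "\<ominus> \<one>"] by (simp add: R.l_minus)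
      show "r \<oplus> s \<in> ?T" if "s \<in> ?T" for s
        using r that U submodule_add[OF V] by (auto simp: smult_l_distr subset_iff)
    qed auto
    fix r s assume rs: "r \<in> ?T" "s \<in> carrier R"
    show "s \<otimes> r \<in> ?T" by (rule closed[OF rs])
    then show "r \<otimes> s \<in> ?T" using rs R.m_comm by auto
  qed (rule R.ring_axioms)
qed

lemma zero_submodule: "submodule {\<zero>\<^bsub>M\<^esub>} R M"
  by (rule submodule_intro) auto

lemma span_incl: "A \<subseteq> mod_span R M A"
  by (auto simp: mod_span_def)

lemma span_least: "submodule N R M \<Longrightarrow> A \<subseteq> N \<Longrightarrow> mod_span R M A \<subseteq> N"
  by (auto simp: mod_span_def)

lemma span_submodule:
  assumes "A \<subseteq> carrier M" shows "submodule (mod_span R M A) R M"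
proof (rule submodule_intro)
  show "mod_span R M A \<subseteq> carrier M"
    using assms carrier_is_submodule by (rule_tac span_least)
qed (auto simp: mod_span_def intro: submodule_zero submodule_add submodule_smult)

lemma span_mono: "A \<subseteq> B \<Longrightarrow> mod_span R M A \<subseteq> mod_span R M B"
  by (auto simp: mod_span_def)

lemma span_span_least:
  assumes "B \<subseteq> carrier M" "A \<subseteq> mod_span R M B"
  shows "mod_span R M A \<subseteq> mod_span R M B"
  using assms by (intro span_least span_submodule)

lemma span_empty: "mod_span R M {} = {\<zero>\<^bsub>M\<^esub>}"
  using span_least[OF zero_submodule, of "{}"] submodule_zero[OF span_submodule[of "{}"]] by auto

lemma span_insert_elim:
  assumes "x \<in> mod_span R M (insert a A)" "a \<in> carrier M" "A \<subseteq> carrier M"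
  obtains r y where "r \<in> carrier R" "y \<in> mod_span R M A" "x = r \<odot>\<^bsub>M\<^esub> a \<oplus>\<^bsub>M\<^esub> y"
proof -
  note sA = span_submodule[OF assms(3)]
  note cA = subsetD[OF submodule_carrier[OF sA]]
  let ?U = "{r \<odot>\<^bsub>M\<^esub> a \<oplus>\<^bsub>M\<^esub> y | r y. r \<in> carrier R \<and> y \<in> mod_span R M A}"
  have "submodule ?U R M"
  proof (rule submodule_intro)
    show "?U \<subseteq> carrier M" using assms(2) cA by auto
    have "\<zero>\<^bsub>M\<^esub> = \<zero> \<odot>\<^bsub>M\<^esub> a \<oplus>\<^bsub>M\<^esub> \<zero>\<^bsub>M\<^esub>" using assms(2) by simp
    then show "\<zero>\<^bsub>M\<^esub> \<in> ?U" using submodule_zero[OF sA] by blast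
  next
    fix u v assume "u \<in> ?U" "v \<in> ?U"
    then obtain r y r' y' where u: "r \<in> carrier R" "y \<in> mod_span R M A" "u = r \<odot>\<^bsub>M\<^esub> a \<oplus>\<^bsub>M\<^esub> y"
      and v: "r' \<in> carrier R" "y' \<in> mod_span R M A" "v = r' \<odot>\<^bsub>M\<^esub> a \<oplus>\<^bsub>M\<^esub> y'" by blast
    have "u \<oplus>\<^bsub>M\<^esub> v = (r \<oplus> r') \<odot>\<^bsub>M\<^esub> a \<oplus>\<^bsub>M\<^esub> (y \<oplus>\<^bsub>M\<^esub> y')"
      using u v assms(2) cA by (simp add: smult_l_distr M.a_ac)
    then show "u \<oplus>\<^bsub>M\<^esub> v \<in> ?U" using u v submodule_add[OF sA] by blast
  next
    fix s u assume s: "s \<in> carrier R" and "u \<in> ?U"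
    then obtain r y where u: "r \<in> carrier R" "y \<in> mod_span R M A" "u = r \<odot>\<^bsub>M\<^esub> a \<oplus>\<^bsub>M\<^esub> y" by blast
    have "s \<odot>\<^bsub>M\<^esub> u = (s \<otimes> r) \<odot>\<^bsub>M\<^esub> a \<oplus>\<^bsub>M\<^esub> (s \<odot>\<^bsub>M\<^esub> y)"
      using u s assms(2) cA by (simp add: smult_r_distr smult_assoc1)
    then show "s \<odot>\<^bsub>M\<^esub> u \<in> ?U" using u s submodule_smult[OF sA] by blast
  qed
  moreover have "insert a A \<subseteq> ?U"
  proof
    fix z assume "z \<in> insert a A"
    then consider "z = a" | "z \<in> A" by auto
    then show "z \<in> ?U"
    proof cases
      case 1
      then have "z = \<one> \<odot>\<^bsub>M\<^esub> a \<oplus>\<^bsub>M\<^esub> \<zero>\<^bsub>M\<^esub>" using assms(2) by simp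
      then show ?thesis using submodule_zero[OF sA] by blast
    next
      case 2
      then have "z = \<zero> \<odot>\<^bsub>M\<^esub> a \<oplus>\<^bsub>M\<^esub> z" using assms(2,3) by auto
      then show ?thesis using span_incl 2 by blast
    qed
  qed
  ultimately have "x \<in> ?U" using span_least assms(1) by blast
  then show thesis using that by blast
qed

lemma submodule_sub_iff:
  assumes U: "submodule U R M"
  shows "submodule N R (M\<lparr>carrier := U\<rparr>) \<longleftrightarrow> submodule N R M \<and> N \<subseteq> U"
proof -
  interpret U: module R "M\<lparr>carrier := U\<rparr>"
    by (rule submodule.submodule_is_module[OF U module_axioms])
  show ?thesis
  proof
    assume N: "submodule N R (M\<lparr>carrier := U\<rparr>)"
    then have NU: "N \<subseteq> U" using submodule_carrier[OF N] by simp
    moreover have "submodule N R M"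
      using submodule_zero[OF N] submodule_add[OF N] submodule_smult[OF N] NU submodule_carrier[OF U]
      by (intro submodule_intro) auto
    ultimately show "submodule N R M \<and> N \<subseteq> U" by simp
  next
    assume N: "submodule N R M \<and> N \<subseteq> U"
    then show "submodule N R (M\<lparr>carrier := U\<rparr>)"
      by (intro U.submodule_intro) (auto intro: submodule_zero submodule_add submodule_smult)
  qed
qed

lemma span_sub:
  assumes U: "submodule U R M" and A: "A \<subseteq> U"
  shows "mod_span R (M\<lparr>carrier := U\<rparr>) A = mod_span R M A"
proof -
  have "mod_span R M A \<subseteq> U" using span_least[OF U A] .
  moreover have "submodule (mod_span R M A) R M"
    using span_submodule A submodule_carrier[OF U] by blast
  ultimately have "submodule (mod_span R M A) R (M\<lparr>carrier := U\<rparr>)"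
    by (simp add: submodule_sub_iff[OF U])
  then have "mod_span R (M\<lparr>carrier := U\<rparr>) A \<subseteq> mod_span R M A"
    using span_incl[of A] unfolding mod_span_def by blast
  moreover have "mod_span R M A \<subseteq> mod_span R (M\<lparr>carrier := U\<rparr>) A"
    unfolding mod_span_def using submodule_sub_iff[OF U] by auto
  ultimately show ?thesis by blast
qed

lemma ideal_smult_eq:
  "ideal_smult R J (M\<lparr>carrier := U\<rparr>) = mod_span R M {r \<odot>\<^bsub>M\<^esub> x | r x. r \<in> J \<and> x \<in> U}"
  if "submodule U R M" "J \<subseteq> carrier R"
proof -
  have "{r \<odot>\<^bsub>M\<^esub> x | r x. r \<in> J \<and> x \<in> U} \<subseteq> U"
    using that by (auto intro: submodule_smult)
  from span_sub[OF that(1) this] show ?thesis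
    unfolding ideal_smult_def by simp
qed

lemma ideal_smult_submodule:
  assumes "J \<subseteq> carrier R" shows "submodule (ideal_smult R J M) R M"
  unfolding ideal_smult_def using assms by (intro span_submodule) auto

lemma ideal_smult_incl: "r \<in> J \<Longrightarrow> x \<in> carrier M \<Longrightarrow> r \<odot>\<^bsub>M\<^esub> x \<in> ideal_smult R J M"
  unfolding ideal_smult_def by (rule subsetD[OF span_incl]) blast

lemma ideal_smult_least:
  assumes "submodule N R M" "\<And>r x. r \<in> J \<Longrightarrow> x \<in> carrier M \<Longrightarrow> r \<odot>\<^bsub>M\<^esub> x \<in> N"
  shows "ideal_smult R J M \<subseteq> N"
  unfolding ideal_smult_def using assms by (intro span_least) auto

lemma ideal_smult_mono: "J \<subseteq> J' \<Longrightarrow> ideal_smult R J M \<subseteq> ideal_smult R J' M"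
  unfolding ideal_smult_def by (rule span_mono) auto

lemma ideal_smult_sub_mono:
  assumes "submodule U R M" "submodule V R M" "U \<subseteq> V" "J \<subseteq> carrier R"
  shows "ideal_smult R J (M\<lparr>carrier := U\<rparr>) \<subseteq> ideal_smult R J (M\<lparr>carrier := V\<rparr>)"
  unfolding ideal_smult_eq[OF assms(1,4)] ideal_smult_eq[OF assms(2,4)]
  using assms(3) by (intro span_mono) auto

lemma ideal_smult_carrier: "ideal_smult R (carrier R) M = carrier M"
proof
  show "ideal_smult R (carrier R) M \<subseteq> carrier M"
    by (rule submodule_carrier[OF ideal_smult_submodule]) simp
  show "carrier M \<subseteq> ideal_smult R (carrier R) M"
    using ideal_smult_incl[of \<one> "carrier R"] by fastforce
qed

end

lemma mod_hom_zero:
  assumes "module R M" "module R N" "f \<in> mod_hom R M N"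
  shows "f \<zero>\<^bsub>M\<^esub> = \<zero>\<^bsub>N\<^esub>"
proof -
  interpret M: module R M by fact
  interpret N: module R N by fact
  have "f (\<zero>\<^bsub>R\<^esub> \<odot>\<^bsub>M\<^esub> \<zero>\<^bsub>M\<^esub>) = \<zero>\<^bsub>R\<^esub> \<odot>\<^bsub>N\<^esub> f \<zero>\<^bsub>M\<^esub>"
    using assms(3) by (intro mod_hom_smult) auto
  then show ?thesis using mod_hom_closed[OF assms(3)] by simp
qed

lemma mod_hom_neg:
  assumes "module R M" "module R N" "f \<in> mod_hom R M N" "x \<in> carrier M"
  shows "f (\<ominus>\<^bsub>M\<^esub> x) = \<ominus>\<^bsub>N\<^esub> f x"
proof -
  interpret M: module R M by fact
  interpret N: module R N by fact
  have "f ((\<ominus>\<^bsub>R\<^esub> \<one>\<^bsub>R\<^esub>) \<odot>\<^bsub>M\<^esub> x) = (\<ominus>\<^bsub>R\<^esub> \<one>\<^bsub>R\<^esub>) \<odot>\<^bsub>N\<^esub> f x"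
    using assms by (intro mod_hom_smult) auto
  then show ?thesis using mod_hom_closed[OF assms(3,4)] assms(4)
    by (simp add: M.smult_l_minus N.smult_l_minus)
qed

lemma mod_hom_minus:
  assumes "module R M" "module R N" "f \<in> mod_hom R M N" "x \<in> carrier M" "y \<in> carrier M"
  shows "f (x \<ominus>\<^bsub>M\<^esub> y) = f x \<ominus>\<^bsub>N\<^esub> f y"
proof -
  interpret M: module R M by fact
  show ?thesis using assms
    by (simp add: a_minus_def mod_hom_add[OF assms(3)] mod_hom_neg)
qed

lemma vimage_submodule:
  assumes M: "module R M" and N: "module R N" and f: "f \<in> mod_hom R M N" and K: "submodule K R N"
  shows "submodule {x \<in> carrier M. f x \<in> K} R M"
proof -
  interpret M: module R M by fact
  show ?thesis
    using submodule_zero[OF K] submodule_add[OF K] submodule_smult[OF K]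
    by (intro M.submodule_intro)
       (auto simp: mod_hom_zero[OF M N f] mod_hom_add[OF f] mod_hom_smult[OF f])
qed

lemma kernel_submodule:
  assumes "module R M" "module R N" "f \<in> mod_hom R M N"
  shows "submodule {x \<in> carrier M. f x = \<zero>\<^bsub>N\<^esub>} R M"
  using vimage_submodule[OF assms module.zero_submodule[OF assms(2)]] by simp

lemma image_submodule:
  assumes M: "module R M" and N: "module R N" and f: "f \<in> mod_hom R M N" and K: "submodule K R M"
  shows "submodule (f ` K) R N"
proof -
  interpret N: module R N by fact
  note Kc = subsetD[OF submodule_carrier[OF K]]
  show ?thesis
  proof (rule N.submodule_intro)
    show "f ` K \<subseteq> carrier N" using mod_hom_closed[OF f] Kc by blast
    show "\<zero>\<^bsub>N\<^esub> \<in> f ` K" using mod_hom_zero[OF M N f] submodule_zero[OF K] by (metis image_eqI)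
  next
    fix a b assume "a \<in> f ` K" "b \<in> f ` K"
    then obtain x y where "x \<in> K" "a = f x" "y \<in> K" "b = f y" by blast
    then show "a \<oplus>\<^bsub>N\<^esub> b \<in> f ` K" using mod_hom_add[OF f] Kc submodule_add[OF K] by (metis image_eqI)
  next
    fix r a assume r: "r \<in> carrier R" and "a \<in> f ` K"
    then obtain x where "x \<in> K" "a = f x" by blast
    then show "r \<odot>\<^bsub>N\<^esub> a \<in> f ` K" using mod_hom_smult[OF f r] Kc submodule_smult[OF K r] by (metis image_eqI)
  qed
qed

lemma image_carrier_submodule:
  assumes "module R M" "module R N" "f \<in> mod_hom R M N"
  shows "submodule (f ` carrier M) R N"
  using image_submodule[OF assms module.carrier_is_submodule[OF assms(1)]] .

lemma equalizer_submodule: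
  assumes M: "module R M" and N: "module R N" and f: "f \<in> mod_hom R M N" and g: "g \<in> mod_hom R M N"
  shows "submodule {x \<in> carrier M. f x = g x} R M"
proof -
  interpret M: module R M by fact
  show ?thesis
    by (intro M.submodule_intro)
       (auto simp: mod_hom_zero[OF M N f] mod_hom_add[OF f] mod_hom_smult[OF f]
          mod_hom_zero[OF M N g] mod_hom_add[OF g] mod_hom_smult[OF g])
qed

lemma mod_hom_span:
  assumes M: "module R M" and N: "module R N" and f: "f \<in> mod_hom R M N" and A: "A \<subseteq> carrier M"
  shows "f ` mod_span R M A = mod_span R N (f ` A)"
proof
  interpret M: module R M by fact
  interpret N: module R N by fact
  have fA: "f ` A \<subseteq> carrier N" using mod_hom_closed[OF f] A by blast
  have "mod_span R M A \<subseteq> {x \<in> carrier M. f x \<in> mod_span R N (f ` A)}"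
    using A N.span_incl[of "f ` A"]
    by (intro M.span_least vimage_submodule[OF M N f] N.span_submodule fA) auto
  then show "f ` mod_span R M A \<subseteq> mod_span R N (f ` A)" by blast
  show "mod_span R N (f ` A) \<subseteq> f ` mod_span R M A"
    using M.span_incl[of A]
    by (intro N.span_least image_submodule[OF M N f] M.span_submodule A) auto
qed

text \<open>An element of \<open>J\<close> times an image has a preimage in \<open>J\<close> times the source. For syzygies this
  trades a condition inside the syzygy module for one on the free module above it.\<close>

lemma mod_hom_ideal_smult:
  assumes M: "module R M" and N: "module R N" and f: "f \<in> mod_hom R M N" and J: "J \<subseteq> carrier R"
  shows "f ` ideal_smult R J M = ideal_smult R J (N\<lparr>carrier := f ` carrier M\<rparr>)"
proof -
  interpret M: module R M by fact
  interpret N: module R N by fact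
  have "f ` {r \<odot>\<^bsub>M\<^esub> x | r x. r \<in> J \<and> x \<in> carrier M}
      = {r \<odot>\<^bsub>N\<^esub> y | r y. r \<in> J \<and> y \<in> f ` carrier M}" (is "f ` ?A = ?B")
  proof
    show "f ` ?A \<subseteq> ?B" using mod_hom_smult[OF f subsetD[OF J]] by blast
    show "?B \<subseteq> f ` ?A"
    proof
      fix z assume "z \<in> ?B"
      then obtain r x where rx: "r \<in> J" "x \<in> carrier M" "z = r \<odot>\<^bsub>N\<^esub> f x" by blast
      then have "z = f (r \<odot>\<^bsub>M\<^esub> x)" using mod_hom_smult[OF f, of r x] J by auto
      then show "z \<in> f ` ?A" using rx by blast
    qed
  qed
  moreover have "?A \<subseteq> carrier M" using J by auto
  ultimately show ?thesis
    using mod_hom_span[OF M N f, of ?A]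
    unfolding N.ideal_smult_eq[OF image_carrier_submodule[OF M N f] J]
    by (simp add: ideal_smult_def)
qed

lemma mod_hom_ideal_smult_subset:
  assumes M: "module R M" and N: "module R N" and f: "f \<in> mod_hom R M N" and J: "J \<subseteq> carrier R"
    and x: "x \<in> ideal_smult R J M"
  shows "f x \<in> ideal_smult R J N"
proof -
  interpret N: module R N by fact
  have "f x \<in> ideal_smult R J (N\<lparr>carrier := f ` carrier M\<rparr>)"
    using x mod_hom_ideal_smult[OF M N f J] by blast
  also have "\<dots> \<subseteq> ideal_smult R J (N\<lparr>carrier := carrier N\<rparr>)"
    by (intro N.ideal_smult_sub_mono image_carrier_submodule[OF M N f] N.carrier_is_submodule J)
       (use mod_hom_closed[OF f] in auto)
  finally show ?thesis by simp
qed

section \<open>Powers of an ideal\<close>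

lemma ideal_pow_ideal:
  assumes "cring R" "ideal m R" shows "ideal (ideal_pow R m q) R"
proof -
  interpret cring R by fact
  show ?thesis by (induction q) (auto intro: oneideal ideal_prod_is_ideal assms)
qed

lemma ideal_pow_carrier:
  assumes "cring R" "ideal m R" shows "ideal_pow R m q \<subseteq> carrier R"
  using ideal_pow_ideal[OF assms, of q] additive_subgroup.a_subset ideal.axioms(1) by blast

lemma ideal_pow_antimono:
  assumes "cring R" "ideal m R" "p \<le> q" shows "ideal_pow R m q \<subseteq> ideal_pow R m p"
proof -
  interpret cring R by fact
  have "ideal_pow R m (Suc n) \<subseteq> ideal_pow R m n" for n
    using ideal_prod_inter[OF assms(2) ideal_pow_ideal[OF assms(1,2), of n]] by auto
  then show ?thesis using assms(3) by (rule lift_Suc_antimono_le)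
qed

lemma ideal_smult_pow_antimono:
  assumes "cring R" "ideal m R" "module R M" "p \<le> q"
  shows "ideal_smult R (ideal_pow R m q) M \<subseteq> ideal_smult R (ideal_pow R m p) M"
  using ideal_pow_antimono[OF assms(1,2,4)] module.ideal_smult_mono[OF assms(3)] by blast

section \<open>Free modules\<close>

text \<open>Allowing arbitrary finite index sets lets monomials serve as a basis.\<close>

definition fmod :: "('a, 'r) ring_scheme \<Rightarrow> 'i set \<Rightarrow> ('a, 'i \<Rightarrow> 'a) module"
  where "fmod R I =
    \<lparr>carrier = {x. (\<forall>i\<in>I. x i \<in> carrier R) \<and> (\<forall>i. i \<notin> I \<longrightarrow> x i = \<zero>\<^bsub>R\<^esub>)},
     mult = undefined, one = undefined,
     zero = (\<lambda>i. \<zero>\<^bsub>R\<^esub>), add = (\<lambda>x y i. x i \<oplus>\<^bsub>R\<^esub> y i), smult = (\<lambda>r x i. r \<otimes>\<^bsub>R\<^esub> x i)\<rparr>"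

definition unit_vec :: "('a, 'r) ring_scheme \<Rightarrow> 'i \<Rightarrow> 'i \<Rightarrow> 'a"
  where "unit_vec R i = (\<lambda>j. if j = i then \<one>\<^bsub>R\<^esub> else \<zero>\<^bsub>R\<^esub>)"

definition lincomb ::
  "('a, 'b, 'm) module_scheme \<Rightarrow> 'i set \<Rightarrow> ('i \<Rightarrow> 'b) \<Rightarrow> ('i \<Rightarrow> 'a) \<Rightarrow> 'b"
  where "lincomb M I v x = (\<Oplus>\<^bsub>M\<^esub> i\<in>I. x i \<odot>\<^bsub>M\<^esub> v i)"

lemma cring_zero: "cring R \<Longrightarrow> \<zero>\<^bsub>R\<^esub> \<in> carrier R"
  and cring_one: "cring R \<Longrightarrow> \<one>\<^bsub>R\<^esub> \<in> carrier R"
  by (simp_all add: cring.cring_simprules)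

lemma free_mod_eq_fmod: "free_mod R b = fmod R {..<b}"
  by (auto simp: free_mod_def fmod_def)

lemma fmod_simps [simp]:
  "\<zero>\<^bsub>fmod R I\<^esub> = (\<lambda>i. \<zero>\<^bsub>R\<^esub>)" "x \<oplus>\<^bsub>fmod R I\<^esub> y = (\<lambda>i. x i \<oplus>\<^bsub>R\<^esub> y i)"
  "r \<odot>\<^bsub>fmod R I\<^esub> x = (\<lambda>i. r \<otimes>\<^bsub>R\<^esub> x i)"
  by (simp_all add: fmod_def)

lemma fmod_carrier: "carrier (fmod R I) = {x. (\<forall>i\<in>I. x i \<in> carrier R) \<and> (\<forall>i. i \<notin> I \<longrightarrow> x i = \<zero>\<^bsub>R\<^esub>)}"
  by (simp add: fmod_def)

lemma fmod_coord: "cring R \<Longrightarrow> x \<in> carrier (fmod R I) \<Longrightarrow> x i \<in> carrier R"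
  by (cases "i \<in> I") (auto simp: fmod_carrier cring_zero cring_one)

lemma fmod_module:
  assumes "cring R" shows "module R (fmod R I)"
proof -
  interpret cring R by fact
  note c = fmod_coord[OF assms, of _ I]
  have [simp]: "(\<lambda>i. x i \<oplus>\<^bsub>R\<^esub> y i) \<in> carrier (fmod R I)"
    if "x \<in> carrier (fmod R I)" "y \<in> carrier (fmod R I)" for x y
    using that by (simp add: fmod_carrier)
  have [simp]: "(\<lambda>i. r \<otimes>\<^bsub>R\<^esub> x i) \<in> carrier (fmod R I)"
    if "r \<in> carrier R" "x \<in> carrier (fmod R I)" for r x
    using that by (simp add: fmod_carrier)
  have [simp]: "(\<lambda>i. \<zero>\<^bsub>R\<^esub>) \<in> carrier (fmod R I)"
    by (simp add: fmod_carrier)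
  note c [simp]
  have "abelian_group (fmod R I)"
  proof (rule abelian_groupI)
    fix x assume x: "x \<in> carrier (fmod R I)"
    have "(\<lambda>i. \<ominus>\<^bsub>R\<^esub> x i) \<in> carrier (fmod R I)"
      using x by (simp add: fmod_carrier del: c)
    then show "\<exists>y\<in>carrier (fmod R I). y \<oplus>\<^bsub>fmod R I\<^esub> x = \<zero>\<^bsub>fmod R I\<^esub>"
      by (rule bexI[rotated]) (use x in \<open>simp add: l_neg\<close>)
  qed (simp_all add: a_ac)
  then show ?thesis
    by (intro moduleI) (simp_all add: assms l_distr r_distr m_assoc)
qed

lemma unit_vec_closed: "cring R \<Longrightarrow> i \<in> I \<Longrightarrow> unit_vec R i \<in> carrier (fmod R I)"
  by (auto simp: unit_vec_def fmod_carrier cring_zero cring_one)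

lemma fmod_neg:
  assumes "cring R" "x \<in> carrier (fmod R I)"
  shows "\<ominus>\<^bsub>fmod R I\<^esub> x = (\<lambda>i. \<ominus>\<^bsub>R\<^esub> x i)"
proof -
  interpret cring R by fact
  interpret F: module R "fmod R I" by (rule fmod_module[OF assms(1)])
  have "\<ominus>\<^bsub>fmod R I\<^esub> x = (\<ominus>\<^bsub>R\<^esub> \<one>\<^bsub>R\<^esub>) \<odot>\<^bsub>fmod R I\<^esub> x"
    using F.smult_l_minus[of "\<one>\<^bsub>R\<^esub>" x] assms(2) F.smult_one[OF assms(2)] by simp
  then show ?thesis using assms by (simp add: fmod_coord l_minus)
qed

lemma fmod_mono: "I \<subseteq> J \<Longrightarrow> cring R \<Longrightarrow> carrier (fmod R I) \<subseteq> carrier (fmod R J)"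
  by (auto simp: fmod_carrier cring_zero cring_one)

lemma fmod_submodule:
  assumes "I \<subseteq> J" "cring R" shows "submodule (carrier (fmod R I)) R (fmod R J)"
proof -
  interpret cring R by fact
  interpret J: module R "fmod R J" by (rule fmod_module) fact
  show ?thesis
    using fmod_mono[OF assms] assms by (intro J.submodule_intro) (auto simp: fmod_carrier)
qed

lemma fmod_restrict: "(fmod R J)\<lparr>carrier := carrier (fmod R I)\<rparr> = fmod R I"
  by (simp add: fmod_def)

text \<open>Every vector is the sum of its coordinates times unit vectors; peeling coordinates off one
  at a time avoids sums of functions.\<close>

lemma fmod_mem_submodule:
  assumes R: "cring R" and I: "finite I" and N: "submodule N R (fmod R I)"
    and x: "x \<in> carrier (fmod R I)"
    and coord: "\<And>i. i \<in> I \<Longrightarrow> x i \<odot>\<^bsub>fmod R I\<^esub> unit_vec R i \<in> N"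
  shows "x \<in> N"
proof -
  interpret cring R by fact
  have "x \<in> N" if "J \<subseteq> I" "x \<in> carrier (fmod R J)"
      "\<And>i. i \<in> J \<Longrightarrow> x i \<odot>\<^bsub>fmod R I\<^esub> unit_vec R i \<in> N" for J x
    using finite_subset[OF that(1) I] that
  proof (induction J arbitrary: x rule: finite_induct)
    case empty
    then have "x = \<zero>\<^bsub>fmod R I\<^esub>" by (auto simp: fmod_carrier)
    then show ?case using submodule_zero[OF N] by metis
  next
    case (insert j J)
    let ?y = "x(j := \<zero>\<^bsub>R\<^esub>)"
    have "?y \<in> carrier (fmod R J)" using insert by (auto simp: fmod_carrier)
    moreover have "?y i \<odot>\<^bsub>fmod R I\<^esub> unit_vec R i \<in> N" if "i \<in> J" for i
      using insert.prems(3)[of i] insert.hyps that by auto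
    ultimately have y: "?y \<in> N" using insert by auto
    have xc: "x i \<in> carrier R" for i by (rule fmod_coord[OF R insert.prems(2)])
    have "x j \<odot>\<^bsub>fmod R I\<^esub> unit_vec R j \<oplus>\<^bsub>fmod R I\<^esub> ?y \<in> N"
      using insert.prems(3) by (intro submodule_add[OF N _ y]) simp
    moreover have "x j \<odot>\<^bsub>fmod R I\<^esub> unit_vec R j \<oplus>\<^bsub>fmod R I\<^esub> ?y = x"
      using xc by (auto simp: unit_vec_def fun_eq_iff)
    ultimately show ?case by simp
  qed
  from this[OF subset_refl x coord] show ?thesis .
qed

lemma fmod_spanned:
  assumes "cring R" "finite I"
  shows "mod_span R (fmod R I) (unit_vec R ` I) = carrier (fmod R I)"
proof -
  interpret F: module R "fmod R I" by (rule fmod_module[OF assms(1)])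
  have uI: "unit_vec R ` I \<subseteq> carrier (fmod R I)" using unit_vec_closed[OF assms(1)] by auto
  note sp = F.span_submodule[OF uI]
  have "x \<in> mod_span R (fmod R I) (unit_vec R ` I)" if x: "x \<in> carrier (fmod R I)" for x
  proof (rule fmod_mem_submodule[OF assms sp x])
    fix i assume "i \<in> I"
    then show "x i \<odot>\<^bsub>fmod R I\<^esub> unit_vec R i \<in> mod_span R (fmod R I) (unit_vec R ` I)"
      using F.span_incl[of "unit_vec R ` I"]
      by (intro submodule_smult[OF sp] fmod_coord[OF assms(1) x]) auto
  qed
  then show ?thesis using submodule_carrier[OF sp] by blast
qed

lemma fmod_mem_ideal_smult:
  assumes R: "cring R" and I: "finite I" and J: "J \<subseteq> carrier R"
    and x: "x \<in> carrier (fmod R I)" and coord: "\<And>i. i \<in> I \<Longrightarrow> x i \<in> J"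
  shows "x \<in> ideal_smult R J (fmod R I)"
proof -
  interpret F: module R "fmod R I" by (rule fmod_module[OF R])
  show ?thesis
    by (rule fmod_mem_submodule[OF R I F.ideal_smult_submodule[OF J] x])
       (intro F.ideal_smult_incl coord unit_vec_closed[OF R])
qed

lemma fmod_hom_ext:
  assumes "cring R" "finite I" "module R N" "f \<in> mod_hom R (fmod R I) N" "g \<in> mod_hom R (fmod R I) N"
    and "\<And>i. i \<in> I \<Longrightarrow> f (unit_vec R i) = g (unit_vec R i)" and "x \<in> carrier (fmod R I)"
  shows "f x = g x"
proof -
  interpret F: module R "fmod R I" by (rule fmod_module[OF assms(1)])
  have "mod_span R (fmod R I) (unit_vec R ` I) \<subseteq> {x \<in> carrier (fmod R I). f x = g x}"
    using assms unit_vec_closed[OF assms(1), of _ I]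
    by (intro F.span_least equalizer_submodule F.module_axioms) auto
  then show ?thesis using assms(7) fmod_spanned[OF assms(1,2)] by auto
qed

lemma lincomb_hom:
  assumes "module R M" "finite I" "\<And>i. i \<in> I \<Longrightarrow> v i \<in> carrier M"
  shows "lincomb M I v \<in> mod_hom R (fmod R I) M"
proof -
  interpret M: module R M by fact
  note c = fmod_coord[OF M.is_cring, of _ I]
  show ?thesis
  proof (rule mod_homI)
    fix x assume x: "x \<in> carrier (fmod R I)"
    show "lincomb M I v x \<in> carrier M"
      unfolding lincomb_def using assms c[OF x] by (intro M.finsum_closed) auto
    fix r assume r: "r \<in> carrier R"
    have "r \<odot>\<^bsub>M\<^esub> lincomb M I v x = (\<Oplus>\<^bsub>M\<^esub> i\<in>I. r \<odot>\<^bsub>M\<^esub> (x i \<odot>\<^bsub>M\<^esub> v i))"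
      unfolding lincomb_def using assms c[OF x] r by (intro M.finsum_smult_ldistr) auto
    also have "\<dots> = lincomb M I v (r \<odot>\<^bsub>fmod R I\<^esub> x)"
      unfolding lincomb_def using assms c[OF x] r by (intro M.finsum_cong') (auto simp: M.smult_assoc1)
    finally show "lincomb M I v (r \<odot>\<^bsub>fmod R I\<^esub> x) = r \<odot>\<^bsub>M\<^esub> lincomb M I v x" ..
  next
    fix x y assume x: "x \<in> carrier (fmod R I)" and y: "y \<in> carrier (fmod R I)"
    have "lincomb M I v x \<oplus>\<^bsub>M\<^esub> lincomb M I v y = (\<Oplus>\<^bsub>M\<^esub> i\<in>I. x i \<odot>\<^bsub>M\<^esub> v i \<oplus>\<^bsub>M\<^esub> y i \<odot>\<^bsub>M\<^esub> v i)"
      unfolding lincomb_def using assms c[OF x] c[OF y] by (intro M.finsum_addf[symmetric]) auto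
    also have "\<dots> = lincomb M I v (x \<oplus>\<^bsub>fmod R I\<^esub> y)"
      unfolding lincomb_def using assms c[OF x] c[OF y]
      by (intro M.finsum_cong') (auto simp: M.smult_l_distr)
    finally show "lincomb M I v (x \<oplus>\<^bsub>fmod R I\<^esub> y) = lincomb M I v x \<oplus>\<^bsub>M\<^esub> lincomb M I v y" ..
  qed
qed

lemma lincomb_unit_vec:
  assumes "module R M" "finite I" "\<And>i. i \<in> I \<Longrightarrow> v i \<in> carrier M" "i \<in> I"
  shows "lincomb M I v (unit_vec R i) = v i"
proof -
  interpret M: module R M by fact
  have "lincomb M I v (unit_vec R i) = (\<Oplus>\<^bsub>M\<^esub> j\<in>I. if i = j then v j else \<zero>\<^bsub>M\<^esub>)"
    unfolding lincomb_def using assms by (intro M.finsum_cong') (auto simp: unit_vec_def)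
  also have "\<dots> = v i" using assms by (intro M.finsum_singleton) auto
  finally show ?thesis .
qed

lemma lincomb_image:
  assumes "module R M" "finite I" "\<And>i. i \<in> I \<Longrightarrow> v i \<in> carrier M"
  shows "lincomb M I v ` carrier (fmod R I) = mod_span R M (v ` I)"
proof -
  interpret M: module R M by fact
  have "lincomb M I v ` carrier (fmod R I)
      = mod_span R M (lincomb M I v ` unit_vec R ` I)"
    unfolding fmod_spanned[OF M.is_cring assms(2), symmetric]
    by (rule mod_hom_span[OF fmod_module[OF M.is_cring] assms(1) lincomb_hom[OF assms]])
       (auto simp: unit_vec_closed M.is_cring)
  also have "lincomb M I v ` unit_vec R ` I = v ` I"
    using lincomb_unit_vec[OF assms] by (force simp: image_image)
  finally show ?thesis .
qed

text \<open>Free modules are projective: lifting the images of the unit vectors is enough.\<close>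

lemma fmod_lift:
  assumes R: "cring R" and I: "finite I" and P: "module R P" and N: "module R N"
    and f: "f \<in> mod_hom R (fmod R I) N" and p: "p \<in> mod_hom R P N"
    and onto: "\<And>x. x \<in> carrier (fmod R I) \<Longrightarrow> f x \<in> p ` carrier P"
  obtains g where "g \<in> mod_hom R (fmod R I) P" "\<And>x. x \<in> carrier (fmod R I) \<Longrightarrow> p (g x) = f x"
proof -
  have "\<exists>y. y \<in> carrier P \<and> p y = f (unit_vec R i)" if "i \<in> I" for i
    using onto[OF unit_vec_closed[OF R that]] by auto
  then obtain v where v: "\<And>i. i \<in> I \<Longrightarrow> v i \<in> carrier P \<and> p (v i) = f (unit_vec R i)" by metis
  have g: "lincomb P I v \<in> mod_hom R (fmod R I) P" using v by (intro lincomb_hom P I) auto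
  have "p (lincomb P I v x) = f x" if "x \<in> carrier (fmod R I)" for x
    by (rule fmod_hom_ext[OF R I N mod_hom_comp[OF g p] f])
       (use v that in \<open>auto simp: lincomb_unit_vec[OF P I]\<close>)
  with g show thesis using that by blast
qed

section \<open>The linear part and vanishing of maps between Tor modules\<close>

context abelian_group
begin

lemma minus_zero_right: "x \<in> carrier G \<Longrightarrow> x \<ominus> \<zero> = x"
  by (simp add: a_minus_def)

lemma minus_minus_cancel: "x \<in> carrier G \<Longrightarrow> y \<in> carrier G \<Longrightarrow> x \<ominus> (x \<ominus> y) = y"
  by (simp add: a_minus_def minus_add a_assoc[symmetric] r_neg)

lemma add_minus_cancel_right: "x \<in> carrier G \<Longrightarrow> y \<in> carrier G \<Longrightarrow> (x \<oplus> y) \<ominus> y = x"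
  by (simp add: a_minus_def a_assoc r_neg)

lemma minus_self: "x \<in> carrier G \<Longrightarrow> x \<ominus> x = \<zero>"
  by (simp add: a_minus_def r_neg)

end

lemma coset_eq_iff:
  assumes "module R M" "submodule U R M" "x \<in> carrier M" "y \<in> carrier M"
  shows "U +>\<^bsub>M\<^esub> x = U +>\<^bsub>M\<^esub> y \<longleftrightarrow> x \<ominus>\<^bsub>M\<^esub> y \<in> U"
proof -
  interpret M: module R M by fact
  have sg: "subgroup U (add_monoid M)" using assms(2) by (rule submodule.axioms)
  note Uc = submodule_carrier[OF assms(2)]
  show ?thesis
  proof
    assume eq: "U +>\<^bsub>M\<^esub> x = U +>\<^bsub>M\<^esub> y"
    have "\<zero>\<^bsub>M\<^esub> \<oplus>\<^bsub>M\<^esub> x \<in> U +>\<^bsub>M\<^esub> x"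
      using submodule_zero[OF assms(2)] Uc assms(3) by (intro M.a_rcosI)
    then obtain u where u: "u \<in> U" "x = u \<oplus>\<^bsub>M\<^esub> y" using assms(3) eq by (auto simp: a_r_coset_def')
    then have "x \<ominus>\<^bsub>M\<^esub> y = u" using Uc assms(4) by (auto simp: a_minus_def M.a_assoc M.r_neg)
    with u show "x \<ominus>\<^bsub>M\<^esub> y \<in> U" by simp
  next
    assume "x \<ominus>\<^bsub>M\<^esub> y \<in> U"
    then have "(x \<ominus>\<^bsub>M\<^esub> y) \<oplus>\<^bsub>M\<^esub> y \<in> U +>\<^bsub>M\<^esub> y" using Uc assms(4) by (intro M.a_rcosI)
    moreover have "(x \<ominus>\<^bsub>M\<^esub> y) \<oplus>\<^bsub>M\<^esub> y = x" using assms(3,4) by (simp add: a_minus_def M.a_assoc M.l_neg)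
    ultimately show "U +>\<^bsub>M\<^esub> x = U +>\<^bsub>M\<^esub> y"
      using M.a_repr_independence[OF _ assms(4) sg] by metis
  qed
qed

lemma coset_eq_self_iff:
  assumes "module R M" "submodule U R M" "x \<in> carrier M"
  shows "U +>\<^bsub>M\<^esub> x = U \<longleftrightarrow> x \<in> U"
proof -
  interpret M: module R M by fact
  have sg: "subgroup U (add_monoid M)" using assms(2) by (rule submodule.axioms)
  show ?thesis using M.a_coset_join1 M.a_coset_join2 sg assms(3) by metis
qed

lemma coset_add:
  assumes "module R M" "submodule U R M" "x \<in> carrier M" "y \<in> carrier M"
  shows "(U +>\<^bsub>M\<^esub> x) <+>\<^bsub>M\<^esub> (U +>\<^bsub>M\<^esub> y) = U +>\<^bsub>M\<^esub> (x \<oplus>\<^bsub>M\<^esub> y)"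
proof -
  interpret M: module R M by fact
  have "abelian_subgroup U M"
    using assms(2) M.abelian_group_axioms
    by (intro abelian_subgroupI3 additive_subgroup.intro submodule.axioms)
  then show ?thesis using assms by (intro abelian_subgroup.a_rcos_sum)
qed

lemma quot_mod_carrier: "carrier (quot_mod (M\<lparr>carrier := W\<rparr>) U) = {U +>\<^bsub>M\<^esub> x | x. x \<in> W}"
  by (auto simp: quot_mod_def A_RCOSETS_def RCOSETS_def a_r_coset_def r_coset_def)

lemma quot_mod_simps [simp]: "\<zero>\<^bsub>quot_mod (M\<lparr>carrier := W\<rparr>) U\<^esub> = U"
  "X \<oplus>\<^bsub>quot_mod (M\<lparr>carrier := W\<rparr>) U\<^esub> Y = X <+>\<^bsub>M\<^esub> Y"
  by (simp_all add: quot_mod_def set_add_def set_mult_def)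

lemma quot_mod_abelian_group:
  assumes M: "module R M" and W: "submodule W R M" and U: "submodule U R M" and "U \<subseteq> W"
  shows "abelian_group (quot_mod (M\<lparr>carrier := W\<rparr>) U)"
proof -
  interpret M: module R M by fact
  have Wc: "x \<in> W \<Longrightarrow> x \<in> carrier M" for x using submodule_carrier[OF W] by blast
  note add = coset_add[OF M U Wc Wc]
  have U0: "U = U +>\<^bsub>M\<^esub> \<zero>\<^bsub>M\<^esub>"
    using coset_eq_self_iff[OF M U] submodule_zero[OF U] by auto
  have zero: "U <+>\<^bsub>M\<^esub> (U +>\<^bsub>M\<^esub> x) = U +>\<^bsub>M\<^esub> x" if "x \<in> W" for x
    using coset_add[OF M U _ Wc[OF that], of "\<zero>\<^bsub>M\<^esub>"] U0 Wc[OF that] by simp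
  show ?thesis
  proof (rule abelian_groupI)
    fix X assume "X \<in> carrier (quot_mod (M\<lparr>carrier := W\<rparr>) U)"
    then obtain x where x: "x \<in> W" "X = U +>\<^bsub>M\<^esub> x" by (auto simp: quot_mod_carrier)
    have "(U +>\<^bsub>M\<^esub> (\<ominus>\<^bsub>M\<^esub> x)) <+>\<^bsub>M\<^esub> X = U"
      using x add[of "\<ominus>\<^bsub>M\<^esub> x" x] submodule_neg[OF W] U0 Wc by (simp add: M.l_neg)
    then show "\<exists>Y\<in>carrier (quot_mod (M\<lparr>carrier := W\<rparr>) U).
        Y \<oplus>\<^bsub>quot_mod (M\<lparr>carrier := W\<rparr>) U\<^esub> X = \<zero>\<^bsub>quot_mod (M\<lparr>carrier := W\<rparr>) U\<^esub>"
      using submodule_neg[OF W x(1)] by (auto simp: quot_mod_carrier)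
  next
    show "\<zero>\<^bsub>quot_mod (M\<lparr>carrier := W\<rparr>) U\<^esub> \<in> carrier (quot_mod (M\<lparr>carrier := W\<rparr>) U)"
      using U0 submodule_zero[OF W] by (auto simp: quot_mod_carrier)
  qed (use submodule_add[OF W] Wc in \<open>auto simp: quot_mod_carrier add zero M.a_ac\<close>)
qed

lemma dsum_mod_abelian_group:
  assumes "\<And>i. abelian_group (M i)"
  shows "abelian_group (dsum_mod M)"
proof -
  have ag: "abelian_monoid (M i)" for i using assms by (simp add: abelian_group_def)
  note simps = abelian_monoid.a_closed[OF ag] abelian_monoid.zero_closed[OF ag]
    abelian_monoid.l_zero[OF ag]
  have fin: "finite {i. x i \<oplus>\<^bsub>M i\<^esub> y i \<noteq> \<zero>\<^bsub>M i\<^esub>}"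
    if "finite {i. x i \<noteq> \<zero>\<^bsub>M i\<^esub>}" "finite {i. y i \<noteq> \<zero>\<^bsub>M i\<^esub>}" for x y
    by (rule finite_subset[OF _ finite_UnI[OF that]]) (auto simp: simps)
  show ?thesis
  proof (rule abelian_groupI)
    fix x assume x: "x \<in> carrier (dsum_mod M)"
    have neg: "\<ominus>\<^bsub>M i\<^esub> x i \<in> carrier (M i)" "(\<ominus>\<^bsub>M i\<^esub> x i) \<oplus>\<^bsub>M i\<^esub> x i = \<zero>\<^bsub>M i\<^esub>" for i
      using x abelian_group.a_inv_closed[OF assms] abelian_group.l_neg[OF assms]
      by (auto simp: dsum_mod_def)
    have "\<ominus>\<^bsub>M i\<^esub> x i = \<zero>\<^bsub>M i\<^esub>" if "x i = \<zero>\<^bsub>M i\<^esub>" for i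
      using neg[of i] that abelian_monoid.r_zero[OF ag] by metis
    then have "finite {i. \<ominus>\<^bsub>M i\<^esub> x i \<noteq> \<zero>\<^bsub>M i\<^esub>}"
      using x by (auto simp: dsum_mod_def intro: rev_finite_subset)
    with neg show "\<exists>y\<in>carrier (dsum_mod M). y \<oplus>\<^bsub>dsum_mod M\<^esub> x = \<zero>\<^bsub>dsum_mod M\<^esub>"
      by (intro bexI[of _ "\<lambda>i. \<ominus>\<^bsub>M i\<^esub> x i"]) (auto simp: dsum_mod_def)
    fix y assume y: "y \<in> carrier (dsum_mod M)"
    have "x i \<oplus>\<^bsub>M i\<^esub> y i = y i \<oplus>\<^bsub>M i\<^esub> x i" for i
      using x y by (intro abelian_monoid.a_comm[OF ag]) (auto simp: dsum_mod_def)
    then show "x \<oplus>\<^bsub>dsum_mod M\<^esub> y = y \<oplus>\<^bsub>dsum_mod M\<^esub> x" by (simp add: dsum_mod_def)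
  qed (auto simp: dsum_mod_def simps fin abelian_monoid.a_assoc[OF ag])
qed

lemma quot_mod_trivial_iff:
  assumes L: "abelian_group L" and U: "subgroup U (add_monoid L)" and Z: "Z \<subseteq> carrier L" "\<zero>\<^bsub>L\<^esub> \<in> Z"
  shows "carrier (quot_mod (L\<lparr>carrier := Z\<rparr>) U) = {\<zero>\<^bsub>quot_mod (L\<lparr>carrier := Z\<rparr>) U\<^esub>} \<longleftrightarrow> Z \<subseteq> U"
proof -
  interpret abelian_group L by fact
  have "U +>\<^bsub>L\<^esub> z = U \<longleftrightarrow> z \<in> U" if "z \<in> Z" for z
    using a_coset_join1[OF _ _ U] a_coset_join2[OF _ U] Z that by blast
  then show ?thesis using Z by (auto simp: quot_mod_carrier)
qed

lemma (in module) smult_hom: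
  assumes "r \<in> carrier R" shows "(\<lambda>x. r \<odot>\<^bsub>M\<^esub> x) \<in> mod_hom R M M"
proof (rule mod_homI)
  fix s x assume "s \<in> carrier R" "x \<in> carrier M"
  then show "r \<odot>\<^bsub>M\<^esub> (s \<odot>\<^bsub>M\<^esub> x) = s \<odot>\<^bsub>M\<^esub> (r \<odot>\<^bsub>M\<^esub> x)"
    using assms by (metis smult_assoc1 m_comm)
qed (use assms in \<open>auto simp: smult_r_distr\<close>)

lemma smult_pow_Suc:
  assumes M: "module R M" and m: "ideal m R" and r: "r \<in> ideal_pow R m p" and y: "y \<in> ideal_smult R m M"
  shows "r \<odot>\<^bsub>M\<^esub> y \<in> ideal_smult R (ideal_pow R m (Suc p)) M"
proof -
  interpret M: module R M by fact
  note pc = ideal_pow_carrier[OF M.is_cring m]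
  have mc: "m \<subseteq> carrier R" by (rule additive_subgroup.a_subset[OF ideal.axioms(1)[OF m]])
  have rc: "r \<in> carrier R" using r pc by blast
  have "ideal_smult R m M \<subseteq> {y \<in> carrier M. r \<odot>\<^bsub>M\<^esub> y \<in> ideal_smult R (ideal_pow R m (Suc p)) M}"
  proof (rule M.ideal_smult_least)
    show "submodule {y \<in> carrier M. r \<odot>\<^bsub>M\<^esub> y \<in> ideal_smult R (ideal_pow R m (Suc p)) M} R M"
      by (rule vimage_submodule[OF M M M.smult_hom[OF rc] M.ideal_smult_submodule[OF pc]])
    fix t z assume t: "t \<in> m" and z: "z \<in> carrier M"
    have "r \<odot>\<^bsub>M\<^esub> (t \<odot>\<^bsub>M\<^esub> z) = (t \<otimes>\<^bsub>R\<^esub> r) \<odot>\<^bsub>M\<^esub> z"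
      using t z rc mc by (metis M.m_comm M.smult_assoc1 subsetD)
    moreover have "t \<otimes>\<^bsub>R\<^esub> r \<in> ideal_pow R m (Suc p)"
      using t r by (auto intro: ideal_prod.prod)
    ultimately show "t \<odot>\<^bsub>M\<^esub> z \<in> {y \<in> carrier M. r \<odot>\<^bsub>M\<^esub> y \<in> ideal_smult R (ideal_pow R m (Suc p)) M}"
      using t z mc by (auto intro: M.ideal_smult_incl)
  qed
  with y show ?thesis by blast
qed

text \<open>For \<open>N = R\<^sup>I/U\<close>, tensoring \<open>0 \<rightarrow> U \<rightarrow> R\<^sup>I \<rightarrow> N \<rightarrow> 0\<close> with \<open>R/m\<^sup>q\<close> identifies \<open>Tor\<^sub>1(R/m\<^sup>q, N)\<close> with
  \<open>(U \<inter> m\<^sup>qR\<^sup>I)/m\<^sup>qU\<close>. The condition says that all maps \<open>Tor\<^sub>1(R/m\<^bsup>q+1\<^esup>, N) \<rightarrow> Tor\<^sub>1(R/m\<^sup>q, N)\<close> are zero.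
  If \<open>U\<close> is the \<open>(j+1)\<close>-st syzygy module of \<open>M\<close>, these are the maps between the \<open>Tor\<^bsub>j+1\<^esub>\<close> of \<open>M\<close>.\<close>

definition tor_maps_vanish :: "('a, 'r) ring_scheme \<Rightarrow> 'a set \<Rightarrow> 'i set \<Rightarrow> ('i \<Rightarrow> 'a) set \<Rightarrow> bool"
  where "tor_maps_vanish R m I U \<longleftrightarrow>
    (\<forall>q. U \<inter> ideal_smult R (ideal_pow R m (Suc q)) (fmod R I)
       \<subseteq> ideal_smult R (ideal_pow R m q) ((fmod R I)\<lparr>carrier := U\<rparr>))"

locale minimal_complex =
  fixes R :: "('a, 'r) ring_scheme" and m :: "'a set"
    and b :: "nat \<Rightarrow> nat" and d :: "nat \<Rightarrow> (nat \<Rightarrow> 'a) \<Rightarrow> (nat \<Rightarrow> 'a)"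
  assumes R: "cring R" and m: "ideal m R"
    and d: "d (Suc j) \<in> mod_hom R (fmod R {..<b (Suc j)}) (fmod R {..<b j})"
    and minimal: "d (Suc j) ` carrier (fmod R {..<b (Suc j)}) \<subseteq> ideal_smult R m (fmod R {..<b j})"
    and exact: "{x \<in> carrier (fmod R {..<b (Suc j)}). d (Suc j) x = \<zero>\<^bsub>fmod R {..<b j}\<^esub>}
        = d (Suc (Suc j)) ` carrier (fmod R {..<b (Suc (Suc j))})"
begin

abbreviation F where "F j \<equiv> fmod R {..<b j}"
abbreviation P where "P p j \<equiv> ideal_smult R (ideal_pow R m p) (F j)"

lemma F: "module R (F j)" by (rule fmod_module[OF R])

lemma pow_carrier: "ideal_pow R m p \<subseteq> carrier R" by (rule ideal_pow_carrier[OF R m])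

lemma P_submodule: "submodule (P p j) R (F j)"
  by (rule module.ideal_smult_submodule[OF F pow_carrier])

lemma P_carrier: "x \<in> P p j \<Longrightarrow> x \<in> carrier (F j)"
  using submodule_carrier[OF P_submodule] by blast

lemma P_zero: "P 0 j = carrier (F j)"
  using module.ideal_smult_carrier[OF F] by simp

lemma P_antimono: "p \<le> q \<Longrightarrow> x \<in> P q j \<Longrightarrow> x \<in> P p j"
  using ideal_smult_pow_antimono[OF R m F] by blast

lemma d_closed: "x \<in> carrier (F (Suc j)) \<Longrightarrow> d (Suc j) x \<in> carrier (F j)"
  by (rule mod_hom_closed[OF d])

lemma d_minus:
  assumes "x \<in> carrier (F (Suc j))" "y \<in> carrier (F (Suc j))"
  shows "d (Suc j) (x \<ominus>\<^bsub>F (Suc j)\<^esub> y) = d (Suc j) x \<ominus>\<^bsub>F j\<^esub> d (Suc j) y"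
  using assms by (rule mod_hom_minus[OF F F d])

lemma dd: "x \<in> carrier (F (Suc (Suc j))) \<Longrightarrow> d (Suc j) (d (Suc (Suc j)) x) = \<zero>\<^bsub>F j\<^esub>"
  using exact by blast

text \<open>Minimality makes the differential raise the adic filtration by one.\<close>

lemma d_P:
  assumes "x \<in> P p (Suc j)" shows "d (Suc j) x \<in> P (Suc p) j"
proof -
  have "P p (Suc j) \<subseteq> {x \<in> carrier (F (Suc j)). d (Suc j) x \<in> P (Suc p) j}"
  proof (rule module.ideal_smult_least[OF F])
    show "submodule {x \<in> carrier (F (Suc j)). d (Suc j) x \<in> P (Suc p) j} R (F (Suc j))"
      by (rule vimage_submodule[OF F F d P_submodule])
    fix r x assume r: "r \<in> ideal_pow R m p" and x: "x \<in> carrier (F (Suc j))"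
    then have rc: "r \<in> carrier R" using pow_carrier by blast
    have "d (Suc j) (r \<odot>\<^bsub>F (Suc j)\<^esub> x) \<in> P (Suc p) j"
      unfolding mod_hom_smult[OF d rc x]
      using x minimal by (intro smult_pow_Suc[OF F m r]) auto
    then show "r \<odot>\<^bsub>F (Suc j)\<^esub> x \<in> {x \<in> carrier (F (Suc j)). d (Suc j) x \<in> P (Suc p) j}"
      using module.smult_closed[OF F rc x] by blast
  qed
  with assms show ?thesis by blast
qed

text \<open>The component of \<open>\<F>\<^sup>sF\<close> in homological degree \<open>j\<close>.\<close>

abbreviation A where "A s j \<equiv> P (s - j) j"

lemma A_Suc: "A (Suc s) j \<subseteq> A s j"
  using P_antimono[of "s - j" "Suc s - j"] by auto

lemma d_A: "x \<in> A s (Suc j) \<Longrightarrow> d (Suc j) x \<in> A s j"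
  using d_P[of x "s - Suc j" j] P_antimono[of "s - j" "Suc (s - Suc j)"] by simp

text \<open>Vanishing of the homology of the linear part in homological degree \<open>j + 1\<close>, in terms of elements.\<close>

definition exact_at :: "nat \<Rightarrow> bool" where
  "exact_at j \<longleftrightarrow> (\<forall>s x. x \<in> A s (Suc j) \<and> d (Suc j) x \<in> A (Suc s) j \<longrightarrow>
     (\<exists>y\<in>A s (Suc (Suc j)). x \<ominus>\<^bsub>F (Suc j)\<^esub> d (Suc (Suc j)) y \<in> A (Suc s) (Suc j)))"

lemma filt_carrier: "carrier (filt R m F i j) = A i j"
  by (simp add: filt_def)

lemma filt_quot_eq: "filt_quot R m F i j = quot_mod ((F j)\<lparr>carrier := A i j\<rparr>) (A (Suc i) j)"
  by (simp add: filt_quot_def filt_def)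

lemma filt_quot_carrier: "carrier (filt_quot R m F i j) = {A (Suc i) j +>\<^bsub>F j\<^esub> x | x. x \<in> A i j}"
  by (simp add: filt_quot_eq quot_mod_carrier)

lemma filt_quot_group: "abelian_group (filt_quot R m F i j)"
  unfolding filt_quot_eq by (rule quot_mod_abelian_group[OF F P_submodule P_submodule A_Suc])

lemma lin_part_group: "abelian_group (lin_part R m F j)"
  unfolding lin_part_def by (rule dsum_mod_abelian_group[OF filt_quot_group])

lemma filt_quot_zero: "\<zero>\<^bsub>filt_quot R m F i j\<^esub> = A (Suc i) j"
  by (simp add: filt_quot_eq)

text \<open>The induced differential may be computed on any representative, because the differential respects
  the filtration.\<close>

lemma filt_quot_d_coset:
  assumes x: "x \<in> carrier (F (Suc j))"
  shows "filt_quot_d R m F d i (Suc j) (A (Suc i) (Suc j) +>\<^bsub>F (Suc j)\<^esub> x)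
       = A (Suc i) j +>\<^bsub>F j\<^esub> d (Suc j) x"
proof -
  interpret J: module R "F (Suc j)" by (rule F)
  interpret J': module R "F j" by (rule F)
  let ?X = "A (Suc i) (Suc j) +>\<^bsub>F (Suc j)\<^esub> x"
  have const: "A (Suc i) j +>\<^bsub>F j\<^esub> d (Suc j) y = A (Suc i) j +>\<^bsub>F j\<^esub> d (Suc j) x" if "y \<in> ?X" for y
  proof -
    from that obtain u where u: "u \<in> A (Suc i) (Suc j)" "y = u \<oplus>\<^bsub>F (Suc j)\<^esub> x"
      by (auto simp: a_r_coset_def')
    have uc: "u \<in> carrier (F (Suc j))" using u(1) P_carrier by blast
    note du = d_closed[OF uc] and dx = d_closed[OF x]
    have "d (Suc j) y \<ominus>\<^bsub>F j\<^esub> d (Suc j) x = d (Suc j) u"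
      unfolding u(2) mod_hom_add[OF d uc x] by (rule J'.add_minus_cancel_right[OF du dx])
    moreover have "d (Suc j) u \<in> A (Suc i) j" using d_A[OF u(1)] .
    ultimately show ?thesis
      using coset_eq_iff[OF F P_submodule d_closed dx] u uc x J.a_closed by metis
  qed
  have "x \<in> ?X"
    using J.a_rcosI[OF submodule_zero[OF P_submodule] submodule_carrier[OF P_submodule] x] J.l_zero[OF x]
    by metis
  then have "?X \<noteq> {}" by blast
  then show ?thesis
    unfolding filt_quot_d_def filt_carrier diff_Suc_1 by (rule SUP_eq_const) (rule const)
qed

lemma lin_part_carrier:
  "x \<in> carrier (lin_part R m F j) \<longleftrightarrow>
     (\<forall>i. x i \<in> {A (Suc i) j +>\<^bsub>F j\<^esub> y | y. y \<in> A i j}) \<and> finite {i. x i \<noteq> A (Suc i) j}"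
  by (simp add: lin_part_def dsum_mod_def filt_quot_carrier filt_quot_zero)

lemma lin_part_repr:
  assumes "x \<in> carrier (lin_part R m F j)"
  shows "\<exists>y. \<forall>i. y i \<in> A i j \<and> x i = A (Suc i) j +>\<^bsub>F j\<^esub> y i"
proof (rule choice)
  show "\<forall>i. \<exists>y. y \<in> A i j \<and> x i = A (Suc i) j +>\<^bsub>F j\<^esub> y"
    using assms unfolding lin_part_carrier by blast
qed

lemma coset_zero: "A (Suc i) j = A (Suc i) j +>\<^bsub>F j\<^esub> \<zero>\<^bsub>F j\<^esub>"
  using coset_eq_self_iff[OF F P_submodule submodule_zero[OF module.carrier_is_submodule[OF F]]]
    submodule_zero[OF P_submodule] by metis

lemma d_zero: "d (Suc j) \<zero>\<^bsub>F (Suc j)\<^esub> = \<zero>\<^bsub>F j\<^esub>"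
  by (rule mod_hom_zero[OF F F d])

lemma filt_quot_d_zero: "filt_quot_d R m F d i (Suc j) (A (Suc i) (Suc j)) = A (Suc i) j"
  using filt_quot_d_coset[OF submodule_zero[OF module.carrier_is_submodule[OF F]], of i j]
    coset_zero d_zero by metis

lemma lin_part_d_closed:
  assumes "x \<in> carrier (lin_part R m F (Suc j))"
  shows "lin_part_d R m F d (Suc j) x \<in> carrier (lin_part R m F j)"
proof -
  from lin_part_repr[OF assms] obtain y where
    "\<forall>i. y i \<in> A i (Suc j) \<and> x i = A (Suc i) (Suc j) +>\<^bsub>F (Suc j)\<^esub> y i" ..
  then have y: "y i \<in> A i (Suc j)" "x i = A (Suc i) (Suc j) +>\<^bsub>F (Suc j)\<^esub> y i" for i
    by blast+
  have "filt_quot_d R m F d i (Suc j) (x i) = A (Suc i) j +>\<^bsub>F j\<^esub> d (Suc j) (y i)" for i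
    unfolding y(2) using P_carrier[OF y(1)] by (rule filt_quot_d_coset)
  moreover have "{i. filt_quot_d R m F d i (Suc j) (x i) \<noteq> A (Suc i) j} \<subseteq> {i. x i \<noteq> A (Suc i) (Suc j)}"
    using filt_quot_d_zero by force
  then have "finite {i. filt_quot_d R m F d i (Suc j) (x i) \<noteq> A (Suc i) j}"
    using assms finite_subset unfolding lin_part_carrier by blast
  ultimately show ?thesis
    unfolding lin_part_carrier lin_part_d_def using d_A[OF y(1)] by auto
qed

lemma lin_part_add:
  "x \<oplus>\<^bsub>lin_part R m F j\<^esub> y = (\<lambda>i. x i <+>\<^bsub>F j\<^esub> y i)"
  by (simp add: lin_part_def dsum_mod_def filt_quot_eq)

lemma lin_part_d_add:
  assumes "x \<in> carrier (lin_part R m F (Suc j))" "x' \<in> carrier (lin_part R m F (Suc j))"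
  shows "lin_part_d R m F d (Suc j) (x \<oplus>\<^bsub>lin_part R m F (Suc j)\<^esub> x')
    = lin_part_d R m F d (Suc j) x \<oplus>\<^bsub>lin_part R m F j\<^esub> lin_part_d R m F d (Suc j) x'"
proof -
  interpret J: module R "F (Suc j)" by (rule F)
  from lin_part_repr[OF assms(1)] obtain y where
    "\<forall>i. y i \<in> A i (Suc j) \<and> x i = A (Suc i) (Suc j) +>\<^bsub>F (Suc j)\<^esub> y i" ..
  then have y: "y i \<in> A i (Suc j)" "x i = A (Suc i) (Suc j) +>\<^bsub>F (Suc j)\<^esub> y i" for i
    by blast+
  from lin_part_repr[OF assms(2)] obtain y' where
    "\<forall>i. y' i \<in> A i (Suc j) \<and> x' i = A (Suc i) (Suc j) +>\<^bsub>F (Suc j)\<^esub> y' i" ..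
  then have y': "y' i \<in> A i (Suc j)" "x' i = A (Suc i) (Suc j) +>\<^bsub>F (Suc j)\<^esub> y' i" for i
    by blast+
  note c = P_carrier[OF y(1)] and c' = P_carrier[OF y'(1)]
  show ?thesis
    unfolding lin_part_d_def lin_part_add y(2) y'(2) coset_add[OF F P_submodule c c']
      filt_quot_d_coset[OF c] filt_quot_d_coset[OF c'] filt_quot_d_coset[OF J.a_closed[OF c c']]
      mod_hom_add[OF d c c'] coset_add[OF F P_submodule d_closed[OF c] d_closed[OF c']] ..
qed

lemma lin_part_boundaries_subgroup:
  "subgroup (boundaries (lin_part R m F) (lin_part_d R m F d) j) (add_monoid (lin_part R m F j))"
proof -
  have "group_hom (add_monoid (lin_part R m F (Suc j))) (add_monoid (lin_part R m F j))
      (lin_part_d R m F d (Suc j))"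
    using abelian_group.a_group[OF lin_part_group] lin_part_d_closed lin_part_d_add
    by (intro group_hom.intro group_hom_axioms.intro) (auto simp: hom_def)
  then show ?thesis unfolding boundaries_def using group_hom.img_is_subgroup by fastforce
qed

lemma lin_part_zero: "\<zero>\<^bsub>lin_part R m F j\<^esub> = (\<lambda>i. A (Suc i) j)"
  by (simp add: lin_part_def dsum_mod_def filt_quot_zero)

text \<open>The linear part is a direct sum over \<open>s\<close> of complexes, so exactness can be tested for one \<open>s\<close> at a
  time. In the other direction, the preimages chosen for the components of a cycle must again have
  finite support; hence zero is chosen wherever the cycle vanishes.\<close>

lemma homology_trivial_iff:
  "carrier (homology (lin_part R m F) (lin_part_d R m F d) (Suc j))
     = {\<zero>\<^bsub>homology (lin_part R m F) (lin_part_d R m F d) (Suc j)\<^esub>} \<longleftrightarrow> exact_at j"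
proof -
  let ?Z = "cycles (lin_part R m F) (lin_part_d R m F d) (Suc j)"
  let ?B = "boundaries (lin_part R m F) (lin_part_d R m F d) (Suc j)"
  have Zc: "?Z \<subseteq> carrier (lin_part R m F (Suc j))" by (auto simp: cycles_def)
  have Z: "z \<in> ?Z \<longleftrightarrow> z \<in> carrier (lin_part R m F (Suc j)) \<and>
      (\<forall>i. filt_quot_d R m F d i (Suc j) (z i) = A (Suc i) j)" for z
    by (auto simp: cycles_def lin_part_d_def lin_part_zero fun_eq_iff)
  have B: "z \<in> ?B \<longleftrightarrow> (\<exists>w\<in>carrier (lin_part R m F (Suc (Suc j))).
      \<forall>i. z i = filt_quot_d R m F d i (Suc (Suc j)) (w i))" for z
    by (auto simp: boundaries_def lin_part_d_def fun_eq_iff image_iff)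
  have self: "A (Suc s) j +>\<^bsub>F j\<^esub> x = A (Suc s) j \<longleftrightarrow> x \<in> A (Suc s) j" if "x \<in> carrier (F j)" for x s j
    by (rule coset_eq_self_iff[OF F P_submodule that])
  have "\<zero>\<^bsub>lin_part R m F (Suc j)\<^esub> \<in> ?Z"
    using abelian_monoid.zero_closed[OF abelian_group.axioms(1)[OF lin_part_group], of "Suc j"]
    unfolding Z lin_part_zero filt_quot_d_zero by blast
  then have "?thesis \<longleftrightarrow> (?Z \<subseteq> ?B \<longleftrightarrow> exact_at j)"
    unfolding homology_def
    using quot_mod_trivial_iff[OF lin_part_group lin_part_boundaries_subgroup Zc] by simp
  also have "?Z \<subseteq> ?B \<longleftrightarrow> exact_at j"
  proof
    assume ZB: "?Z \<subseteq> ?B"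
    show "exact_at j"
      unfolding exact_at_def
    proof (intro allI impI)
      fix s x assume x: "x \<in> A s (Suc j) \<and> d (Suc j) x \<in> A (Suc s) j"
      then have xc: "x \<in> carrier (F (Suc j))" using P_carrier by blast
      define z where "z = (\<lambda>t. if t = s then A (Suc s) (Suc j) +>\<^bsub>F (Suc j)\<^esub> x else A (Suc t) (Suc j))"
      have "z \<in> carrier (lin_part R m F (Suc j))"
        unfolding lin_part_carrier
      proof (intro conjI allI)
        fix i show "z i \<in> {A (Suc i) (Suc j) +>\<^bsub>F (Suc j)\<^esub> y |y. y \<in> A i (Suc j)}"
        proof (cases "i = s")
          case True
          then show ?thesis using x unfolding z_def by auto
        next
          case False
          then have "z i = A (Suc i) (Suc j) +>\<^bsub>F (Suc j)\<^esub> \<zero>\<^bsub>F (Suc j)\<^esub>"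
            using coset_zero[of i "Suc j"] unfolding z_def by (simp only: if_False)
          then show ?thesis using submodule_zero[OF P_submodule] by blast
        qed
      next
        show "finite {i. z i \<noteq> A (Suc i) (Suc j)}"
          by (rule finite_subset[of _ "{s}"]) (auto simp: z_def)
      qed
      moreover have "filt_quot_d R m F d i (Suc j) (z i) = A (Suc i) j" for i
      proof (cases "i = s")
        case True
        show ?thesis
          unfolding z_def True if_P[OF refl] filt_quot_d_coset[OF xc] self[OF d_closed[OF xc]]
          using x by blast
      next
        case False
        show ?thesis unfolding z_def if_not_P[OF False] by (rule filt_quot_d_zero)
      qed
      ultimately have "z \<in> ?B" using Z ZB by blast
      then obtain w where w: "w \<in> carrier (lin_part R m F (Suc (Suc j)))"
        "z s = filt_quot_d R m F d s (Suc (Suc j)) (w s)" unfolding B by blast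
      from w(1) obtain y where y: "y \<in> A s (Suc (Suc j))"
        "w s = A (Suc s) (Suc (Suc j)) +>\<^bsub>F (Suc (Suc j))\<^esub> y" unfolding lin_part_carrier by blast
      note yc = P_carrier[OF y(1)]
      have "A (Suc s) (Suc j) +>\<^bsub>F (Suc j)\<^esub> x = A (Suc s) (Suc j) +>\<^bsub>F (Suc j)\<^esub> d (Suc (Suc j)) y"
        using w(2) unfolding y(2) filt_quot_d_coset[OF yc] by (simp add: z_def)
      then show "\<exists>y\<in>A s (Suc (Suc j)). x \<ominus>\<^bsub>F (Suc j)\<^esub> d (Suc (Suc j)) y \<in> A (Suc s) (Suc j)"
        using y(1) coset_eq_iff[OF F P_submodule xc d_closed[OF yc]] by blast
    qed
  next
    assume E: "exact_at j"
    show "?Z \<subseteq> ?B"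
    proof
      fix z assume z: "z \<in> ?Z"
      define Q where "Q s w \<longleftrightarrow> w \<in> {A (Suc s) (Suc (Suc j)) +>\<^bsub>F (Suc (Suc j))\<^esub> y | y. y \<in> A s (Suc (Suc j))}
          \<and> z s = filt_quot_d R m F d s (Suc (Suc j)) w
          \<and> (z s = A (Suc s) (Suc j) \<longrightarrow> w = A (Suc s) (Suc (Suc j)))" for s w
      have "\<exists>w. Q s w" for s
      proof (cases "z s = A (Suc s) (Suc j)")
        case True
        have "A (Suc s) (Suc (Suc j)) \<in> {A (Suc s) (Suc (Suc j)) +>\<^bsub>F (Suc (Suc j))\<^esub> y | y. y \<in> A s (Suc (Suc j))}"
          using coset_zero[of s "Suc (Suc j)"] submodule_zero[OF P_submodule] by blast
        moreover have "z s = filt_quot_d R m F d s (Suc (Suc j)) (A (Suc s) (Suc (Suc j)))"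
          unfolding True by (rule filt_quot_d_zero[symmetric])
        ultimately show ?thesis unfolding Q_def by blast
      next
        case False
        from z obtain x where x: "x \<in> A s (Suc j)" "z s = A (Suc s) (Suc j) +>\<^bsub>F (Suc j)\<^esub> x"
          unfolding Z lin_part_carrier by blast
        note xc = P_carrier[OF x(1)]
        have "filt_quot_d R m F d s (Suc j) (z s) = A (Suc s) j" using z unfolding Z by blast
        then have "d (Suc j) x \<in> A (Suc s) j"
          unfolding x(2) filt_quot_d_coset[OF xc] self[OF d_closed[OF xc]] .
        with E x(1) obtain y where y: "y \<in> A s (Suc (Suc j))"
          "x \<ominus>\<^bsub>F (Suc j)\<^esub> d (Suc (Suc j)) y \<in> A (Suc s) (Suc j)" unfolding exact_at_def by blast
        note yc = P_carrier[OF y(1)]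
        have "z s = filt_quot_d R m F d s (Suc (Suc j)) (A (Suc s) (Suc (Suc j)) +>\<^bsub>F (Suc (Suc j))\<^esub> y)"
          unfolding x(2) filt_quot_d_coset[OF yc] coset_eq_iff[OF F P_submodule xc d_closed[OF yc]]
          using y(2) .
        then show ?thesis unfolding Q_def using y(1) False by blast
      qed
      then obtain w where "\<And>s. Q s (w s)" by metis
      then have w: "w s \<in> {A (Suc s) (Suc (Suc j)) +>\<^bsub>F (Suc (Suc j))\<^esub> y | y. y \<in> A s (Suc (Suc j))}"
          "z s = filt_quot_d R m F d s (Suc (Suc j)) (w s)"
          "z s = A (Suc s) (Suc j) \<Longrightarrow> w s = A (Suc s) (Suc (Suc j))" for s
        unfolding Q_def by blast+
      have "finite {s. z s \<noteq> A (Suc s) (Suc j)}" using z unfolding Z lin_part_carrier by blast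
      moreover have "{s. w s \<noteq> A (Suc s) (Suc (Suc j))} \<subseteq> {s. z s \<noteq> A (Suc s) (Suc j)}"
        using w(3) by blast
      ultimately have "finite {s. w s \<noteq> A (Suc s) (Suc (Suc j))}" using finite_subset by blast
      then have "w \<in> carrier (lin_part R m F (Suc (Suc j)))"
        unfolding lin_part_carrier using w(1) by blast
      then show "z \<in> ?B" unfolding B using w(2) by blast
    qed
  qed
  finally show ?thesis by blast
qed

definition tor_vanish :: "nat \<Rightarrow> bool" where
  "tor_vanish j \<longleftrightarrow> tor_maps_vanish R m {..<b j} (d (Suc j) ` carrier (F (Suc j)))"

lemma tor_vanish_iff:
  "tor_vanish j \<longleftrightarrow> (\<forall>q. \<forall>x\<in>carrier (F (Suc j)). d (Suc j) x \<in> P (Suc q) j \<longrightarrow>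
     (\<exists>y\<in>P q (Suc j). d (Suc j) x = d (Suc j) y))"
  unfolding tor_vanish_def tor_maps_vanish_def
    mod_hom_ideal_smult[OF F F d pow_carrier, symmetric] by blast

text \<open>If \<open>d x\<close> lies in \<open>m\<^bsup>q+1\<^esup>\<close> times the free module, then \<open>x\<close> can be corrected by boundaries so that it
  moves one step deeper into the adic filtration at a time, until it lies in \<open>m\<^sup>q\<close> times its module.\<close>

lemma exact_imp_tor_vanish:
  assumes "exact_at j" shows "tor_vanish j"
  unfolding tor_vanish_iff
proof (intro allI ballI impI)
  interpret J: module R "F (Suc j)" by (rule F)
  interpret J': module R "F j" by (rule F)
  fix q x assume x: "x \<in> carrier (F (Suc j))" and dx: "d (Suc j) x \<in> P (Suc q) j"
  have "p \<le> q \<Longrightarrow> \<exists>y\<in>P p (Suc j). d (Suc j) x = d (Suc j) y" for p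
  proof (induction p)
    case 0
    then show ?case using x P_zero by blast
  next
    case (Suc p)
    then obtain y where y: "y \<in> P p (Suc j)" "d (Suc j) x = d (Suc j) y" by auto
    note yc = P_carrier[OF y(1)]
    have "d (Suc j) y \<in> P (Suc (Suc p)) j"
      using P_antimono[OF _ dx, of "Suc (Suc p)"] Suc.prems y(2) by simp
    with y(1) obtain z where z: "z \<in> A (p + Suc j) (Suc (Suc j))"
      "y \<ominus>\<^bsub>F (Suc j)\<^esub> d (Suc (Suc j)) z \<in> P (Suc p) (Suc j)"
      using assms[unfolded exact_at_def, rule_format, of y "p + Suc j"]
      by (auto simp: Suc_diff_le)
    note zc = P_carrier[OF z(1)]
    have "d (Suc j) (y \<ominus>\<^bsub>F (Suc j)\<^esub> d (Suc (Suc j)) z) = d (Suc j) y"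
      unfolding d_minus[OF yc d_closed[OF zc]] dd[OF zc]
      by (rule J'.minus_zero_right[OF d_closed[OF yc]])
    then show ?case using z(2) y(2) by metis
  qed
  then show "\<exists>y\<in>P q (Suc j). d (Suc j) x = d (Suc j) y" by blast
qed

text \<open>Vanishing in degree \<open>j\<close> writes an element \<open>x\<close> as a sum of a deeper element \<open>y\<close> and a boundary
  \<open>d z\<close>; vanishing in degree \<open>j + 1\<close>, applied to \<open>d z\<close>, moves \<open>z\<close> to the required depth.\<close>

lemma tor_vanish_imp_exact:
  assumes T: "tor_vanish j" "tor_vanish (Suc j)" shows "exact_at j"
  unfolding exact_at_def
proof (intro allI impI)
  interpret J: module R "F (Suc j)" by (rule F)
  fix s x assume x: "x \<in> A s (Suc j) \<and> d (Suc j) x \<in> A (Suc s) j"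
  then have xc: "x \<in> carrier (F (Suc j))" using P_carrier by blast
  show "\<exists>y\<in>A s (Suc (Suc j)). x \<ominus>\<^bsub>F (Suc j)\<^esub> d (Suc (Suc j)) y \<in> A (Suc s) (Suc j)"
  proof (cases "s < Suc j")
    case True
    have z: "\<zero>\<^bsub>F (Suc (Suc j))\<^esub> \<in> A s (Suc (Suc j))" by (rule submodule_zero[OF P_submodule])
    have "x \<ominus>\<^bsub>F (Suc j)\<^esub> d (Suc (Suc j)) \<zero>\<^bsub>F (Suc (Suc j))\<^esub> \<in> carrier (F (Suc j))"
      using d_closed[OF P_carrier[OF z]] xc by blast
    moreover have "A (Suc s) (Suc j) = carrier (F (Suc j))" using True P_zero by simp
    ultimately show ?thesis using z by blast
  next
    case False
    define p where "p = s - Suc j"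
    have sp: "s = p + Suc j" using False by (simp add: p_def)
    have xp: "x \<in> P p (Suc j)" and dx: "d (Suc j) x \<in> P (Suc (Suc p)) j"
      using x by (simp_all add: sp Suc_diff_le)
    from T(1) xc dx obtain y where y: "y \<in> P (Suc p) (Suc j)" "d (Suc j) x = d (Suc j) y"
      unfolding tor_vanish_iff by blast
    note yc = P_carrier[OF y(1)]
    have diff: "x \<ominus>\<^bsub>F (Suc j)\<^esub> (x \<ominus>\<^bsub>F (Suc j)\<^esub> y) = y"
      by (rule J.minus_minus_cancel[OF xc yc])
    have "d (Suc j) (x \<ominus>\<^bsub>F (Suc j)\<^esub> y) = \<zero>\<^bsub>F j\<^esub>"
      unfolding d_minus[OF xc yc] y(2)
      by (rule abelian_group.minus_self[OF module.axioms(2)[OF F] d_closed[OF yc]])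
    moreover have "x \<ominus>\<^bsub>F (Suc j)\<^esub> y \<in> carrier (F (Suc j))" using xc yc by blast
    ultimately obtain z where z: "z \<in> carrier (F (Suc (Suc j)))"
      "x \<ominus>\<^bsub>F (Suc j)\<^esub> y = d (Suc (Suc j)) z" using exact by blast
    \<comment> \<open>For \<open>p = 0\<close> no depth is required of \<open>z\<close>; the truncated \<open>p - 1\<close> covers this case.\<close>
    have dz: "d (Suc (Suc j)) z \<in> P p (Suc j)"
      unfolding z(2)[symmetric] using xp P_antimono[OF _ y(1), of p]
      by (intro submodule_minus[OF P_submodule]) auto
    have "\<exists>z'\<in>P (p - 1) (Suc (Suc j)). d (Suc (Suc j)) z = d (Suc (Suc j)) z'"
    proof (cases p)
      case 0
      then show ?thesis using z(1) P_zero by auto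
    next
      case (Suc p')
      then show ?thesis using T(2) z(1) dz unfolding tor_vanish_iff by auto
    qed
    then obtain z' where z': "z' \<in> P (p - 1) (Suc (Suc j))" "d (Suc (Suc j)) z = d (Suc (Suc j)) z'" by blast
    have "x \<ominus>\<^bsub>F (Suc j)\<^esub> d (Suc (Suc j)) z' = y" using z(2) z'(2) diff by metis
    then show ?thesis using z'(1) y(1) by (auto simp: sp Suc_diff_le)
  qed
qed

text \<open>A positive degree with nonzero homology is one where the maps between Tor modules do not vanish, or just
  below one. This does not change the supremum. Homology in degree 0 contributes 0, which is the
  supremum of the empty set.\<close>

lemma Sup_homology:
  "Sup {enat i | i. carrier (homology (lin_part R m F) (lin_part_d R m F d) i)
      \<noteq> {\<zero>\<^bsub>homology (lin_part R m F) (lin_part_d R m F d) i\<^esub>}}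
   = Sup {enat (Suc j) | j. \<not> tor_vanish j}" (is "Sup ?A = Sup ?B")
proof (rule antisym)
  have B: "enat (Suc j) \<le> Sup ?B" if "\<not> tor_vanish j" for j
    using that by (intro Sup_upper) blast
  show "Sup ?A \<le> Sup ?B"
  proof (rule Sup_least)
    fix e assume "e \<in> ?A"
    then obtain i where i: "e = enat i" "carrier (homology (lin_part R m F) (lin_part_d R m F d) i)
      \<noteq> {\<zero>\<^bsub>homology (lin_part R m F) (lin_part_d R m F d) i\<^esub>}" by blast
    show "e \<le> Sup ?B"
    proof (cases i)
      case 0
      then show ?thesis using i by (simp add: zero_enat_def[symmetric])
    next
      case (Suc j)
      then have "\<not> exact_at j" using i homology_trivial_iff by blast
      then consider "\<not> tor_vanish j" | "\<not> tor_vanish (Suc j)" using tor_vanish_imp_exact by blast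
      then show ?thesis
      proof cases
        case 1
        then show ?thesis using B[of j] i Suc by simp
      next
        case 2
        have "e \<le> enat (Suc (Suc j))" using i Suc by simp
        also have "\<dots> \<le> Sup ?B" using B[OF 2] .
        finally show ?thesis .
      qed
    qed
  qed
  show "Sup ?B \<le> Sup ?A"
  proof (rule Sup_subset_mono)
    show "?B \<subseteq> ?A"
    proof
      fix e assume "e \<in> ?B"
      then obtain j where j: "e = enat (Suc j)" "\<not> tor_vanish j" by blast
      then have "\<not> exact_at j" using exact_imp_tor_vanish by blast
      then show "e \<in> ?A" unfolding homology_trivial_iff[symmetric] j(1) by blast
    qed
  qed
qed

end

lemma min_free_res_minimal_complex:
  assumes "cring R" "ideal m R" "min_free_res R m M b d \<epsilon>"
  shows "minimal_complex R m b d"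
  using assms unfolding min_free_res_def Let_def free_mod_eq_fmod boundaries_def cycles_def
  by (intro minimal_complex.intro) auto

text \<open>The resolution obtained here is the one that the choice operator picks in the definition of the
  linearity defect.\<close>

lemma ld_eq_Sup_tor:
  assumes "cring R" "ideal m R" "min_free_res R m M b0 d0 \<epsilon>0"
  obtains b d \<epsilon> where "min_free_res R m M b d \<epsilon>"
    "ld R m M = Sup {enat (Suc j) | j.
       \<not> tor_maps_vanish R m {..<b j} (d (Suc j) ` carrier (fmod R {..<b (Suc j)}))}"
proof -
  obtain b d \<epsilon> where bd: "(SOME (b, d, \<epsilon>). min_free_res R m M b d \<epsilon>) = (b, d, \<epsilon>)"
    using prod_cases3 by blast
  have "min_free_res R m M b d \<epsilon>"
    using someI[of "\<lambda>(b, d, \<epsilon>). min_free_res R m M b d \<epsilon>" "(b0, d0, \<epsilon>0)"] assms(3) bd by simp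
  moreover interpret minimal_complex R m b d
    by (rule min_free_res_minimal_complex[OF assms(1,2)]) fact
  have "ld R m M = Sup {enat (Suc j) | j. \<not> tor_vanish j}"
    unfolding ld_def bd Let_def prod.case free_mod_eq_fmod by (rule Sup_homology)
  ultimately show thesis using that unfolding tor_vanish_def by blast
qed

section \<open>Independence of the resolution\<close>

definition cover ::
  "('a, 'r) ring_scheme \<Rightarrow> 'i set \<Rightarrow> (('i \<Rightarrow> 'a) \<Rightarrow> 'b) \<Rightarrow> ('a, 'b, 'm) module_scheme \<Rightarrow> bool"
  where "cover R I \<pi> N \<longleftrightarrow> finite I \<and> \<pi> \<in> mod_hom R (fmod R I) N \<and> \<pi> ` carrier (fmod R I) = carrier N"

definition syzygy ::
  "('a, 'r) ring_scheme \<Rightarrow> 'i set \<Rightarrow> (('i \<Rightarrow> 'a) \<Rightarrow> 'b) \<Rightarrow> ('a, 'b, 'm) module_scheme \<Rightarrow> ('i \<Rightarrow> 'a) set"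
  where "syzygy R I \<pi> N = {x \<in> carrier (fmod R I). \<pi> x = \<zero>\<^bsub>N\<^esub>}"

abbreviation sub_fmod :: "('a, 'r) ring_scheme \<Rightarrow> 'i set \<Rightarrow> ('i \<Rightarrow> 'a) set \<Rightarrow> ('a, 'i \<Rightarrow> 'a) module"
  where "sub_fmod R I U \<equiv> (fmod R I)\<lparr>carrier := U\<rparr>"

text \<open>\<open>N\<close> is a retract of \<open>N'\<close> up to an endomorphism that factors through the given free cover of \<open>N\<close>. The
  relation is inherited by syzygies and thereby replaces the comparison of whole resolutions up to
  homotopy.\<close>

definition stable_retract ::
  "('a, 'r) ring_scheme \<Rightarrow> 'i set \<Rightarrow> (('i \<Rightarrow> 'a) \<Rightarrow> 'b) \<Rightarrow> ('a, 'b, 'm) module_scheme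
    \<Rightarrow> ('a, 'c, 'n) module_scheme \<Rightarrow> bool"
  where "stable_retract R I \<pi> N N' \<longleftrightarrow>
    (\<exists>\<phi>\<in>mod_hom R N N'. \<exists>\<psi>\<in>mod_hom R N' N. \<exists>\<kappa>\<in>mod_hom R N (fmod R I).
       \<forall>x\<in>carrier N. \<psi> (\<phi> x) = x \<oplus>\<^bsub>N\<^esub> \<pi> (\<kappa> x))"

lemma mod_hom_diff:
  assumes M: "module R M" and N: "module R N" and f: "f \<in> mod_hom R M N" and g: "g \<in> mod_hom R M N"
  shows "(\<lambda>x. f x \<ominus>\<^bsub>N\<^esub> g x) \<in> mod_hom R M N"
proof -
  interpret M: module R M by fact
  interpret N: module R N by fact
  note fc = mod_hom_closed[OF f] and gc = mod_hom_closed[OF g]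
  show ?thesis
  proof (rule mod_homI)
    fix x y assume xy: "x \<in> carrier M" "y \<in> carrier M"
    show "f (x \<oplus>\<^bsub>M\<^esub> y) \<ominus>\<^bsub>N\<^esub> g (x \<oplus>\<^bsub>M\<^esub> y) = (f x \<ominus>\<^bsub>N\<^esub> g x) \<oplus>\<^bsub>N\<^esub> (f y \<ominus>\<^bsub>N\<^esub> g y)"
      using xy fc gc
      by (simp add: mod_hom_add[OF f] mod_hom_add[OF g] a_minus_def N.minus_add N.a_ac)
  next
    fix r x assume rx: "r \<in> carrier R" "x \<in> carrier M"
    show "f (r \<odot>\<^bsub>M\<^esub> x) \<ominus>\<^bsub>N\<^esub> g (r \<odot>\<^bsub>M\<^esub> x) = r \<odot>\<^bsub>N\<^esub> (f x \<ominus>\<^bsub>N\<^esub> g x)"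
      using rx fc gc
      by (simp add: mod_hom_smult[OF f] mod_hom_smult[OF g] a_minus_def N.smult_r_distr N.smult_r_minus)
  qed (use fc gc in auto)
qed

lemma coverD:
  assumes "cover R I \<pi> N"
  shows "finite I" "\<pi> \<in> mod_hom R (fmod R I) N" "\<pi> ` carrier (fmod R I) = carrier N"
  using assms by (auto simp: cover_def)

lemma syzygy_submodule:
  assumes "module R N" "cover R I \<pi> N"
  shows "submodule (syzygy R I \<pi> N) R (fmod R I)"
  unfolding syzygy_def using assms coverD(2) module.axioms(1)
  by (intro kernel_submodule fmod_module) auto

lemma sub_fmod_module:
  assumes "cring R" "submodule U R (fmod R I)"
  shows "module R (sub_fmod R I U)"
  by (rule submodule.submodule_is_module[OF assms(2) fmod_module[OF assms(1)]])

text \<open>Lift \<open>\<phi>\<close> and \<open>\<psi>\<close> to maps \<open>f\<close> and \<open>g\<close> between the covers. On the whole cover, \<open>g f\<close> differs from the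
  identity by \<open>\<kappa> \<pi>\<close>, which vanishes on syzygies, and by a map \<open>s\<close> into the syzygies.\<close>

lemma stable_retract_lift:
  assumes N: "module R N" and N': "module R N'"
    and c: "cover R I \<pi> N" and c': "cover R I' \<pi>' N'" and sr: "stable_retract R I \<pi> N N'"
  obtains f g s where "f \<in> mod_hom R (fmod R I) (fmod R I')" "g \<in> mod_hom R (fmod R I') (fmod R I)"
    "s \<in> mod_hom R (fmod R I) (sub_fmod R I (syzygy R I \<pi> N))"
    "f \<in> mod_hom R (sub_fmod R I (syzygy R I \<pi> N)) (sub_fmod R I' (syzygy R I' \<pi>' N'))"
    "g \<in> mod_hom R (sub_fmod R I' (syzygy R I' \<pi>' N')) (sub_fmod R I (syzygy R I \<pi> N))"
    "\<And>x. x \<in> syzygy R I \<pi> N \<Longrightarrow> g (f x) = x \<oplus>\<^bsub>fmod R I\<^esub> s x"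
proof -
  interpret N: module R N by fact
  interpret N': module R N' by fact
  note R = N.is_cring
  note P = fmod_module[OF R, of I] and P' = fmod_module[OF R, of I']
  interpret P: module R "fmod R I" by (rule P)
  note cD = coverD[OF c] and c'D = coverD[OF c']
  obtain \<phi> \<psi> \<kappa> where \<phi>: "\<phi> \<in> mod_hom R N N'" and \<psi>: "\<psi> \<in> mod_hom R N' N"
    and \<kappa>: "\<kappa> \<in> mod_hom R N (fmod R I)"
    and eq: "\<And>x. x \<in> carrier N \<Longrightarrow> \<psi> (\<phi> x) = x \<oplus>\<^bsub>N\<^esub> \<pi> (\<kappa> x)"
    using sr unfolding stable_retract_def by blast
  note pc = mod_hom_closed[OF cD(2)] and pc' = mod_hom_closed[OF c'D(2)]
  have "\<phi> (\<pi> x) \<in> \<pi>' ` carrier (fmod R I')" if "x \<in> carrier (fmod R I)" for x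
    using mod_hom_closed[OF \<phi> pc[OF that]] c'D(3) by blast
  from fmod_lift[OF R cD(1) P' N' mod_hom_comp[OF cD(2) \<phi>] c'D(2) this]
  obtain f where f: "f \<in> mod_hom R (fmod R I) (fmod R I')"
    "\<And>x. x \<in> carrier (fmod R I) \<Longrightarrow> \<pi>' (f x) = \<phi> (\<pi> x)" by blast
  have "\<psi> (\<pi>' x) \<in> \<pi> ` carrier (fmod R I)" if "x \<in> carrier (fmod R I')" for x
    using mod_hom_closed[OF \<psi> pc'[OF that]] cD(3) by blast
  from fmod_lift[OF R c'D(1) P N mod_hom_comp[OF c'D(2) \<psi>] cD(2) this]
  obtain g where g: "g \<in> mod_hom R (fmod R I') (fmod R I)"
    "\<And>x. x \<in> carrier (fmod R I') \<Longrightarrow> \<pi> (g x) = \<psi> (\<pi>' x)" by blast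
  note fc = mod_hom_closed[OF f(1)] and gc = mod_hom_closed[OF g(1)] and kc = mod_hom_closed[OF \<kappa>]
  define s where "s x = (g (f x) \<ominus>\<^bsub>fmod R I\<^esub> x) \<ominus>\<^bsub>fmod R I\<^esub> \<kappa> (\<pi> x)" for x
  have id: "(\<lambda>x. x) \<in> mod_hom R (fmod R I) (fmod R I)" by (rule mod_homI) auto
  have s_hom: "s \<in> mod_hom R (fmod R I) (fmod R I)"
    unfolding s_def
    by (intro mod_hom_diff[OF P P] mod_hom_comp[OF f(1) g(1)] mod_hom_comp[OF cD(2) \<kappa>] id)
  have s_ker: "s x \<in> syzygy R I \<pi> N" if x: "x \<in> carrier (fmod R I)" for x
  proof -
    have gf: "\<pi> (g (f x)) = \<pi> x \<oplus>\<^bsub>N\<^esub> \<pi> (\<kappa> (\<pi> x))"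
      using g(2)[OF fc[OF x]] f(2)[OF x] eq[OF pc[OF x]] by simp
    have "\<pi> (s x) = (\<pi> (g (f x)) \<ominus>\<^bsub>N\<^esub> \<pi> x) \<ominus>\<^bsub>N\<^esub> \<pi> (\<kappa> (\<pi> x))"
      unfolding s_def using x by (simp add: mod_hom_minus[OF P N cD(2)] fc gc kc pc)
    also have "\<dots> = \<zero>\<^bsub>N\<^esub>"
      unfolding gf using pc[OF x] pc[OF kc[OF pc[OF x]]]
      by (simp add: a_minus_def N.a_ac N.r_neg)
    finally show ?thesis using mod_hom_closed[OF s_hom x] by (simp add: syzygy_def)
  qed
  have zero: "\<phi> \<zero>\<^bsub>N\<^esub> = \<zero>\<^bsub>N'\<^esub>" "\<psi> \<zero>\<^bsub>N'\<^esub> = \<zero>\<^bsub>N\<^esub>" "\<kappa> \<zero>\<^bsub>N\<^esub> = \<zero>\<^bsub>fmod R I\<^esub>"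
    using mod_hom_zero[OF N N' \<phi>] mod_hom_zero[OF N' N \<psi>] mod_hom_zero[OF N P \<kappa>] by auto
  show thesis
  proof (rule that[OF f(1) g(1)])
    show "s \<in> mod_hom R (fmod R I) (sub_fmod R I (syzygy R I \<pi> N))"
      using s_hom s_ker by (rule mod_hom_into_sub)
    show "f \<in> mod_hom R (sub_fmod R I (syzygy R I \<pi> N)) (sub_fmod R I' (syzygy R I' \<pi>' N'))"
      using f(2) fc zero
      by (intro mod_hom_into_sub mod_hom_restrict[OF f(1)]) (auto simp: syzygy_def)
    show "g \<in> mod_hom R (sub_fmod R I' (syzygy R I' \<pi>' N')) (sub_fmod R I (syzygy R I \<pi> N))"
      using g(2) gc zero
      by (intro mod_hom_into_sub mod_hom_restrict[OF g(1)]) (auto simp: syzygy_def)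
    fix x assume "x \<in> syzygy R I \<pi> N"
    then have x: "x \<in> carrier (fmod R I)" "\<pi> x = \<zero>\<^bsub>N\<^esub>" by (auto simp: syzygy_def)
    have "s x = g (f x) \<ominus>\<^bsub>fmod R I\<^esub> x"
      unfolding s_def x(2) zero(3)
      by (rule P.minus_zero_right) (rule P.minus_closed[OF gc[OF fc[OF x(1)]] x(1)])
    then have "x \<oplus>\<^bsub>fmod R I\<^esub> s x = x \<oplus>\<^bsub>fmod R I\<^esub> (g (f x) \<oplus>\<^bsub>fmod R I\<^esub> \<ominus>\<^bsub>fmod R I\<^esub> x)"
      by (simp only: a_minus_def)
    also have "\<dots> = g (f x)"
      using x(1) gc[OF fc[OF x(1)]]
      by (metis P.a_assoc P.a_comm P.add.inv_closed P.r_neg P.r_zero)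
    finally show "g (f x) = x \<oplus>\<^bsub>fmod R I\<^esub> s x" ..
  qed
qed

text \<open>On syzygies \<open>g f\<close> differs from the identity by \<open>s\<close>. Since \<open>s\<close> is defined on a free module, it lifts
  through any cover of the syzygies.\<close>

lemma stable_retract_syzygy:
  assumes N: "module R N" and N': "module R N'"
    and c: "cover R I \<pi> N" and c': "cover R I' \<pi>' N'" and sr: "stable_retract R I \<pi> N N'"
    and c1: "cover R I1 \<pi>1 (sub_fmod R I (syzygy R I \<pi> N))"
  shows "stable_retract R I1 \<pi>1 (sub_fmod R I (syzygy R I \<pi> N)) (sub_fmod R I' (syzygy R I' \<pi>' N'))"
proof -
  interpret N: module R N by fact
  note R = N.is_cring
  note S = sub_fmod_module[OF R syzygy_submodule[OF N c]]
  obtain f g s where fgs: "s \<in> mod_hom R (fmod R I) (sub_fmod R I (syzygy R I \<pi> N))"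
    "f \<in> mod_hom R (sub_fmod R I (syzygy R I \<pi> N)) (sub_fmod R I' (syzygy R I' \<pi>' N'))"
    "g \<in> mod_hom R (sub_fmod R I' (syzygy R I' \<pi>' N')) (sub_fmod R I (syzygy R I \<pi> N))"
    "\<And>x. x \<in> syzygy R I \<pi> N \<Longrightarrow> g (f x) = x \<oplus>\<^bsub>fmod R I\<^esub> s x"
    using stable_retract_lift[OF N N' c c' sr] by metis
  have "s x \<in> \<pi>1 ` carrier (fmod R I1)" if "x \<in> carrier (fmod R I)" for x
    using mod_hom_closed[OF fgs(1) that] coverD(3)[OF c1] by simp
  from fmod_lift[OF R coverD(1)[OF c] fmod_module[OF R] S fgs(1) coverD(2)[OF c1] this]
  obtain t where t: "t \<in> mod_hom R (fmod R I) (fmod R I1)"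
    "\<And>x. x \<in> carrier (fmod R I) \<Longrightarrow> \<pi>1 (t x) = s x" by blast
  note sub = submodule_carrier[OF syzygy_submodule[OF N c]]
  show ?thesis
    unfolding stable_retract_def
  proof (intro bexI[OF _ fgs(2)] bexI[OF _ fgs(3)] bexI[OF _ mod_hom_restrict[OF t(1) sub]] ballI)
    fix x assume "x \<in> carrier (sub_fmod R I (syzygy R I \<pi> N))"
    then show "g (f x) = x \<oplus>\<^bsub>sub_fmod R I (syzygy R I \<pi> N)\<^esub> \<pi>1 (t x)"
      using fgs(4)[of x] t(2)[of x] sub by auto
  qed
qed

text \<open>A syzygy \<open>x\<close> in \<open>m\<^bsup>q+1\<^esup>\<close> times the cover equals \<open>g (f x) - s x\<close>. Here \<open>f x\<close> is controlled by the
  hypothesis on \<open>N'\<close>, and \<open>s\<close> maps \<open>m\<^bsup>q+1\<^esup>\<close> times the cover into \<open>m\<^bsup>q+1\<^esup>\<close> times the syzygies.\<close>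

lemma tor_maps_vanish_stable_retract:
  assumes N: "module R N" and N': "module R N'" and m: "ideal m R"
    and c: "cover R I \<pi> N" and c': "cover R I' \<pi>' N'" and sr: "stable_retract R I \<pi> N N'"
    and T: "tor_maps_vanish R m I' (syzygy R I' \<pi>' N')"
  shows "tor_maps_vanish R m I (syzygy R I \<pi> N)"
  unfolding tor_maps_vanish_def
proof (intro allI subsetI)
  interpret N: module R N by fact
  note R = N.is_cring
  interpret P: module R "fmod R I" by (rule fmod_module[OF R])
  note P' = fmod_module[OF R, of I']
  let ?U = "sub_fmod R I (syzygy R I \<pi> N)" and ?U' = "sub_fmod R I' (syzygy R I' \<pi>' N')"
  note U = sub_fmod_module[OF R syzygy_submodule[OF N c]]
  note U' = sub_fmod_module[OF R syzygy_submodule[OF N' c']]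
  obtain f g s where f: "f \<in> mod_hom R (fmod R I) (fmod R I')" and
    fgs: "s \<in> mod_hom R (fmod R I) ?U" "f \<in> mod_hom R ?U ?U'" "g \<in> mod_hom R ?U' ?U"
    "\<And>x. x \<in> syzygy R I \<pi> N \<Longrightarrow> g (f x) = x \<oplus>\<^bsub>fmod R I\<^esub> s x"
    using stable_retract_lift[OF N N' c c' sr] by metis
  note pc = ideal_pow_carrier[OF R m]
  fix q x assume "x \<in> syzygy R I \<pi> N \<inter> ideal_smult R (ideal_pow R m (Suc q)) (fmod R I)"
  then have x: "x \<in> syzygy R I \<pi> N" "x \<in> ideal_smult R (ideal_pow R m (Suc q)) (fmod R I)" by auto
  have xc: "x \<in> carrier (fmod R I)" using x(1) by (simp add: syzygy_def)
  have "f x \<in> ideal_smult R (ideal_pow R m (Suc q)) (fmod R I')"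
    by (rule mod_hom_ideal_smult_subset[OF P.module_axioms P' f pc x(2)])
  moreover have "f x \<in> syzygy R I' \<pi>' N'" using mod_hom_closed[OF fgs(2)] x(1) by simp
  ultimately have "f x \<in> ideal_smult R (ideal_pow R m q) ?U'"
    using T unfolding tor_maps_vanish_def by blast
  then have gf: "g (f x) \<in> ideal_smult R (ideal_pow R m q) ?U"
    by (rule mod_hom_ideal_smult_subset[OF U' U fgs(3) pc])
  have "s x \<in> ideal_smult R (ideal_pow R m (Suc q)) ?U"
    by (rule mod_hom_ideal_smult_subset[OF P.module_axioms U fgs(1) pc x(2)])
  then have sx: "s x \<in> ideal_smult R (ideal_pow R m q) ?U"
    using ideal_smult_pow_antimono[OF R m U, of q "Suc q"] by auto
  have sub: "submodule (ideal_smult R (ideal_pow R m q) ?U) R (fmod R I)"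
    using module.ideal_smult_submodule[OF U pc] P.submodule_sub_iff[OF syzygy_submodule[OF N c]] by blast
  note sxc = subsetD[OF submodule_carrier[OF sub] sx]
  have "g (f x) \<ominus>\<^bsub>fmod R I\<^esub> s x = x"
    unfolding fgs(4)[OF x(1)] by (rule P.add_minus_cancel_right[OF xc sxc])
  then show "x \<in> ideal_smult R (ideal_pow R m q) ?U"
    using submodule_minus[OF sub gf sx] by metis
qed

lemma stable_retract_iso:
  assumes N: "module R N" and N': "module R N'" and c: "cover R I \<pi> N"
    and h: "h \<in> mod_hom R N N'" and bij: "bij_betw h (carrier N) (carrier N')"
  shows "stable_retract R I \<pi> N N'"
proof -
  interpret N: module R N by fact
  interpret N': module R N' by fact
  interpret P: module R "fmod R I" by (rule fmod_module[OF N.is_cring])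
  define k where "k = inv_into (carrier N) h"
  have kc: "k y \<in> carrier N" and hk: "h (k y) = y" if "y \<in> carrier N'" for y
    using bij that unfolding k_def bij_betw_def by (auto intro: inv_into_into f_inv_into_f)
  have kh: "k (h x) = x" if "x \<in> carrier N" for x
    using bij that unfolding k_def bij_betw_def by auto
  have "k \<in> mod_hom R N' N"
  proof (rule mod_homI)
    fix x y assume "x \<in> carrier N'" "y \<in> carrier N'"
    then have "k (x \<oplus>\<^bsub>N'\<^esub> y) = k (h (k x \<oplus>\<^bsub>N\<^esub> k y))"
      by (simp add: mod_hom_add[OF h] kc hk)
    also have "\<dots> = k x \<oplus>\<^bsub>N\<^esub> k y"
      using \<open>x \<in> carrier N'\<close> \<open>y \<in> carrier N'\<close> by (simp add: kh kc)
    finally show "k (x \<oplus>\<^bsub>N'\<^esub> y) = k x \<oplus>\<^bsub>N\<^esub> k y" .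
  next
    fix r x assume rx: "r \<in> carrier R" "x \<in> carrier N'"
    then have "k (r \<odot>\<^bsub>N'\<^esub> x) = k (h (r \<odot>\<^bsub>N\<^esub> k x))"
      by (simp add: mod_hom_smult[OF h] kc hk)
    also have "\<dots> = r \<odot>\<^bsub>N\<^esub> k x" using rx by (simp add: kh kc)
    finally show "k (r \<odot>\<^bsub>N'\<^esub> x) = r \<odot>\<^bsub>N\<^esub> k x" .
  qed (rule kc)
  moreover have "\<pi> \<zero>\<^bsub>fmod R I\<^esub> = \<zero>\<^bsub>N\<^esub>" using coverD(2)[OF c] by (rule mod_hom_zero[OF P.module_axioms N])
  moreover have "(\<lambda>x. \<zero>\<^bsub>fmod R I\<^esub>) \<in> mod_hom R N (fmod R I)"
    by (intro mod_homI) (simp_all add: P.smult_r_null P.zero_closed P.l_zero del: fmod_simps)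
  ultimately show ?thesis unfolding stable_retract_def
    by (intro bexI[OF _ h] bexI[of _ k] bexI[of _ "\<lambda>x. \<zero>\<^bsub>fmod R I\<^esub>"] ballI)
       (simp_all add: kh del: fmod_simps)
qed

lemma stable_retract_refl:
  assumes "module R N" "cover R I \<pi> N" shows "stable_retract R I \<pi> N N"
  by (rule stable_retract_iso[OF assms(1,1,2), of "\<lambda>x. x"]) (auto simp: mod_hom_def bij_betw_def)

lemma min_free_res_cover:
  assumes "min_free_res R m M b d \<epsilon>"
  shows "cover R {..<b 0} \<epsilon> M"
    "syzygy R {..<b 0} \<epsilon> M = d (Suc 0) ` carrier (fmod R {..<b (Suc 0)})"
    "cring R \<Longrightarrow> cover R {..<b (Suc j)} (d (Suc j))
        (sub_fmod R {..<b j} (d (Suc j) ` carrier (fmod R {..<b (Suc j)})))"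
    "syzygy R {..<b (Suc j)} (d (Suc j)) (sub_fmod R {..<b j} (d (Suc j) ` carrier (fmod R {..<b (Suc j)})))
       = d (Suc (Suc j)) ` carrier (fmod R {..<b (Suc (Suc j))})"
  using assms unfolding min_free_res_def Let_def free_mod_eq_fmod boundaries_def cycles_def
    cover_def syzygy_def
  by (auto intro: mod_hom_into_sub)

lemma min_free_res_stable_retract:
  assumes N: "module R N" and N': "module R N'" and m: "ideal m R"
    and F: "min_free_res R m N b d \<epsilon>" and F': "min_free_res R m N' b' d' \<epsilon>'"
    and sr: "stable_retract R {..<b 0} \<epsilon> N N'"
    and T: "tor_maps_vanish R m {..<b' j} (d' (Suc j) ` carrier (fmod R {..<b' (Suc j)}))"
  shows "tor_maps_vanish R m {..<b j} (d (Suc j) ` carrier (fmod R {..<b (Suc j)}))"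
proof -
  interpret N: module R N by fact
  note R = N.is_cring
  let ?S = "\<lambda>j. sub_fmod R {..<b j} (d (Suc j) ` carrier (fmod R {..<b (Suc j)}))"
  let ?S' = "\<lambda>j. sub_fmod R {..<b' j} (d' (Suc j) ` carrier (fmod R {..<b' (Suc j)}))"
  note c = min_free_res_cover[OF F] and c' = min_free_res_cover[OF F']
  have d: "d (Suc j) \<in> mod_hom R (fmod R {..<b (Suc j)}) (fmod R {..<b j})" for j
    using F by (simp add: min_free_res_def free_mod_eq_fmod Let_def)
  have d': "d' (Suc j) \<in> mod_hom R (fmod R {..<b' (Suc j)}) (fmod R {..<b' j})" for j
    using F' by (simp add: min_free_res_def free_mod_eq_fmod Let_def)
  have S: "module R (?S j)" for j
    by (intro sub_fmod_module R image_carrier_submodule fmod_module d)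
  have S': "module R (?S' j)" for j
    by (intro sub_fmod_module R image_carrier_submodule fmod_module d')
  have step: "stable_retract R {..<b (Suc j)} (d (Suc j)) (?S j) (?S' j)" for j
  proof (induction j)
    case 0
    show ?case
      using stable_retract_syzygy[OF N N' c(1) c'(1) sr] c(3)[OF R] unfolding c(2) c'(2) by blast
  next
    case (Suc j)
    show ?case
      using stable_retract_syzygy[OF S S' c(3)[OF R] c'(3)[OF R] Suc] c(3)[OF R] unfolding c(4) c'(4) by blast
  qed
  show ?thesis
  proof (cases j)
    case 0
    show ?thesis
      using tor_maps_vanish_stable_retract[OF N N' m c(1) c'(1) sr] T unfolding 0 c(2) c'(2) .
  next
    case (Suc i)
    show ?thesis
      using tor_maps_vanish_stable_retract[OF S S' m c(3)[OF R] c'(3)[OF R] step] T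
      unfolding Suc c(4) c'(4) .
  qed
qed

section \<open>Minimal free resolutions exist\<close>

text \<open>Coordinate ideals reduce finite generation of submodules of free modules to that of ideals.\<close>

lemma coord_ideal:
  assumes R: "cring R" and U: "submodule U R (fmod R I)" and M: "module R (fmod R I)"
  shows "ideal {x i | x. x \<in> U} R"
proof -
  interpret cring R by fact
  note Uc = subsetD[OF submodule_carrier[OF U]]
  show ?thesis
  proof (rule idealI)
    show "ring R" by (rule ring_axioms)
    show "subgroup {x i | x. x \<in> U} (add_monoid R)"
    proof (rule add.subgroupI)
      show "{x i | x. x \<in> U} \<subseteq> carrier R" using fmod_coord[OF R Uc] by blast
      show "{x i | x. x \<in> U} \<noteq> {}" using submodule_zero[OF U] by blast
      fix a assume "a \<in> {x i | x. x \<in> U}"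
      then obtain x where x: "x \<in> U" "a = x i" by blast
      have "(\<ominus>\<^bsub>fmod R I\<^esub> x) i = \<ominus>\<^bsub>R\<^esub> a" using fmod_neg[OF R Uc[OF x(1)]] x(2) by simp
      then show "\<ominus>\<^bsub>R\<^esub> a \<in> {x i | x. x \<in> U}" using submodule_neg[OF U x(1)]
        by (intro CollectI exI[of _ "\<ominus>\<^bsub>fmod R I\<^esub> x"]) simp
      fix b assume "b \<in> {x i | x. x \<in> U}"
      then obtain y where y: "y \<in> U" "b = y i" by blast
      then show "a \<oplus>\<^bsub>R\<^esub> b \<in> {x i | x. x \<in> U}"
        using submodule_add[OF U x(1) y(1)] x(2) by (intro CollectI exI[of _ "x \<oplus>\<^bsub>fmod R I\<^esub> y"]) simp
    qed
    fix a r assume a: "a \<in> {x i | x. x \<in> U}" and r: "r \<in> carrier R"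
    then obtain x where x: "x \<in> U" "a = x i" by blast
    show "r \<otimes>\<^bsub>R\<^esub> a \<in> {x i | x. x \<in> U}" using submodule_smult[OF U r x(1)] x(2)
      by (intro CollectI exI[of _ "r \<odot>\<^bsub>fmod R I\<^esub> x"]) simp
    moreover have "a \<in> carrier R" using fmod_coord[OF R Uc[OF x(1)]] x(2) by simp
    ultimately show "a \<otimes>\<^bsub>R\<^esub> r \<in> {x i | x. x \<in> U}" using r m_comm by simp
  qed
qed

text \<open>Generators are found one coordinate at a time: lift generators of the ideal of \<open>j\<close>-th coordinates and
  add generators of the part where the \<open>j\<close>-th coordinate vanishes.\<close>

lemma fmod_noetherian:
  assumes R: "cring R" and noeth: "noetherian_ring R" and "finite I" and "submodule U R (fmod R I)"
  shows "\<exists>A. finite A \<and> A \<subseteq> U \<and> mod_span R (fmod R I) A = U"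
  using assms(3,4)
proof (induction I arbitrary: U rule: finite_induct)
  case empty
  interpret F: module R "fmod R {}" by (rule fmod_module[OF R])
  have "U = {\<zero>\<^bsub>fmod R {}\<^esub>}"
    using submodule_carrier[OF empty] submodule_zero[OF empty] by (auto simp: fmod_carrier)
  then show ?case using F.span_empty by (intro exI[of _ "{}"]) auto
next
  case (insert j I)
  interpret cring R by fact
  let ?F = "fmod R (insert j I)"
  interpret F: module R ?F by (rule fmod_module[OF R])
  note U = insert.prems
  note Uc = subsetD[OF submodule_carrier[OF U]]
  let ?U0 = "U \<inter> carrier (fmod R I)"
  have sI: "submodule (carrier (fmod R I)) R ?F" by (rule fmod_submodule[OF _ R]) auto
  have "submodule ?U0 R ?F"
    using submodule_zero[OF U] submodule_add[OF U] submodule_smult[OF U]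
      submodule_zero[OF sI] submodule_add[OF sI] submodule_smult[OF sI] Uc
    by (intro F.submodule_intro) auto
  then have "submodule ?U0 R (fmod R I)"
    using F.submodule_sub_iff[OF sI] by (auto simp: fmod_restrict)
  from insert.IH[OF this] obtain A0 where A0: "finite A0" "A0 \<subseteq> ?U0" "mod_span R (fmod R I) A0 = ?U0"
    by blast
  have spA0: "mod_span R ?F A0 = ?U0"
    using F.span_sub[OF sI, of A0] A0 by (simp add: fmod_restrict)
  obtain B where B: "B \<subseteq> carrier R" "finite B" "{x j | x. x \<in> U} = Idl\<^bsub>R\<^esub> B"
    using noetherian_ring.finetely_gen[OF noeth coord_ideal[OF R U F.module_axioms]] by blast
  have "\<exists>x. x \<in> U \<and> x j = b" if "b \<in> B" for b
  proof -
    have "b \<in> {x j | x. x \<in> U}" unfolding B(3) by (rule subsetD[OF genideal_self[OF B(1)] that])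
    then show ?thesis by force
  qed
  then obtain u where u: "\<And>b. b \<in> B \<Longrightarrow> u b \<in> U \<and> u b j = b" by metis
  define A where "A = A0 \<union> u ` B"
  have AU: "A \<subseteq> U" using A0(2) u by (auto simp: A_def)
  then have Ac: "A \<subseteq> carrier ?F" using Uc by blast
  note sA = F.span_submodule[OF Ac]
  have "U \<subseteq> mod_span R ?F A"
  proof
    fix x assume x: "x \<in> U"
    have "b \<in> {y j | y. y \<in> mod_span R ?F A}" if "b \<in> B" for b
    proof -
      have "u b \<in> mod_span R ?F A" using that F.span_incl[of A] by (auto simp: A_def)
      then show ?thesis using u[OF that] by (intro CollectI exI[of _ "u b"]) simp
    qed
    then have "Idl\<^bsub>R\<^esub> B \<subseteq> {y j | y. y \<in> mod_span R ?F A}"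
      by (intro genideal_minimal coord_ideal[OF R sA F.module_axioms]) blast
    then have "x j \<in> {y j | y. y \<in> mod_span R ?F A}" using B(3) x by blast
    then obtain y where y: "y \<in> mod_span R ?F A" "y j = x j"
      unfolding mem_Collect_eq by (elim exE conjE) (erule that, simp)
    have yU: "y \<in> U" using F.span_least[OF U AU] y(1) by blast
    have xc: "x \<in> carrier ?F" and yc: "y \<in> carrier ?F" using Uc x yU by auto
    have diffU: "x \<ominus>\<^bsub>?F\<^esub> y \<in> U" by (rule submodule_minus[OF U x yU])
    have "(x \<ominus>\<^bsub>?F\<^esub> y) j = \<zero>\<^bsub>R\<^esub>"
      using fmod_coord[OF R xc] y(2) by (simp add: a_minus_def fmod_neg[OF R yc] r_neg)
    then have "x \<ominus>\<^bsub>?F\<^esub> y \<in> carrier (fmod R I)"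
      using Uc[OF diffU] by (auto simp: fmod_carrier)
    then have "x \<ominus>\<^bsub>?F\<^esub> y \<in> mod_span R ?F A"
      using spA0 diffU F.span_mono[of A0 A] by (auto simp: A_def)
    from submodule_add[OF sA this y(1)] have "(x \<ominus>\<^bsub>?F\<^esub> y) \<oplus>\<^bsub>?F\<^esub> y \<in> mod_span R ?F A" .
    moreover have "(x \<ominus>\<^bsub>?F\<^esub> y) \<oplus>\<^bsub>?F\<^esub> y = x"
      unfolding a_minus_def F.a_assoc[OF xc F.a_inv_closed[OF yc] yc] F.l_neg[OF yc] F.r_zero[OF xc] ..
    ultimately show "x \<in> mod_span R ?F A" by metis
  qed
  moreover have "mod_span R ?F A \<subseteq> U" by (rule F.span_least[OF U AU])
  moreover have "finite A" using A0(1) B(2) by (simp add: A_def)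
  ultimately show ?case using AU by blast
qed

lemma noeth_local_ringD:
  assumes "noeth_local_ring R m"
  shows "cring R" "noetherian_ring R" "maximalideal m R" "ideal m R"
  using assms unfolding noeth_local_ring_def maximalideal_def by auto

text \<open>A nonunit lies in some maximal ideal; the ascending chain condition supplies the upper bounds for
  Zorn's lemma.\<close>

lemma local_unit:
  assumes "noeth_local_ring R m" "a \<in> carrier R" "a \<notin> m"
  shows "\<exists>u\<in>carrier R. u \<otimes>\<^bsub>R\<^esub> a = \<one>\<^bsub>R\<^esub>"
proof (rule ccontr)
  assume no: "\<not> ?thesis"
  interpret cring R by (rule noeth_local_ringD[OF assms(1)])
  interpret noetherian_ring R by (rule noeth_local_ringD[OF assms(1)])
  define S where "S = {I. ideal I R \<and> a \<in> I \<and> I \<noteq> carrier R}"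
  have "PIdl\<^bsub>R\<^esub> a \<in> S"
  proof -
    have "\<one>\<^bsub>R\<^esub> \<notin> PIdl\<^bsub>R\<^esub> a" using no unfolding cgenideal_def by auto
    then show ?thesis
      using cgenideal_ideal[OF assms(2)] cgenideal_self[OF assms(2)] one_closed unfolding S_def by blast
  qed
  then have "S \<noteq> {}" by blast
  moreover have "\<Union>C \<in> S" if "C \<noteq> {}" "subset.chain S C" for C
  proof -
    have "subset.chain {I. ideal I R} C"
      using that(2) unfolding S_def subset.chain_def by blast
    from ideal_chain_is_trivial[OF that(1) this] have "\<Union>C \<in> C" .
    then show ?thesis using that(2) unfolding subset.chain_def by blast
  qed
  ultimately obtain J where J: "J \<in> S" "\<And>X. X \<in> S \<Longrightarrow> J \<subseteq> X \<Longrightarrow> X = J"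
    using subset_Zorn_nonempty[of S] by blast
  have "maximalideal J R"
  proof (rule maximalidealI)
    show "ideal J R" "carrier R \<noteq> J" using J(1) by (auto simp: S_def)
    fix K assume K: "ideal K R" "J \<subseteq> K" "K \<subseteq> carrier R"
    show "K = J \<or> K = carrier R" using J K by (auto simp: S_def)
  qed
  then have "J = m" using assms(1) unfolding noeth_local_ring_def by blast
  then show False using J(1) assms(3) by (simp add: S_def)
qed

text \<open>A relation among generators of smallest possible number has all its coefficients in the
  maximal ideal: a coefficient outside is a unit and makes its generator superfluous.\<close>

lemma min_cover_exists:
  assumes loc: "noeth_local_ring R m" and M: "module R M" and fg: "fin_gen R M"
  shows "\<exists>(b :: nat) \<pi>. cover R {..<b} \<pi> M \<and> syzygy R {..<b} \<pi> M \<subseteq> ideal_smult R m (fmod R {..<b})"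
proof -
  interpret M: module R M by fact
  note R = M.is_cring
  have mc: "m \<subseteq> carrier R"
    using noeth_local_ringD(4)[OF loc] by (intro additive_subgroup.a_subset ideal.axioms(1))
  define Q where "Q n \<longleftrightarrow> (\<exists>A. finite A \<and> A \<subseteq> carrier M \<and> mod_span R M A = carrier M \<and> card A = n)" for n
  define n where "n = (LEAST n. Q n)"
  have "\<exists>n. Q n" using fg unfolding fin_gen_def Q_def by blast
  then have "Q n" and least: "\<And>k. Q k \<Longrightarrow> n \<le> k"
    unfolding n_def by (auto intro: LeastI_ex Least_le)
  then obtain A where A: "finite A" "A \<subseteq> carrier M" "mod_span R M A = carrier M" "card A = n"
    unfolding Q_def by blast
  from ex_bij_betw_nat_finite[OF A(1)] A(4) obtain v where "bij_betw v {0..<n} A" by blast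
  then have v: "bij_betw v {..<n} A" by (simp add: atLeast0LessThan)
  then have vA: "v ` {..<n} = A" and inj: "inj_on v {..<n}" by (auto simp: bij_betw_def)
  have vc: "v i \<in> carrier M" if "i \<in> {..<n}" for i using vA A(2) that by blast
  define \<pi> where "\<pi> = lincomb M {..<n} v"
  have \<pi>: "\<pi> \<in> mod_hom R (fmod R {..<n}) M"
    unfolding \<pi>_def using vc by (intro lincomb_hom[OF M]) auto
  have unit: "\<pi> (unit_vec R i) = v i" if "i \<in> {..<n}" for i
    unfolding \<pi>_def using vc that by (intro lincomb_unit_vec[OF M]) auto
  have onto: "\<pi> ` carrier (fmod R {..<n}) = carrier M"
    unfolding \<pi>_def using lincomb_image[OF M, of "{..<n}" v] vc vA A(3) by simp
  interpret F: module R "fmod R {..<n}" by (rule fmod_module[OF R])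
  have "x i \<in> m" if x: "x \<in> carrier (fmod R {..<n})" "\<pi> x = \<zero>\<^bsub>M\<^esub>" and i: "i \<in> {..<n}" for x i
  proof (rule ccontr)
    assume "x i \<notin> m"
    have xc: "x j \<in> carrier R" for j by (rule fmod_coord[OF R x(1)])
    from local_unit[OF loc xc \<open>x i \<notin> m\<close>] obtain u where u: "u \<in> carrier R" "u \<otimes>\<^bsub>R\<^esub> x i = \<one>\<^bsub>R\<^esub>" by blast
    let ?A = "A - {v i}" and ?y = "x(i := \<zero>\<^bsub>R\<^esub>)"
    have Ac: "?A \<subseteq> carrier M" using A(2) by blast
    note sA = M.span_submodule[OF Ac]
    have yc: "?y \<in> carrier (fmod R {..<n})" using x(1) i by (auto simp: fmod_carrier cring_zero[OF R])
    have "?y \<in> {y \<in> carrier (fmod R {..<n}). \<pi> y \<in> mod_span R M ?A}"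
    proof (rule fmod_mem_submodule[OF R _ vimage_submodule[OF F.module_axioms M \<pi> sA] yc])
      fix j assume j: "j \<in> {..<n}"
      have yj: "?y j \<in> carrier R" by (rule fmod_coord[OF R yc])
      have "?y j \<odot>\<^bsub>M\<^esub> v j \<in> mod_span R M ?A"
      proof (cases "j = i")
        case True
        then show ?thesis using submodule_zero[OF sA] vc[OF i] by simp
      next
        case False
        then have "v j \<in> ?A" using j i vA inj_onD[OF inj, of j i] by auto
        then show ?thesis using submodule_smult[OF sA yj] M.span_incl[of ?A] by blast
      qed
      then show "?y j \<odot>\<^bsub>fmod R {..<n}\<^esub> unit_vec R j
          \<in> {y \<in> carrier (fmod R {..<n}). \<pi> y \<in> mod_span R M ?A}"
        using mod_hom_smult[OF \<pi> yj unit_vec_closed[OF R j]] unit[OF j]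
          F.smult_closed[OF yj unit_vec_closed[OF R j]] by (simp del: fmod_simps)
    qed simp
    then have py: "\<pi> ?y \<in> mod_span R M ?A" by blast
    have "x = x i \<odot>\<^bsub>fmod R {..<n}\<^esub> unit_vec R i \<oplus>\<^bsub>fmod R {..<n}\<^esub> ?y"
      using xc by (auto simp: unit_vec_def fun_eq_iff M.is_cring)
    then have "\<pi> x = \<pi> (x i \<odot>\<^bsub>fmod R {..<n}\<^esub> unit_vec R i \<oplus>\<^bsub>fmod R {..<n}\<^esub> ?y)" by simp
    also have "\<dots> = x i \<odot>\<^bsub>M\<^esub> v i \<oplus>\<^bsub>M\<^esub> \<pi> ?y"
      using mod_hom_add[OF \<pi> F.smult_closed[OF xc unit_vec_closed[OF R i]] yc]
        mod_hom_smult[OF \<pi> xc unit_vec_closed[OF R i]] unit[OF i] by metis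
    finally have zero: "x i \<odot>\<^bsub>M\<^esub> v i \<oplus>\<^bsub>M\<^esub> \<pi> ?y = \<zero>\<^bsub>M\<^esub>" using x(2) by simp
    have pyc: "\<pi> ?y \<in> carrier M" using mod_hom_closed[OF \<pi> yc] .
    have "x i \<odot>\<^bsub>M\<^esub> v i = \<ominus>\<^bsub>M\<^esub> \<pi> ?y"
      using M.minus_equality[OF zero] pyc xc vc[OF i] by (metis M.minus_minus M.minus_equality M.a_comm M.smult_closed)
    then have "u \<odot>\<^bsub>M\<^esub> (x i \<odot>\<^bsub>M\<^esub> v i) \<in> mod_span R M ?A"
      using submodule_smult[OF sA u(1) submodule_neg[OF sA py]] by simp
    then have "v i \<in> mod_span R M ?A"
      unfolding M.smult_assoc1[OF u(1) xc[of i] vc[OF i], symmetric] u(2) M.smult_one[OF vc[OF i]] .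
    moreover have "?A \<subseteq> mod_span R M ?A" by (rule M.span_incl)
    ultimately have "A \<subseteq> mod_span R M ?A" by blast
    from M.span_span_least[OF Ac this] have "mod_span R M ?A = carrier M"
      using A(3) submodule_carrier[OF sA] by blast
    then have "Q (card ?A)" unfolding Q_def using A Ac by blast
    from least[OF this] show False
      using A(1,4) vA i by (metis card_Diff1_less image_eqI leD)
  qed
  then have "syzygy R {..<n} \<pi> M \<subseteq> ideal_smult R m (fmod R {..<n})"
    unfolding syzygy_def using mc by (auto intro!: fmod_mem_ideal_smult[OF R])
  moreover have "cover R {..<n} \<pi> M" using \<pi> onto by (simp add: cover_def)
  ultimately show ?thesis by blast
qed

lemma sub_fmod_fin_gen:
  assumes R: "cring R" and noeth: "noetherian_ring R" and "finite I" and U: "submodule U R (fmod R I)"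
  shows "fin_gen R (sub_fmod R I U)"
proof -
  obtain A where A: "finite A" "A \<subseteq> U" "mod_span R (fmod R I) A = U"
    using fmod_noetherian[OF assms] by blast
  have "mod_span R (sub_fmod R I U) A = U"
    using module.span_sub[OF fmod_module[OF R] U A(2)] A(3) by simp
  then show ?thesis unfolding fin_gen_def using A by auto
qed

lemma min_free_res_exists:
  assumes loc: "noeth_local_ring R m" and M: "module R M" and fg: "fin_gen R M"
  shows "\<exists>b d \<epsilon>. min_free_res R m M b d \<epsilon>"
proof -
  note R = noeth_local_ringD(1)[OF loc]
  \<comment> \<open>A partial resolution is recorded by the rank of its last free module and the relations in it.\<close>
  define good where "good s \<longleftrightarrow> submodule (snd s) R (fmod R {..<fst s})
      \<and> snd s \<subseteq> ideal_smult R m (fmod R {..<fst s})" for s :: "nat \<times> (nat \<Rightarrow> 'a) set"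
  define step where "step s s' \<longleftrightarrow> (\<exists>\<pi>. cover R {..<fst s'} \<pi> (sub_fmod R {..<fst s} (snd s))
      \<and> snd s' = syzygy R {..<fst s'} \<pi> (sub_fmod R {..<fst s} (snd s)))" for s s' :: "nat \<times> (nat \<Rightarrow> 'a) set"
  obtain b0 :: nat and \<epsilon> where \<epsilon>: "cover R {..<b0} \<epsilon> M" "syzygy R {..<b0} \<epsilon> M \<subseteq> ideal_smult R m (fmod R {..<b0})"
    using min_cover_exists[OF assms] by blast
  have "\<exists>f. \<forall>n. (good (f n) \<and> (n = 0 \<longrightarrow> f n = (b0, syzygy R {..<b0} \<epsilon> M))) \<and> step (f n) (f (Suc n))"
  proof (rule dependent_nat_choice)
    show "\<exists>s. good s \<and> (0 = (0::nat) \<longrightarrow> s = (b0, syzygy R {..<b0} \<epsilon> M))"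
      using \<epsilon> syzygy_submodule[OF M \<epsilon>(1)] by (auto simp: good_def)
  next
    fix s n assume s: "good s \<and> (n = (0::nat) \<longrightarrow> s = (b0, syzygy R {..<b0} \<epsilon> M))"
    let ?U = "sub_fmod R {..<fst s} (snd s)"
    have sub: "submodule (snd s) R (fmod R {..<fst s})" using s by (simp add: good_def)
    have U: "module R ?U" by (rule sub_fmod_module[OF R sub])
    have "fin_gen R ?U" by (rule sub_fmod_fin_gen[OF R noeth_local_ringD(2)[OF loc] _ sub]) simp
    from min_cover_exists[OF loc U this] obtain b :: nat and \<pi> where
      \<pi>: "cover R {..<b} \<pi> ?U" "syzygy R {..<b} \<pi> ?U \<subseteq> ideal_smult R m (fmod R {..<b})" by blast
    have "good (b, syzygy R {..<b} \<pi> ?U)" using \<pi> syzygy_submodule[OF U \<pi>(1)] by (simp add: good_def)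
    moreover have "step s (b, syzygy R {..<b} \<pi> ?U)" using \<pi>(1) by (auto simp: step_def)
    ultimately show "\<exists>s'. (good s' \<and> (Suc n = 0 \<longrightarrow> s' = (b0, syzygy R {..<b0} \<epsilon> M))) \<and> step s s'"
      by blast
  qed
  then obtain f where f: "\<And>n. good (f n)" "f 0 = (b0, syzygy R {..<b0} \<epsilon> M)" "\<And>n. step (f n) (f (Suc n))"
    by blast
  define b where "b n = fst (f n)" for n
  define K where "K n = snd (f n)" for n
  have "\<exists>\<pi>. cover R {..<b (Suc n)} \<pi> (sub_fmod R {..<b n} (K n))
      \<and> K (Suc n) = syzygy R {..<b (Suc n)} \<pi> (sub_fmod R {..<b n} (K n))" for n
    using f(3)[of n] unfolding step_def b_def K_def .
  then obtain p where p: "\<And>n. cover R {..<b (Suc n)} (p n) (sub_fmod R {..<b n} (K n))"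
    "\<And>n. K (Suc n) = syzygy R {..<b (Suc n)} (p n) (sub_fmod R {..<b n} (K n))" by metis
  have K: "submodule (K n) R (fmod R {..<b n})" "K n \<subseteq> ideal_smult R m (fmod R {..<b n})" for n
    using f(1)[of n] by (auto simp: good_def b_def K_def)
  define d where "d j = p (j - 1)" for j
  have im: "d (Suc j) ` carrier (fmod R {..<b (Suc j)}) = K j" for j
    using coverD(3)[OF p(1)] by (simp add: d_def)
  have dh: "d (Suc j) \<in> mod_hom R (fmod R {..<b (Suc j)}) (fmod R {..<b j})" for j
    unfolding d_def diff_Suc_1
    by (rule mod_hom_from_sub[OF coverD(2)[OF p(1)[of j]] submodule_carrier[OF K(1)]])
  have ker: "{x \<in> carrier (fmod R {..<b (Suc j)}). d (Suc j) x = \<zero>\<^bsub>fmod R {..<b j}\<^esub>} = K (Suc j)" for j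
    unfolding p(2) syzygy_def by (simp add: d_def)
  have b0: "b 0 = b0" "K 0 = syzygy R {..<b0} \<epsilon> M" using f(2) by (simp_all add: b_def K_def)
  have "min_free_res R m M b d \<epsilon>"
    unfolding min_free_res_def Let_def free_mod_eq_fmod boundaries_def im
    using dh K(2) ker coverD[OF \<epsilon>(1)] b0 by (auto simp: cycles_def syzygy_def)
  then show ?thesis by blast
qed

section \<open>Vanishing of maps between Tor modules as an invariant of a module\<close>

text \<open>Vanishing of all maps \<open>Tor\<^bsub>j+1\<^esub>(R/m\<^bsup>q+1\<^esup>, M) \<rightarrow> Tor\<^bsub>j+1\<^esub>(R/m\<^sup>q, M)\<close>. Some minimal resolution has the
  property if and only if every one has it, since any two are related by stable retracts.\<close>

definition tor_vanish_at ::
  "('a, 'r) ring_scheme \<Rightarrow> 'a set \<Rightarrow> ('a, 'c, 'm) module_scheme \<Rightarrow> nat \<Rightarrow> bool"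
  where "tor_vanish_at R m M j \<longleftrightarrow> (\<exists>b d \<epsilon>. min_free_res R m M b d \<epsilon>
     \<and> tor_maps_vanish R m {..<b j} (d (Suc j) ` carrier (fmod R {..<b (Suc j)})))"

lemma tor_vanish_at_eq:
  assumes loc: "noeth_local_ring R m" and M: "module R M" and F: "min_free_res R m M b d \<epsilon>"
  shows "tor_vanish_at R m M j \<longleftrightarrow>
    tor_maps_vanish R m {..<b j} (d (Suc j) ` carrier (fmod R {..<b (Suc j)}))"
  unfolding tor_vanish_at_def
  using min_free_res_stable_retract[OF M M noeth_local_ringD(4)[OF loc] F _
      stable_retract_refl[OF M min_free_res_cover(1)[OF F]]] F by blast

lemma ld_eq:
  assumes loc: "noeth_local_ring R m" and M: "module R M" and fg: "fin_gen R M"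
  shows "ld R m M = Sup {enat (Suc j) | j. \<not> tor_vanish_at R m M j}"
proof -
  obtain b0 d0 \<epsilon>0 where "min_free_res R m M b0 d0 \<epsilon>0" using min_free_res_exists[OF assms] by blast
  from ld_eq_Sup_tor[OF noeth_local_ringD(1,4)[OF loc] this] obtain b d \<epsilon>
    where F: "min_free_res R m M b d \<epsilon>" and eq: "ld R m M = Sup {enat (Suc j) | j.
       \<not> tor_maps_vanish R m {..<b j} (d (Suc j) ` carrier (fmod R {..<b (Suc j)}))}" .
  show ?thesis unfolding eq tor_vanish_at_eq[OF loc M F] ..
qed

lemma tor_vanish_at_iso:
  assumes loc: "noeth_local_ring R m" and M: "module R M" and fg: "fin_gen R M"
    and M': "module R M'" and h: "h \<in> mod_hom R M M'" and bij: "bij_betw h (carrier M) (carrier M')"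
    and T: "tor_vanish_at R m M' j"
  shows "tor_vanish_at R m M j"
proof -
  obtain b d \<epsilon> where F: "min_free_res R m M b d \<epsilon>" using min_free_res_exists[OF loc M fg] by blast
  from T obtain b' d' \<epsilon>' where F': "min_free_res R m M' b' d' \<epsilon>'"
    and T': "tor_maps_vanish R m {..<b' j} (d' (Suc j) ` carrier (fmod R {..<b' (Suc j)}))"
    unfolding tor_vanish_at_def by blast
  show ?thesis
    unfolding tor_vanish_at_eq[OF loc M F]
    by (rule min_free_res_stable_retract[OF M M' noeth_local_ringD(4)[OF loc] F F'
          stable_retract_iso[OF M M' min_free_res_cover(1)[OF F] h bij] T'])
qed

lemma cover_fin_gen:
  assumes "module R M" "cover R I \<pi> M" shows "fin_gen R M"
proof -
  interpret M: module R M by fact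
  note R = M.is_cring and c = coverD[OF assms(2)]
  have "mod_span R M (\<pi> ` unit_vec R ` I) = \<pi> ` mod_span R (fmod R I) (unit_vec R ` I)"
    by (rule mod_hom_span[OF fmod_module[OF R] assms(1) c(2), symmetric])
       (use unit_vec_closed[OF R, of _ I] in blast)
  then have "mod_span R M (\<pi> ` unit_vec R ` I) = carrier M"
    using fmod_spanned[OF R c(1)] c(3) by simp
  moreover have "\<pi> ` unit_vec R ` I \<subseteq> carrier M"
    using mod_hom_closed[OF c(2)] unit_vec_closed[OF R, of _ I] by blast
  moreover have "finite (\<pi> ` unit_vec R ` I)" using c(1) by simp
  ultimately show ?thesis unfolding fin_gen_def by blast
qed

text \<open>\<open>M\<close> is a stable retract of itself relative to any pair of covers, so a minimal cover may be exchanged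
  for the given one.\<close>

lemma tor_vanish_at_0:
  assumes loc: "noeth_local_ring R m" and M: "module R M" and c: "cover R I \<pi> M"
  shows "tor_vanish_at R m M 0 \<longleftrightarrow> tor_maps_vanish R m I (syzygy R I \<pi> M)"
proof -
  note m = noeth_local_ringD(4)[OF loc]
  obtain b d \<epsilon> where F: "min_free_res R m M b d \<epsilon>"
    using min_free_res_exists[OF loc M cover_fin_gen[OF M c]] by blast
  note cF = min_free_res_cover[OF F]
  show ?thesis
    unfolding tor_vanish_at_eq[OF loc M F] cF(2)[symmetric]
    using tor_maps_vanish_stable_retract[OF M M m cF(1) c stable_retract_refl[OF M cF(1)]]
      tor_maps_vanish_stable_retract[OF M M m c cF(1) stable_retract_refl[OF M c]] by blast
qed

text \<open>Dimension shifting: a minimal resolution of \<open>M\<close> without its first module resolves the syzygies in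
  that module, and these and the syzygies of the given cover are stable retracts of each other.\<close>

lemma tor_vanish_at_Suc:
  assumes loc: "noeth_local_ring R m" and M: "module R M" and c: "cover R I \<pi> M"
  shows "tor_vanish_at R m M (Suc j) \<longleftrightarrow> tor_vanish_at R m (sub_fmod R I (syzygy R I \<pi> M)) j"
proof -
  note R = noeth_local_ringD(1)[OF loc] and m = noeth_local_ringD(4)[OF loc]
  obtain b d \<epsilon> where F: "min_free_res R m M b d \<epsilon>"
    using min_free_res_exists[OF loc M cover_fin_gen[OF M c]] by blast
  note cF = min_free_res_cover[OF F]
  let ?S = "sub_fmod R {..<b 0} (syzygy R {..<b 0} \<epsilon> M)"
  let ?U = "sub_fmod R I (syzygy R I \<pi> M)"
  note sU = syzygy_submodule[OF M c]
  have S: "module R ?S" by (rule sub_fmod_module[OF R syzygy_submodule[OF M cF(1)]])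
  have U: "module R ?U" by (rule sub_fmod_module[OF R sU])
  have FS: "min_free_res R m ?S (\<lambda>j. b (Suc j)) (\<lambda>j. d (Suc j)) (d (Suc 0))"
    using F cF(3)[OF R, of 0] cF(4)[of 0] unfolding cF(2) min_free_res_def Let_def free_mod_eq_fmod
    by (auto simp: boundaries_def cycles_def cover_def syzygy_def)
  obtain b' d' \<epsilon>' where FU: "min_free_res R m ?U b' d' \<epsilon>'"
    using min_free_res_exists[OF loc U
        sub_fmod_fin_gen[OF R noeth_local_ringD(2)[OF loc] coverD(1)[OF c] sU]] by blast
  note cS = min_free_res_cover(1)[OF FS] and cU = min_free_res_cover(1)[OF FU]
  have SU: "stable_retract R {..<b (Suc 0)} (d (Suc 0)) ?S ?U"
    by (rule stable_retract_syzygy[OF M M cF(1) c stable_retract_refl[OF M cF(1)] cS])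
  have US: "stable_retract R {..<b' 0} \<epsilon>' ?U ?S"
    by (rule stable_retract_syzygy[OF M M c cF(1) stable_retract_refl[OF M c] cU])
  have "tor_vanish_at R m M (Suc j) \<longleftrightarrow> tor_vanish_at R m ?S j"
    unfolding tor_vanish_at_eq[OF loc M F] tor_vanish_at_eq[OF loc S FS] ..
  also have "\<dots> \<longleftrightarrow> tor_vanish_at R m ?U j"
    unfolding tor_vanish_at_eq[OF loc S FS] tor_vanish_at_eq[OF loc U FU]
    using min_free_res_stable_retract[OF S U m FS FU SU] min_free_res_stable_retract[OF U S m FU FS US]
    by blast
  finally show ?thesis .
qed

section \<open>A graded Hilbert basis theorem\<close>

definition incr :: "nat \<Rightarrow> (nat \<Rightarrow> nat) \<Rightarrow> nat \<Rightarrow> nat"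
  where "incr j a = a(j := Suc (a j))"

definition decr :: "nat \<Rightarrow> (nat \<Rightarrow> nat) \<Rightarrow> nat \<Rightarrow> nat"
  where "decr j a = a(j := a j - 1)"

lemma incr_decr: "a j > 0 \<Longrightarrow> incr j (decr j a) = a"
  by (auto simp: incr_def decr_def)

lemma decr_incr: "decr j (incr j a) = a"
  by (auto simp: incr_def decr_def)

lemma sum_incr_in: "finite A \<Longrightarrow> j \<in> A \<Longrightarrow> sum (incr j a) A = Suc (sum a A)"
  by (simp add: incr_def sum.remove[of A j])

lemma sum_incr_out: "j \<notin> A \<Longrightarrow> sum (incr j a) A = sum a A"
  by (rule sum.cong) (auto simp: incr_def)

lemma less_fun_incr: "less_fun a a' \<Longrightarrow> less_fun (incr j a) (incr j a')"
  unfolding less_fun_def incr_def by force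

text \<open>Dickson's lemma: every sequence of exponent vectors has a subsequence that increases in each
  of finitely many coordinates.\<close>

lemma dickson_subseq:
  fixes f :: "nat \<Rightarrow> nat \<Rightarrow> nat"
  shows "\<exists>r. strict_mono r \<and> (\<forall>j<K. incseq (\<lambda>s. f (r s) j))"
proof (induction K)
  case 0
  show ?case by (intro exI[of _ "\<lambda>s. s"]) (auto simp: strict_mono_def)
next
  case (Suc K)
  then obtain r where r: "strict_mono r" "\<And>j. j < K \<Longrightarrow> incseq (\<lambda>s. f (r s) j)" by blast
  obtain t where t: "strict_mono t" "monoseq (\<lambda>s. f (r (t s)) K)"
    using seq_monosub[of "\<lambda>s. f (r s) K"] by blast
  have comp: "incseq (\<lambda>s. f (r (t (s + N))) j)" if "j < K" for j N
    using r(2)[OF that] strict_mono_mono[OF t(1)] by (auto simp: mono_def)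
  have ex: "\<exists>N. incseq (\<lambda>s. f (r (t (s + N))) K)"
  proof (cases "incseq (\<lambda>s. f (r (t s)) K)")
    case True
    then show ?thesis by (intro exI[of _ 0]) simp
  next
    case False
    then have dec: "decseq (\<lambda>s. f (r (t s)) K)" using t(2) by (auto simp: monoseq_iff)
    \<comment> \<open>A decreasing sequence of naturals is constant once it attains its minimum.\<close>
    define v where "v = (LEAST v. \<exists>s. f (r (t s)) K = v)"
    have "\<exists>s. f (r (t s)) K = v" unfolding v_def by (rule LeastI_ex) blast
    then obtain N where N: "f (r (t N)) K = v" ..
    have "f (r (t (s + N))) K = v" for s
    proof (rule antisym)
      show "f (r (t (s + N))) K \<le> v" using dec N by (auto simp: decseq_def)
      show "v \<le> f (r (t (s + N))) K" unfolding v_def by (rule Least_le) blast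
    qed
    then show ?thesis by (intro exI[of _ N]) simp
  qed
  then obtain N where N: "incseq (\<lambda>s. f (r (t (s + N))) K)" ..
  have "strict_mono (\<lambda>s. r (t (s + N)))"
    using r(1) t(1) by (auto simp: strict_mono_def)
  moreover have "incseq (\<lambda>s. f (r (t (s + N))) j)" if "j < Suc K" for j
    using that comp N by (cases "j = K") auto
  ultimately show ?case by blast
qed

lemma monotone_exponents:
  assumes mono: "\<And>a j. j < K \<Longrightarrow> L a \<subseteq> L (incr j a)"
    and "\<And>j. j \<ge> K \<Longrightarrow> a j = c j" and "\<And>j. j < K \<Longrightarrow> a j \<le> c j"
  shows "L a \<subseteq> L c"
  using assms(2,3)
proof (induction "\<Sum>j<K. c j - a j" arbitrary: c)
  case 0
  then have "a j = c j" for j by (cases "j < K") force+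
  then have "a = c" by auto
  then show ?case by simp
next
  case (Suc s)
  then obtain j where j: "j < K" "a j < c j"
    by (metis (no_types, lifting) diff_is_0_eq' lessThan_iff nat.distinct(1) not_le sum.neutral)
  let ?c = "decr j c"
  have c: "incr j ?c = c" using j by (intro incr_decr) simp
  have "(\<Sum>l<K. c l - a l) = Suc (\<Sum>l<K. ?c l - a l)"
  proof -
    have "(\<Sum>l<K. c l - a l) = (c j - a j) + (\<Sum>l\<in>{..<K} - {j}. c l - a l)"
      using j by (intro sum.remove) auto
    moreover have "(\<Sum>l<K. ?c l - a l) = (?c j - a j) + (\<Sum>l\<in>{..<K} - {j}. ?c l - a l)"
      using j by (intro sum.remove) auto
    moreover have "(\<Sum>l\<in>{..<K} - {j}. ?c l - a l) = (\<Sum>l\<in>{..<K} - {j}. c l - a l)"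
      by (rule sum.cong) (auto simp: decr_def)
    ultimately show ?thesis using j by (simp add: decr_def)
  qed
  then have "L a \<subseteq> L ?c"
    using Suc.hyps(2) Suc.prems j by (intro Suc.hyps(1)) (auto simp: decr_def)
  also have "\<dots> \<subseteq> L (incr j ?c)" by (rule mono[OF j(1)])
  finally show ?case unfolding c .
qed

text \<open>Otherwise there is a sequence of exponents of unbounded degree in the first \<open>k\<close> variables at which
  the ideal strictly grows in each of these directions. After passing to an increasing subsequence,
  the ideals form a chain, which becomes stationary. A later term exceeds an earlier one in one of
  the first \<open>k\<close> coordinates, so the ideal cannot have grown in that direction.\<close>

lemma ideal_exponents_stabilize:
  fixes L :: "(nat \<Rightarrow> nat) \<Rightarrow> 'a set"
  assumes noeth: "noetherian_ring R" and kK: "k \<le> K"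
    and L: "\<And>a. ideal (L a) R" and mono: "\<And>a j. j < K \<Longrightarrow> L a \<subseteq> L (incr j a)"
  shows "\<exists>B. \<forall>a. (\<forall>j\<ge>K. a j = 0) \<longrightarrow> B < (\<Sum>j<k. a j) \<longrightarrow> (\<exists>j<k. 0 < a j \<and> L (decr j a) = L a)"
proof (rule ccontr)
  interpret noetherian_ring R by fact
  assume no: "\<not> ?thesis"
  have "\<forall>B. \<exists>a. (\<forall>j\<ge>K. a j = 0) \<and> B < (\<Sum>j<k. a j) \<and> (\<forall>j<k. 0 < a j \<longrightarrow> L (decr j a) \<noteq> L a)"
    using no by meson
  then obtain f where f0: "\<And>s j. j \<ge> K \<Longrightarrow> f s j = 0" and fdeg: "\<And>s. s < (\<Sum>j<k. f s j)"
    and fL: "\<And>s j. j < k \<Longrightarrow> 0 < f s j \<Longrightarrow> L (decr j (f s)) \<noteq> L (f s)" by metis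
  obtain r where r: "strict_mono r" "\<And>j. j < K \<Longrightarrow> incseq (\<lambda>s. f (r s) j)"
    using dickson_subseq[of K f] by blast
  have le: "L (f (r s)) \<subseteq> L (f (r t))" if "s \<le> t" for s t
    using f0 r(2) that by (intro monotone_exponents[OF mono]) (auto simp: mono_def)
  let ?C = "range (\<lambda>s. L (f (r s)))"
  have "subset.chain {I. ideal I R} ?C"
    unfolding subset_chain_def
  proof (intro conjI ballI)
    fix x y assume "x \<in> ?C" "y \<in> ?C"
    then obtain s t where "x = L (f (r s))" "y = L (f (r t))" by blast
    then show "x \<subseteq> y \<or> y \<subseteq> x" using le[of s t] le[of t s] by (cases "s \<le> t") auto
  qed (use L in auto)
  from ideal_chain_is_trivial[OF _ this] obtain N where N: "\<Union>?C = L (f (r N))" by blast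
  define t where "t = max N (\<Sum>j<k. f (r N) j)"
  have "(\<Sum>j<k. f (r N) j) < (\<Sum>j<k. f (r t) j)"
    using fdeg[of "r t"] strict_mono_imp_increasing[OF r(1), of t] by (simp add: t_def)
  then obtain j where j: "j < k" "f (r N) j < f (r t) j"
    by (metis lessThan_iff not_less sum_mono)
  have Nt: "N \<le> t" by (simp add: t_def)
  have "L (f (r N)) \<subseteq> L (decr j (f (r t)))"
  proof (rule monotone_exponents[OF mono])
    fix l show "f (r N) l = decr j (f (r t)) l" if "l \<ge> K"
      using that f0 j kK by (auto simp: decr_def)
    show "f (r N) l \<le> decr j (f (r t)) l" if "l < K"
      using r(2)[OF that] Nt j by (auto simp: decr_def mono_def)
  qed
  moreover have "L (decr j (f (r t))) \<subseteq> L (f (r t))"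
    using mono[of j "decr j (f (r t))"] incr_decr[of "f (r t)" j] j kK by auto
  moreover have "L (f (r t)) \<subseteq> L (f (r N))" using N by blast
  ultimately have "L (decr j (f (r t))) = L (f (r t))" by blast
  then show False using fL[of j "r t"] j by auto
qed

text \<open>A monomial order: lexicographic in the exponents, with ties broken by the index of the generator.\<close>

definition mono_less :: "nat \<times> (nat \<Rightarrow> nat) \<Rightarrow> nat \<times> (nat \<Rightarrow> nat) \<Rightarrow> bool"
  where "mono_less p p' \<longleftrightarrow> less_fun (snd p) (snd p') \<or> snd p = snd p' \<and> fst p < fst p'"

lemma mono_less_incr: "mono_less (i, a) (i', a') \<Longrightarrow> mono_less (i, incr j a) (i', incr j a')"
  using less_fun_incr by (auto simp: mono_less_def)

lemma mono_less_maximal: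
  assumes "finite J" "J \<noteq> {}"
  shows "\<exists>p\<in>J. \<forall>p'\<in>J. p' \<noteq> p \<longrightarrow> \<not> mono_less p p'"
proof (rule Finite_Set.bex_max_element[OF assms(1) _ _ assms(2)])
  show "asymp_on J mono_less"
    by (rule asymp_onI) (auto simp: mono_less_def less_fun_irrefl dest: less_fun_asym)
  show "transp_on J mono_less"
    by (rule transp_onI) (auto simp: mono_less_def intro: less_fun_trans)
qed

text \<open>Basis elements of bidegree \<open>(n, q)\<close>: the first \<open>k\<close> variables have bidegree \<open>(1, 0)\<close>, the others
  up to \<open>K\<close> have bidegree \<open>(0, 1)\<close>.\<close>

definition mono_index :: "nat \<Rightarrow> nat \<Rightarrow> nat \<Rightarrow> nat \<Rightarrow> nat \<Rightarrow> (nat \<times> (nat \<Rightarrow> nat)) set"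
  where "mono_index b k K n q = {(i, a). i < b \<and> (\<forall>j\<ge>K. a j = 0)
     \<and> (\<Sum>j<k. a j) = n \<and> (\<Sum>j\<in>{k..<K}. a j) = q}"

lemma mono_index_finite: "finite (mono_index b k K n q)"
proof -
  let ?A = "{a. \<forall>j. (j \<in> {..<K} \<longrightarrow> a j \<in> {..n + q}) \<and> (j \<notin> {..<K} \<longrightarrow> a j = (0::nat))}"
  have "a \<in> ?A" if a: "\<forall>j\<ge>K. a j = 0" "(\<Sum>j<k. a j) = n" "(\<Sum>j\<in>{k..<K}. a j) = q" for a :: "nat \<Rightarrow> nat"
  proof -
    have "a j \<le> n + q" for j
    proof (cases "j < k")
      case True
      then have "a j \<le> (\<Sum>j<k. a j)" by (intro member_le_sum) auto
      then show ?thesis using a by simp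
    next
      case False
      show ?thesis
      proof (cases "j < K")
        case True
        then have "a j \<le> (\<Sum>j\<in>{k..<K}. a j)" using False by (intro member_le_sum) auto
        then show ?thesis using a by simp
      qed (use a in auto)
    qed
    then show ?thesis using a(1) by auto
  qed
  then have "mono_index b k K n q \<subseteq> {..<b} \<times> ?A" by (auto simp: mono_index_def)
  moreover have "finite ?A" by (rule finite_set_of_finite_funs) auto
  ultimately show ?thesis by (meson finite_SigmaI finite_lessThan finite_subset)
qed

lemma mono_index_total:
  assumes "(i, a) \<in> mono_index b k K n q" "(i', a') \<in> mono_index b k K n' q'"
  shows "mono_less (i, a) (i', a') \<or> (i, a) = (i', a') \<or> mono_less (i', a') (i, a)"
proof -
  have "finite {j. a j \<noteq> a' j}"
    by (rule finite_subset[of _ "{..<K}"]) (use assms in \<open>auto simp: mono_index_def not_less[symmetric]\<close>, metis)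
  from less_fun_trichotomy[OF this] show ?thesis by (auto simp: mono_less_def)
qed

lemma mono_index_incr_low:
  assumes "(i, a) \<in> mono_index b k K n q" "j < k" "k \<le> K"
  shows "(i, incr j a) \<in> mono_index b k K (Suc n) q"
  using assms by (auto simp: mono_index_def sum_incr_in sum_incr_out) (auto simp: incr_def)

lemma mono_index_incr_high:
  assumes "(i, a) \<in> mono_index b k K n q" "k \<le> j" "j < K"
  shows "(i, incr j a) \<in> mono_index b k K n (Suc q)"
  using assms by (auto simp: mono_index_def sum_incr_in sum_incr_out) (auto simp: incr_def)

lemma mono_index_decr_low:
  assumes "(i, a) \<in> mono_index b k K (Suc n) q" "j < k" "k \<le> K" "0 < a j"
  shows "(i, decr j a) \<in> mono_index b k K n q"
proof -
  have eq: "incr j (decr j a) = a" using assms(4) by (rule incr_decr)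
  have "sum a {..<k} = Suc (sum (decr j a) {..<k})" "sum a {k..<K} = sum (decr j a) {k..<K}"
    using sum_incr_in[of "{..<k}" j "decr j a"] sum_incr_out[of j "{k..<K}" "decr j a"] assms
    by (auto simp: eq)
  moreover have "\<forall>l\<ge>K. decr j a l = 0" using assms by (auto simp: mono_index_def decr_def)
  ultimately show ?thesis using assms by (auto simp: mono_index_def)
qed

text \<open>The module is generated by elements \<open>h i a\<close>, the products of the monomial with exponents \<open>a\<close> and a
  generator with index \<open>i\<close>. They may satisfy linear relations. The sets \<open>W n q\<close> are the components of a
  bigraded submodule for the action of the polynomial ring.\<close>

locale bigraded_submodules = module R M for R (structure) and M (structure) +
  fixes h :: "nat \<Rightarrow> (nat \<Rightarrow> nat) \<Rightarrow> 'c" and X :: "nat \<Rightarrow> 'c \<Rightarrow> 'c" and b k K :: nat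
    and W :: "nat \<Rightarrow> nat \<Rightarrow> 'c set"
  assumes noeth: "noetherian_ring R" and kK: "k \<le> K"
    and h_closed: "h i a \<in> carrier M"
    and X_hom: "j < K \<Longrightarrow> X j \<in> mod_hom R M M"
    and X_h: "j < K \<Longrightarrow> X j (h i a) = h i (incr j a)"
    and W_sub: "submodule (W n q) R M"
    and W_span: "W n q \<subseteq> mod_span R M (case_prod h ` mono_index b k K n q)"
    and X_low: "j < k \<Longrightarrow> X j ` W n q \<subseteq> W (Suc n) q"
    and X_high: "k \<le> j \<Longrightarrow> j < K \<Longrightarrow> X j ` W n q \<subseteq> W n (Suc q)"
begin

definition below :: "nat \<Rightarrow> (nat \<Rightarrow> nat) \<Rightarrow> nat \<Rightarrow> nat \<Rightarrow> 'c set" where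
  "below i a n q = mod_span R M (case_prod h ` {p \<in> mono_index b k K n q. mono_less p (i, a)})"

definition xdeg :: "(nat \<Rightarrow> nat) \<Rightarrow> nat" where "xdeg a = (\<Sum>j<k. a j)"
definition ydeg :: "(nat \<Rightarrow> nat) \<Rightarrow> nat" where "ydeg a = (\<Sum>j\<in>{k..<K}. a j)"

text \<open>Leading coefficients, including zero, of the elements of \<open>W\<close> with leading monomial \<open>h i a\<close>. The
  bidegree is determined by \<open>a\<close>.\<close>

definition lead :: "nat \<Rightarrow> (nat \<Rightarrow> nat) \<Rightarrow> 'a set" where
  "lead i a = {r \<in> carrier R. \<exists>y\<in>below i a (xdeg a) (ydeg a).
     r \<odot>\<^bsub>M\<^esub> h i a \<oplus>\<^bsub>M\<^esub> y \<in> W (xdeg a) (ydeg a)}"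

lemma h_image: "case_prod h ` J \<subseteq> carrier M"
  using h_closed by auto

lemma below_submodule: "submodule (below i a n q) R M"
  unfolding below_def by (rule span_submodule[OF h_image])

lemma below_closed: "y \<in> below i a n q \<Longrightarrow> y \<in> carrier M"
  using submodule_carrier[OF below_submodule] by blast

lemma lead_ideal: "ideal (lead i a) R"
proof (rule idealI)
  note B = below_submodule[of i a "xdeg a" "ydeg a"] and W = W_sub[of "xdeg a" "ydeg a"]
  have closed: "s \<otimes> r \<in> lead i a" if "r \<in> lead i a" "s \<in> carrier R" for r s
  proof -
    from that(1) obtain y where y: "r \<in> carrier R" "y \<in> below i a (xdeg a) (ydeg a)"
      "r \<odot>\<^bsub>M\<^esub> h i a \<oplus>\<^bsub>M\<^esub> y \<in> W (xdeg a) (ydeg a)" by (auto simp: lead_def)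
    have "s \<odot>\<^bsub>M\<^esub> (r \<odot>\<^bsub>M\<^esub> h i a \<oplus>\<^bsub>M\<^esub> y) = (s \<otimes> r) \<odot>\<^bsub>M\<^esub> h i a \<oplus>\<^bsub>M\<^esub> s \<odot>\<^bsub>M\<^esub> y"
      using y that(2) h_closed below_closed[OF y(2)] by (simp add: smult_r_distr smult_assoc1)
    then show ?thesis
      using submodule_smult[OF W that(2) y(3)] submodule_smult[OF B that(2) y(2)] y(1) that(2)
      unfolding lead_def by auto
  qed
  show "ring R" by (rule R.ring_axioms)
  show "subgroup (lead i a) (add_monoid R)"
  proof (rule R.add.subgroupI)
    show "lead i a \<subseteq> carrier R" by (auto simp: lead_def)
    have "\<zero> \<odot>\<^bsub>M\<^esub> h i a \<oplus>\<^bsub>M\<^esub> \<zero>\<^bsub>M\<^esub> \<in> W (xdeg a) (ydeg a)"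
      using submodule_zero[OF W] h_closed by simp
    then show "lead i a \<noteq> {}" using submodule_zero[OF B] unfolding lead_def by blast
    fix r assume r: "r \<in> lead i a"
    then have rc: "r \<in> carrier R" by (simp add: lead_def)
    have "(\<ominus> \<one>) \<otimes> r = \<ominus> r" using rc by (simp add: R.l_minus)
    then show "\<ominus> r \<in> lead i a" using closed[OF r, of "\<ominus> \<one>"] by simp
    fix s assume s: "s \<in> lead i a"
    from r obtain y where y: "y \<in> below i a (xdeg a) (ydeg a)"
      "r \<odot>\<^bsub>M\<^esub> h i a \<oplus>\<^bsub>M\<^esub> y \<in> W (xdeg a) (ydeg a)" by (auto simp: lead_def)
    from s obtain z where z: "s \<in> carrier R" "z \<in> below i a (xdeg a) (ydeg a)"
      "s \<odot>\<^bsub>M\<^esub> h i a \<oplus>\<^bsub>M\<^esub> z \<in> W (xdeg a) (ydeg a)" by (auto simp: lead_def)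
    have "(r \<odot>\<^bsub>M\<^esub> h i a \<oplus>\<^bsub>M\<^esub> y) \<oplus>\<^bsub>M\<^esub> (s \<odot>\<^bsub>M\<^esub> h i a \<oplus>\<^bsub>M\<^esub> z) = (r \<oplus> s) \<odot>\<^bsub>M\<^esub> h i a \<oplus>\<^bsub>M\<^esub> (y \<oplus>\<^bsub>M\<^esub> z)"
      using rc z(1) h_closed below_closed[OF y(1)] below_closed[OF z(2)]
      by (simp add: smult_l_distr M.a_ac)
    then show "r \<oplus> s \<in> lead i a"
      using submodule_add[OF W y(2) z(3)] submodule_add[OF B y(1) z(2)] rc z(1)
      unfolding lead_def by auto
  qed
  fix r s assume rs: "r \<in> lead i a" "s \<in> carrier R"
  show "s \<otimes> r \<in> lead i a" by (rule closed[OF rs])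
  then show "r \<otimes> s \<in> lead i a" using rs R.m_comm by (auto simp: lead_def)
qed

lemma X_below:
  assumes j: "j < K" and y: "y \<in> below i a n q"
    and deg: "\<And>i a. (i, a) \<in> mono_index b k K n q \<Longrightarrow> (i, incr j a) \<in> mono_index b k K n' q'"
  shows "X j y \<in> below i (incr j a) n' q'"
proof -
  let ?J = "{p \<in> mono_index b k K n q. mono_less p (i, a)}"
  have "X j y \<in> X j ` mod_span R M (case_prod h ` ?J)" using y by (simp add: below_def)
  also have "\<dots> = mod_span R M (X j ` case_prod h ` ?J)"
    by (rule mod_hom_span[OF module_axioms module_axioms X_hom[OF j] h_image])
  also have "\<dots> \<subseteq> below i (incr j a) n' q'"
    unfolding below_def
  proof (rule span_mono, rule subsetI)
    fix x assume "x \<in> X j ` case_prod h ` ?J"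
    then obtain i' a' where p: "(i', a') \<in> mono_index b k K n q" "mono_less (i', a') (i, a)"
      "x = X j (h i' a')" by auto
    then have "(i', incr j a') \<in> {p \<in> mono_index b k K n' q'. mono_less p (i, incr j a)}"
      using deg mono_less_incr by blast
    moreover have "x = case_prod h (i', incr j a')" using p(3) X_h[OF j] by simp
    ultimately show "x \<in> case_prod h ` {p \<in> mono_index b k K n' q'. mono_less p (i, incr j a)}"
      by (rule rev_image_eqI)
  qed
  finally show ?thesis .
qed

lemma deg_incr_low: "j < k \<Longrightarrow> xdeg (incr j a) = Suc (xdeg a) \<and> ydeg (incr j a) = ydeg a"
  by (simp add: xdeg_def ydeg_def sum_incr_in sum_incr_out)

lemma deg_incr_high: "k \<le> j \<Longrightarrow> j < K \<Longrightarrow> xdeg (incr j a) = xdeg a \<and> ydeg (incr j a) = Suc (ydeg a)"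
  by (simp add: xdeg_def ydeg_def sum_incr_in sum_incr_out)

lemma X_lead_term:
  assumes "j < K" "r \<in> carrier R" "y \<in> carrier M"
  shows "X j (r \<odot>\<^bsub>M\<^esub> h i a \<oplus>\<^bsub>M\<^esub> y) = r \<odot>\<^bsub>M\<^esub> h i (incr j a) \<oplus>\<^bsub>M\<^esub> X j y"
  using assms h_closed
  by (simp add: mod_hom_add[OF X_hom] mod_hom_smult[OF X_hom] X_h)

lemma lead_mono:
  assumes j: "j < K" shows "lead i a \<subseteq> lead i (incr j a)"
proof
  fix r assume "r \<in> lead i a"
  then obtain y where y: "r \<in> carrier R" "y \<in> below i a (xdeg a) (ydeg a)"
    "r \<odot>\<^bsub>M\<^esub> h i a \<oplus>\<^bsub>M\<^esub> y \<in> W (xdeg a) (ydeg a)" by (auto simp: lead_def)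
  note lt = X_lead_term[OF j y(1) below_closed[OF y(2)]]
  show "r \<in> lead i (incr j a)"
  proof (cases "j < k")
    case True
    have "X j y \<in> below i (incr j a) (Suc (xdeg a)) (ydeg a)"
      by (rule X_below[OF j y(2)]) (rule mono_index_incr_low[OF _ True kK])
    moreover have "r \<odot>\<^bsub>M\<^esub> h i (incr j a) \<oplus>\<^bsub>M\<^esub> X j y \<in> W (Suc (xdeg a)) (ydeg a)"
      using X_low[OF True] y(3) lt by (metis image_subset_iff)
    ultimately show ?thesis using y(1) deg_incr_low[OF True, of a] by (auto simp: lead_def)
  next
    case False
    then have kj: "k \<le> j" by simp
    have "X j y \<in> below i (incr j a) (xdeg a) (Suc (ydeg a))"
      by (rule X_below[OF j y(2)]) (rule mono_index_incr_high[OF _ kj j])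
    moreover have "r \<odot>\<^bsub>M\<^esub> h i (incr j a) \<oplus>\<^bsub>M\<^esub> X j y \<in> W (xdeg a) (Suc (ydeg a))"
      using X_high[OF kj j] y(3) lt by (metis image_subset_iff)
    ultimately show ?thesis using y(1) deg_incr_high[OF kj j, of a] by (auto simp: lead_def)
  qed
qed

text \<open>Division with respect to the monomial order: the leading coefficient of \<open>u\<close> already occurs one degree
  lower in some direction \<open>j\<close>, so subtracting a multiple of the variable \<open>j\<close> removes the leading term.\<close>

lemma lead_stable_imp_generated:
  assumes stable: "\<And>i a. i < b \<Longrightarrow> (\<forall>j\<ge>K. a j = 0) \<Longrightarrow> xdeg a = Suc n
      \<Longrightarrow> \<exists>j<k. 0 < a j \<and> lead i (decr j a) = lead i a"
    and Z: "submodule Z R M" and XZ: "\<And>j. j < k \<Longrightarrow> X j ` W n q \<subseteq> Z"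
  shows "W (Suc n) q \<subseteq> Z"
proof -
  let ?I = "mono_index b k K (Suc n) q"
  have "W (Suc n) q \<inter> mod_span R M (case_prod h ` J) \<subseteq> Z"
    if "finite J" "J \<subseteq> ?I" "\<And>p p'. p \<in> J \<Longrightarrow> p' \<in> ?I \<Longrightarrow> mono_less p' p \<Longrightarrow> p' \<in> J" for J
    using that
  proof (induction "card J" arbitrary: J)
    case 0
    then have "J = {}" by simp
    then show ?case using span_empty submodule_zero[OF Z] by auto
  next
    case (Suc c)
    then have "J \<noteq> {}" by auto
    from mono_less_maximal[OF Suc.prems(1) this] obtain p where p: "p \<in> J"
      "\<And>p'. p' \<in> J \<Longrightarrow> p' \<noteq> p \<Longrightarrow> \<not> mono_less p p'" by blast
    obtain i a where ia: "p = (i, a)" by (cases p)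
    let ?J = "{p' \<in> ?I. mono_less p' (i, a)}"
    have pI: "(i, a) \<in> ?I" using p(1) Suc.prems(2) ia by auto
    have irr: "\<not> mono_less p p" by (simp add: mono_less_def less_fun_irrefl)
    have J: "J = insert p ?J" "p \<notin> ?J"
    proof -
      have "p' \<in> ?J" if "p' \<in> J" "p' \<noteq> p" for p'
      proof -
        obtain i' a' where p': "p' = (i', a')" by (cases p')
        have "p' \<in> ?I" using that(1) Suc.prems(2) by blast
        then show ?thesis using mono_index_total[of i a b k K "Suc n" q i' a' "Suc n" q] pI p(2)[OF that] that(2)
          unfolding ia p' by blast
      qed
      then show "J = insert p ?J" using p(1) Suc.prems(3)[OF p(1)] ia by blast
      show "p \<notin> ?J" using irr ia by auto
    qed
    have cJ: "c = card ?J"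
    proof -
      have "card J = Suc (card ?J)"
        using J card_insert_disjoint[of ?J p] mono_index_finite[of b k K "Suc n" q] by simp
      then show ?thesis using Suc.hyps(2) by simp
    qed
    have IH: "W (Suc n) q \<inter> mod_span R M (case_prod h ` ?J) \<subseteq> Z"
    proof (rule Suc.hyps(1)[OF cJ])
      show "p2 \<in> ?J" if "p1 \<in> ?J" "p2 \<in> ?I" "mono_less p2 p1" for p1 p2
        using that by (auto simp: mono_less_def intro: less_fun_trans)
    qed (use mono_index_finite in auto)
    show ?case
    proof
      fix u assume "u \<in> W (Suc n) q \<inter> mod_span R M (case_prod h ` J)"
      then have uW: "u \<in> W (Suc n) q" and "u \<in> mod_span R M (insert (h i a) (case_prod h ` ?J))"
        using J(1) ia by auto
      from span_insert_elim[OF this(2) h_closed h_image] obtain r y where r: "r \<in> carrier R"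
        and y: "y \<in> mod_span R M (case_prod h ` ?J)" and u: "u = r \<odot>\<^bsub>M\<^esub> h i a \<oplus>\<^bsub>M\<^esub> y" .
      have deg: "xdeg a = Suc n" "ydeg a = q" "i < b" "\<forall>j\<ge>K. a j = 0"
        using pI by (auto simp: mono_index_def xdeg_def ydeg_def)
      have "r \<in> lead i a" using r y uW u by (auto simp: lead_def deg below_def)
      moreover obtain j where j: "j < k" "0 < a j" "lead i (decr j a) = lead i a"
        using stable[OF deg(3,4,1)] by blast
      ultimately have rl: "r \<in> lead i (decr j a)" by simp
      have jK: "j < K" using j(1) kK by simp
      have eq: "incr j (decr j a) = a" using j(2) by (rule incr_decr)
      have deg': "xdeg (decr j a) = n" "ydeg (decr j a) = q"
        using deg_incr_low[OF j(1), of "decr j a"] deg unfolding eq by auto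
      from rl obtain z where z: "z \<in> below i (decr j a) n q"
        "r \<odot>\<^bsub>M\<^esub> h i (decr j a) \<oplus>\<^bsub>M\<^esub> z \<in> W n q" by (auto simp: lead_def deg')
      let ?w = "X j (r \<odot>\<^bsub>M\<^esub> h i (decr j a) \<oplus>\<^bsub>M\<^esub> z)"
      have w: "?w = r \<odot>\<^bsub>M\<^esub> h i a \<oplus>\<^bsub>M\<^esub> X j z"
        using X_lead_term[OF jK r below_closed[OF z(1)], of i "decr j a"] unfolding eq .
      have Xz: "X j z \<in> mod_span R M (case_prod h ` ?J)"
        using X_below[OF jK z(1) mono_index_incr_low[OF _ j(1) kK]] unfolding eq below_def .
      note sJ = span_submodule[OF h_image, of ?J]
      have yc: "y \<in> carrier M" and Xzc: "X j z \<in> carrier M"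
        using y Xz submodule_carrier[OF sJ] by auto
      have wW: "?w \<in> W (Suc n) q" using X_low[OF j(1)] z(2) by blast
      have wZ: "?w \<in> Z" using XZ[OF j(1)] z(2) by blast
      have hc: "r \<odot>\<^bsub>M\<^esub> h i a \<in> carrier M" using r h_closed by simp
      have diff: "u \<ominus>\<^bsub>M\<^esub> ?w = y \<ominus>\<^bsub>M\<^esub> X j z"
        unfolding w u using hc yc Xzc
        by (simp add: a_minus_def M.minus_add M.a_ac) (simp add: M.a_assoc[symmetric] M.r_neg M.l_neg)
      have "u \<ominus>\<^bsub>M\<^esub> ?w \<in> W (Suc n) q \<inter> mod_span R M (case_prod h ` ?J)"
        using submodule_minus[OF W_sub uW wW] submodule_minus[OF sJ y Xz] diff by simp
      then have "u \<ominus>\<^bsub>M\<^esub> ?w \<in> Z" using IH by blast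
      from submodule_add[OF Z this wZ] have "(u \<ominus>\<^bsub>M\<^esub> ?w) \<oplus>\<^bsub>M\<^esub> ?w \<in> Z" .
      moreover have "u \<in> carrier M" "?w \<in> carrier M"
        using submodule_carrier[OF W_sub] uW wW by blast+
      then have "(u \<ominus>\<^bsub>M\<^esub> ?w) \<oplus>\<^bsub>M\<^esub> ?w = u" by (simp add: a_minus_def M.a_assoc M.l_neg)
      ultimately show "u \<in> Z" by simp
    qed
  qed
  from this[of ?I] show ?thesis using W_span mono_index_finite by blast
qed

text \<open>The bound \<open>B\<close> works for all \<open>q\<close> at once because the variables of bidegree \<open>(0, 1)\<close> take part in
  Dickson's lemma.\<close>

theorem eventually_generated:
  "\<exists>B. \<forall>n\<ge>B. \<forall>q Z. submodule Z R M \<longrightarrow> (\<forall>j<k. X j ` W n q \<subseteq> Z) \<longrightarrow> W (Suc n) q \<subseteq> Z"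
proof -
  have "\<forall>i. \<exists>B. \<forall>a. (\<forall>j\<ge>K. a j = 0) \<longrightarrow> B < (\<Sum>j<k. a j)
      \<longrightarrow> (\<exists>j<k. 0 < a j \<and> lead i (decr j a) = lead i a)"
  proof
    fix i show "\<exists>B. \<forall>a. (\<forall>j\<ge>K. a j = 0) \<longrightarrow> B < (\<Sum>j<k. a j)
      \<longrightarrow> (\<exists>j<k. 0 < a j \<and> lead i (decr j a) = lead i a)"
      by (rule ideal_exponents_stabilize[OF noeth kK lead_ideal lead_mono])
  qed
  from choice[OF this] obtain B where B: "\<And>i a. (\<forall>j\<ge>K. a j = 0) \<Longrightarrow> B i < xdeg a
      \<Longrightarrow> \<exists>j<k. 0 < a j \<and> lead i (decr j a) = lead i a" unfolding xdeg_def by blast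
  show ?thesis
  proof (intro exI[of _ "\<Sum>i<b. B i"] allI impI)
    fix n q Z assume n: "n \<ge> (\<Sum>i<b. B i)" and Z: "submodule Z R M" "\<forall>j<k. X j ` W n q \<subseteq> Z"
    have "B i \<le> n" if "i < b" for i
      using n member_le_sum[of i "{..<b}" B] that by auto
    then show "W (Suc n) q \<subseteq> Z"
      using Z B by (intro lead_stable_imp_generated) (auto simp: less_Suc_eq_le)
  qed
qed

end

section \<open>Graded systems and their syzygies\<close>

text \<open>The monomial with exponents \<open>a\<close> in the first \<open>l\<close> variables, acting through the operators \<open>X\<close>.\<close>

primrec xpow :: "(nat \<Rightarrow> 'b \<Rightarrow> 'b) \<Rightarrow> (nat \<Rightarrow> nat) \<Rightarrow> nat \<Rightarrow> 'b \<Rightarrow> 'b"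
  where "xpow X a 0 v = v"
  | "xpow X a (Suc l) v = (X l ^^ a l) (xpow X a l v)"

lemma funpow_closed: "(\<And>x. x \<in> S \<Longrightarrow> f x \<in> S) \<Longrightarrow> x \<in> S \<Longrightarrow> (f ^^ n) x \<in> S"
  by (induction n) auto

lemma xpow_closed:
  assumes "\<And>j x. j < K \<Longrightarrow> x \<in> S \<Longrightarrow> X j x \<in> S" "l \<le> K" "v \<in> S"
  shows "xpow X a l v \<in> S"
  using assms(2) by (induction l) (auto intro!: funpow_closed assms)

lemma xpow_cong: "(\<And>j. j < l \<Longrightarrow> a j = c j) \<Longrightarrow> xpow X a l v = xpow X c l v"
  by (induction l) auto

lemma xpow_zero: "(\<And>j. j < l \<Longrightarrow> a j = 0) \<Longrightarrow> xpow X a l v = v"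
  by (induction l) auto

lemma xpow_incr:
  assumes closed: "\<And>j x. j < K \<Longrightarrow> x \<in> S \<Longrightarrow> X j x \<in> S"
    and comm: "\<And>i j x. i < K \<Longrightarrow> j < K \<Longrightarrow> x \<in> S \<Longrightarrow> X i (X j x) = X j (X i x)"
    and "l \<le> K" "j < l" and v: "v \<in> S"
  shows "xpow X (incr j a) l v = X j (xpow X a l v)"
  using assms(3,4)
proof (induction l)
  case 0
  then show ?case by simp
next
  case (Suc l)
  show ?case
  proof (cases "j = l")
    case True
    have "xpow X (incr l a) l v = xpow X a l v" by (rule xpow_cong) (simp add: incr_def)
    moreover have "incr l a l = Suc (a l)" by (simp add: incr_def)
    ultimately show ?thesis using True by (simp only: xpow.simps funpow.simps o_apply)
  next
    case False
    have w: "xpow X a l v \<in> S" using closed Suc.prems v by (intro xpow_closed[of K]) auto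
    have pow: "(X l ^^ t) (X j w) = X j ((X l ^^ t) w)" if "w \<in> S" for t w
    proof (induction t)
      case (Suc t)
      have "(X l ^^ t) w \<in> S" using that closed \<open>Suc l \<le> K\<close> by (intro funpow_closed) auto
      then show ?case using Suc comm[of l j] \<open>Suc l \<le> K\<close> \<open>j < Suc l\<close> by simp
    qed simp
    have "xpow X (incr j a) l v = X j (xpow X a l v)" using Suc False by auto
    moreover have "incr j a l = a l" using False by (simp add: incr_def)
    ultimately show ?thesis using pow[OF w] by (simp only: xpow.simps)
  qed
qed

text \<open>Multiplication by a variable on polynomial vectors, whose coordinates are indexed by a component
  and an exponent vector.\<close>

definition shift :: "('a, 'r) ring_scheme \<Rightarrow> nat \<Rightarrow> (nat \<times> (nat \<Rightarrow> nat) \<Rightarrow> 'a) \<Rightarrow> nat \<times> (nat \<Rightarrow> nat) \<Rightarrow> 'a"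
  where "shift R j x = (\<lambda>(i, a). if a j = 0 then \<zero>\<^bsub>R\<^esub> else x (i, decr j a))"

lemma shift_hom:
  assumes "cring R" shows "shift R j \<in> mod_hom R (fmod R UNIV) (fmod R UNIV)"
proof -
  interpret cring R by fact
  show ?thesis by (rule mod_homI) (auto simp: fmod_carrier shift_def fun_eq_iff)
qed

lemma shift_unit_vec: "shift R j (unit_vec R (i, a)) = unit_vec R (i, incr j a)"
proof
  fix p :: "nat \<times> (nat \<Rightarrow> nat)"
  obtain i' a' where p: "p = (i', a')" by (cases p)
  show "shift R j (unit_vec R (i, a)) p = unit_vec R (i, incr j a) p"
  proof (cases "a' j = 0")
    case True
    then have "a' \<noteq> incr j a" by (auto simp: incr_def)
    then show ?thesis using True by (simp add: p shift_def unit_vec_def)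
  next
    case False
    then have "decr j a' = a \<longleftrightarrow> a' = incr j a" using incr_decr[of a' j] decr_incr[of j a] by auto
    then show ?thesis using False by (simp add: p shift_def unit_vec_def)
  qed
qed

lemma shift_comm: "shift R i (shift R j x) = shift R j (shift R i x)"
proof (cases "i = j")
  case False
  then have d: "decr i (decr j a) = decr j (decr i a)" "decr i a j = a j" "decr j a i = a i" for a
    by (auto simp: decr_def fun_upd_twist)
  show ?thesis
  proof
    fix p
    show "shift R i (shift R j x) p = shift R j (shift R i x) p"
      by (cases p) (simp add: shift_def d)
  qed
qed simp

lemma shift_fmod:
  assumes "j < k" "x \<in> carrier (fmod R (mono_index b k k n 0))" "cring R"
  shows "shift R j x \<in> carrier (fmod R (mono_index b k k (Suc n) 0))"
proof -
  interpret cring R by fact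
  have "x (i, decr j a) = \<zero>\<^bsub>R\<^esub>" if "(i, a) \<notin> mono_index b k k (Suc n) 0" "a j \<noteq> 0" for i a
  proof -
    have "(i, decr j a) \<notin> mono_index b k k n 0"
      using mono_index_incr_low[of i "decr j a" b k k n 0 j] incr_decr[of a j] that assms(1) by auto
    then show ?thesis using assms(2) by (simp add: fmod_carrier)
  qed
  moreover have "x p \<in> carrier R" for p by (rule fmod_coord[OF assms(3,2)])
  ultimately show ?thesis by (auto simp: fmod_carrier shift_def)
qed

text \<open>An \<open>\<nat>\<close>-graded module generated in degree 0 over a polynomial ring over \<open>R\<close>, given by its
  components inside a common \<open>R\<close>-module and the action of the variables.\<close>

locale graded_system = module R M for R (structure) and M (structure) +
  fixes m :: "'a set" and k :: nat and X :: "nat \<Rightarrow> 'c \<Rightarrow> 'c" and C :: "nat \<Rightarrow> 'c set"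
  assumes loc: "noeth_local_ring R m"
    and X_hom: "j < k \<Longrightarrow> X j \<in> mod_hom R M M"
    and X_comm: "i < k \<Longrightarrow> j < k \<Longrightarrow> x \<in> carrier M \<Longrightarrow> X i (X j x) = X j (X i x)"
    and C_sub: "submodule (C n) R M"
    and C_fg: "fin_gen R (M\<lparr>carrier := C 0\<rparr>)"
    and C_Suc: "C (Suc n) = mod_span R M (\<Union>j<k. X j ` C n)"

lemma (in graded_system) component_module: "module R (M\<lparr>carrier := C n\<rparr>)"
  by (rule submodule.submodule_is_module[OF C_sub module_axioms])

text \<open>Chosen generators \<open>g\<close> of the component of degree 0 and \<open>\<mu>\<close> of the maximal ideal.\<close>

locale generated_graded_system = graded_system R M m k X C
  for R (structure) and M (structure) and m k X C +
  fixes b :: nat and g :: "nat \<Rightarrow> 'c" and e :: nat and \<mu> :: "nat \<Rightarrow> 'a"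
  assumes g: "g ` {..<b} \<subseteq> C 0" and g_span: "mod_span R M (g ` {..<b}) = C 0"
    and \<mu>: "\<mu> ` {..<e} \<subseteq> carrier R" and \<mu>_gen: "m = Idl (\<mu> ` {..<e})"
begin

lemma X_closed: "j < k \<Longrightarrow> x \<in> carrier M \<Longrightarrow> X j x \<in> carrier M"
  using mod_hom_closed[OF X_hom] .

lemma C_closed: "x \<in> C n \<Longrightarrow> x \<in> carrier M"
  using submodule_carrier[OF C_sub] by blast

lemma X_C: assumes "j < k" "x \<in> C n" shows "X j x \<in> C (Suc n)"
  unfolding C_Suc using assms by (intro subsetD[OF span_incl]) blast

text \<open>The basis of the component of degree \<open>n\<close> of the free graded module on the generators. As \<open>K = k\<close>,
  there are no variables of bidegree \<open>(0, 1)\<close>, whence the 0.\<close>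

definition I :: "nat \<Rightarrow> (nat \<times> (nat \<Rightarrow> nat)) set" where "I n = mono_index b k k n 0"

definition v :: "nat \<times> (nat \<Rightarrow> nat) \<Rightarrow> 'c" where "v = (\<lambda>(i, a). xpow X a k (g i))"

definition \<pi> :: "nat \<Rightarrow> (nat \<times> (nat \<Rightarrow> nat) \<Rightarrow> 'a) \<Rightarrow> 'c" where "\<pi> n = lincomb M (I n) v"

abbreviation P where "P n \<equiv> fmod R (I n)"
abbreviation Amb where "Amb \<equiv> fmod R (UNIV :: (nat \<times> (nat \<Rightarrow> nat)) set)"
abbreviation comp where "comp n \<equiv> M\<lparr>carrier := C n\<rparr>"

definition \<Omega> where "\<Omega> n = syzygy R (I n) (\<pi> n) (comp n)"

lemma I_finite: "finite (I n)" unfolding I_def by (rule mono_index_finite)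

lemma v_C: assumes "p \<in> I n" shows "v p \<in> C n"
proof -
  obtain i a where p: "p = (i, a)" by (cases p)
  have "(X l ^^ t) x \<in> C (t + s)" if "x \<in> C s" "l < k" for l t s x
    using that by (induction t) (auto intro: X_C)
  then have "l \<le> k \<Longrightarrow> xpow X a l x \<in> C (\<Sum>j<l. a j)" if "x \<in> C 0" for l x
    using that by (induction l) (auto simp: add.commute[of "sum a _"])
  then show ?thesis using assms g by (auto simp: p v_def I_def mono_index_def)
qed

lemma v_incr: "j < k \<Longrightarrow> i < b \<Longrightarrow> v (i, incr j a) = X j (v (i, a))"
  unfolding v_def prod.case using g C_closed
  by (intro xpow_incr[where S = "carrier M" and K = k]) (auto intro: X_closed X_comm)

lemma v_span: "mod_span R M (v ` I n) = C n"
proof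
  show "mod_span R M (v ` I n) \<subseteq> C n" using v_C by (intro span_least[OF C_sub]) auto
  show "C n \<subseteq> mod_span R M (v ` I n)"
  proof (induction n)
    case 0
    have "g i \<in> v ` I 0" if "i < b" for i
    proof (rule image_eqI)
      show "(i, \<lambda>_. 0) \<in> I 0" using that by (simp add: I_def mono_index_def)
      show "g i = v (i, \<lambda>_. 0)" by (simp add: v_def xpow_zero)
    qed
    then show ?case unfolding g_span[symmetric] by (intro span_mono) auto
  next
    case (Suc n)
    have vI: "v ` I n \<subseteq> carrier M" for n using v_C C_closed by blast
    have "X j ` C n \<subseteq> mod_span R M (v ` I (Suc n))" if j: "j < k" for j
    proof -
      have "X j ` C n \<subseteq> X j ` mod_span R M (v ` I n)" using Suc by blast
      also have "\<dots> = mod_span R M (X j ` v ` I n)"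
        by (rule mod_hom_span[OF module_axioms module_axioms X_hom[OF j] vI])
      also have "\<dots> \<subseteq> mod_span R M (v ` I (Suc n))"
      proof (rule span_mono, rule subsetI)
        fix x assume "x \<in> X j ` v ` I n"
        then obtain i a where ia: "(i, a) \<in> I n" "x = X j (v (i, a))" by auto
        then have "x = v (i, incr j a)" using v_incr[OF j] by (auto simp: I_def mono_index_def)
        moreover have "(i, incr j a) \<in> I (Suc n)"
          using ia(1) mono_index_incr_low[OF _ j] unfolding I_def by blast
        ultimately show "x \<in> v ` I (Suc n)" by blast
      qed
      finally show ?thesis .
    qed
    then show ?case unfolding C_Suc by (intro span_least span_submodule vI) blast
  qed
qed

lemma \<pi>_hom: "\<pi> n \<in> mod_hom R (P n) M"
  unfolding \<pi>_def using v_C C_closed by (intro lincomb_hom[OF module_axioms I_finite]) blast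

lemma \<pi>_unit: "p \<in> I n \<Longrightarrow> \<pi> n (unit_vec R p) = v p"
  unfolding \<pi>_def using v_C C_closed by (intro lincomb_unit_vec[OF module_axioms I_finite]) blast+

lemma \<pi>_image: "\<pi> n ` carrier (P n) = C n"
  unfolding \<pi>_def v_span[symmetric] using v_C C_closed
  by (intro lincomb_image[OF module_axioms I_finite]) blast

lemma \<pi>_cover: "cover R (I n) (\<pi> n) (comp n)"
  unfolding cover_def using I_finite \<pi>_image \<pi>_hom mod_hom_into_sub[OF \<pi>_hom, of n "C n"] by auto

lemma P_module: "module R (P n)" and Amb_module: "module R Amb"
  by (rule fmod_module[OF is_cring])+

lemma P_sub: "submodule (carrier (P n)) R Amb"
  by (rule fmod_submodule[OF _ is_cring]) simp

lemma shift_P_hom: assumes "j < k" shows "shift R j \<in> mod_hom R (P n) (P (Suc n))"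
proof -
  have "shift R j x \<in> carrier (P (Suc n))" if "x \<in> carrier (P n)" for x
    using shift_fmod[OF assms _ is_cring] that unfolding I_def .
  then have "shift R j \<in> mod_hom R (Amb\<lparr>carrier := carrier (P n)\<rparr>) (Amb\<lparr>carrier := carrier (P (Suc n))\<rparr>)"
    by (intro mod_hom_into_sub mod_hom_restrict[OF shift_hom[OF is_cring]] submodule_carrier[OF P_sub]) simp
  then show ?thesis by (simp add: fmod_restrict)
qed

text \<open>The covers are compatible with the action of the variables, so the syzygies form a graded
  submodule.\<close>

lemma \<pi>_shift:
  assumes j: "j < k" and x: "x \<in> carrier (P n)"
  shows "\<pi> (Suc n) (shift R j x) = X j (\<pi> n x)"
proof (rule fmod_hom_ext[OF is_cring I_finite module_axioms _ _ _ x])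
  show "(\<lambda>x. \<pi> (Suc n) (shift R j x)) \<in> mod_hom R (P n) M"
    by (rule mod_hom_comp[OF shift_P_hom[OF j] \<pi>_hom])
  show "(\<lambda>x. X j (\<pi> n x)) \<in> mod_hom R (P n) M"
    by (rule mod_hom_comp[OF \<pi>_hom X_hom[OF j]])
  fix p assume p: "p \<in> I n"
  obtain i a where ia: "p = (i, a)" by (cases p)
  have "(i, incr j a) \<in> I (Suc n)"
    using p mono_index_incr_low[OF _ j] unfolding I_def ia by blast
  then show "\<pi> (Suc n) (shift R j (unit_vec R p)) = X j (\<pi> n (unit_vec R p))"
    unfolding \<pi>_unit[OF p] unfolding ia shift_unit_vec
    using \<pi>_unit v_incr[OF j] p by (auto simp: ia I_def mono_index_def)
qed

lemma \<Omega>_iff: "x \<in> \<Omega> n \<longleftrightarrow> x \<in> carrier (P n) \<and> \<pi> n x = \<zero>\<^bsub>M\<^esub>"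
  by (simp add: \<Omega>_def syzygy_def)

lemma \<Omega>_sub_P: "submodule (\<Omega> n) R (P n)"
  unfolding \<Omega>_def by (rule syzygy_submodule[OF component_module \<pi>_cover])

lemma \<Omega>_sub: "submodule (\<Omega> n) R Amb"
  using \<Omega>_sub_P[of n] module.submodule_sub_iff[OF Amb_module P_sub, of "\<Omega> n" n]
  by (simp add: fmod_restrict)

lemma \<Omega>_shift: "j < k \<Longrightarrow> x \<in> \<Omega> n \<Longrightarrow> shift R j x \<in> \<Omega> (Suc n)"
  using mod_hom_closed[OF shift_P_hom] \<pi>_shift mod_hom_zero[OF module_axioms module_axioms X_hom]
  by (auto simp: \<Omega>_iff)

text \<open>Variables of bidegree \<open>(0, 1)\<close> act through generators of the maximal ideal. They turn the
  filtration of a module by powers of the maximal ideal into a second grading.\<close>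

definition Y where "Y j = (if j < k then shift R j else (\<lambda>x. \<mu> (j - k) \<odot>\<^bsub>Amb\<^esub> x))"

definition h where "h i a = xpow Y a (k + e) (unit_vec R (i, \<lambda>_. 0))"

lemma \<mu>_closed: "k \<le> j \<Longrightarrow> j < k + e \<Longrightarrow> \<mu> (j - k) \<in> carrier R"
  using \<mu> by auto

lemma Y_hom: assumes "j < k + e" shows "Y j \<in> mod_hom R Amb Amb"
proof (cases "j < k")
  case True
  then show ?thesis unfolding Y_def using shift_hom[OF is_cring] by simp
next
  case False
  then have "\<mu> (j - k) \<in> carrier R" using \<mu>_closed assms by simp
  from module.smult_hom[OF Amb_module this] show ?thesis
    unfolding Y_def using False by (simp only: if_False)
qed

lemma Y_comm:
  assumes ij: "i < k + e" "j < k + e" and x: "x \<in> carrier Amb"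
  shows "Y i (Y j x) = Y j (Y i x)"
proof -
  interpret A: module R Amb by (rule Amb_module)
  consider "i < k" "j < k" | "i < k" "k \<le> j" | "k \<le> i" "j < k" | "k \<le> i" "k \<le> j" by linarith
  then show ?thesis
  proof cases
    case 1
    then show ?thesis by (simp add: Y_def shift_comm)
  next
    case 2
    then show ?thesis
      using mod_hom_smult[OF shift_hom[OF is_cring] \<mu>_closed x, of j i] ij by (simp add: Y_def)
  next
    case 3
    then show ?thesis
      using mod_hom_smult[OF shift_hom[OF is_cring] \<mu>_closed x, of i j] ij by (simp add: Y_def)
  next
    case 4
    then have c: "\<mu> (i - k) \<in> carrier R" "\<mu> (j - k) \<in> carrier R" using \<mu>_closed ij by auto
    show ?thesis
      using 4 A.smult_assoc1[OF c x] A.smult_assoc1[OF c(2,1) x] R.m_comm[OF c]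
      by (simp add: Y_def del: fmod_simps)
  qed
qed

lemma unit_vec_Amb: "unit_vec R p \<in> carrier Amb"
  by (rule unit_vec_closed[OF is_cring]) simp

lemma h_closed: "h i a \<in> carrier Amb"
  unfolding h_def using mod_hom_closed[OF Y_hom] unit_vec_Amb
  by (intro xpow_closed[where K = "k + e"]) auto

lemma Y_h: "j < k + e \<Longrightarrow> Y j (h i a) = h i (incr j a)"
  unfolding h_def using mod_hom_closed[OF Y_hom] Y_comm unit_vec_Amb
  by (intro xpow_incr[where S = "carrier Amb" and K = "k + e", symmetric]) auto

lemma unit_vec_eq_h: "(i, a) \<in> I n \<Longrightarrow> unit_vec R (i, a) = h i a"
proof (induction n arbitrary: a)
  case 0
  then have "a = (\<lambda>_. 0)" by (auto simp: I_def mono_index_def fun_eq_iff not_less[symmetric])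
  then show ?case by (simp add: h_def xpow_zero)
next
  case (Suc n)
  then have "(\<Sum>j<k. a j) = Suc n" by (simp add: I_def mono_index_def)
  then obtain j where j: "j < k" "0 < a j"
    by (metis gr0I lessThan_iff nat.distinct(1) sum.neutral)
  have eq: "incr j (decr j a) = a" using j(2) by (rule incr_decr)
  have "(i, decr j a) \<in> I n"
    using Suc.prems mono_index_decr_low[of i a b k k n 0 j] j by (simp add: I_def)
  then have "unit_vec R (i, decr j a) = h i (decr j a)" by (rule Suc.IH)
  then have "shift R j (unit_vec R (i, decr j a)) = Y j (h i (decr j a))" using j by (simp add: Y_def)
  then show ?case using Y_h[of j i "decr j a"] j by (simp add: shift_unit_vec eq)
qed

abbreviation J where "J n q \<equiv> mono_index b k (k + e) n q"

lemma h_image: "case_prod h ` A \<subseteq> carrier Amb"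
  using h_closed by auto

lemma m_ideal: "ideal m R" by (rule noeth_local_ringD[OF loc])

lemma pow_carrier: "ideal_pow R m q \<subseteq> carrier R"
  by (rule ideal_pow_carrier[OF is_cring m_ideal])

text \<open>Elements of \<open>m\<^sup>q\<close> are combinations of products of \<open>q\<close> generators \<open>\<mu>\<close>, so \<open>m\<^sup>q\<close> times the component of
  degree \<open>n\<close> is spanned by the monomials of bidegree \<open>(n, q)\<close>.\<close>

lemma pow_smult_span:
  "ideal_smult R (ideal_pow R m q) (P n) \<subseteq> mod_span R Amb (case_prod h ` J n q)"
proof (induction q)
  interpret A: module R Amb by (rule Amb_module)
  case 0
  have "ideal_smult R (ideal_pow R m 0) (P n) = carrier (P n)"
    using module.ideal_smult_carrier[OF P_module] by simp
  also have "\<dots> = mod_span R (Amb\<lparr>carrier := carrier (P n)\<rparr>) (unit_vec R ` I n)"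
    unfolding fmod_restrict by (rule fmod_spanned[OF is_cring I_finite, symmetric])
  also have "\<dots> = mod_span R Amb (unit_vec R ` I n)"
    using unit_vec_closed[OF is_cring, of _ "I n"] by (intro A.span_sub[OF P_sub]) blast
  also have "\<dots> \<subseteq> mod_span R Amb (case_prod h ` J n 0)"
  proof (rule A.span_mono, rule subsetI)
    fix x assume "x \<in> unit_vec R ` I n"
    then obtain i a where ia: "(i, a) \<in> I n" "x = unit_vec R (i, a)" by auto
    have "(i, a) \<in> J n 0" using ia(1) by (auto simp: I_def mono_index_def)
    then show "x \<in> case_prod h ` J n 0" using unit_vec_eq_h[OF ia(1)] ia(2) by force
  qed
  finally show ?case .
next
  interpret A: module R Amb by (rule Amb_module)
  case (Suc q)
  let ?S = "mod_span R Amb (case_prod h ` J n q)" and ?S' = "mod_span R Amb (case_prod h ` J n (Suc q))"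
  note S = A.span_submodule[OF h_image, of "J n q"] and S' = A.span_submodule[OF h_image, of "J n (Suc q)"]
  have Sc: "y \<in> carrier Amb" if "y \<in> ?S" for y using that submodule_carrier[OF S] by blast
  let ?T = "{r \<in> carrier R. \<forall>y\<in>?S. r \<odot>\<^bsub>Amb\<^esub> y \<in> ?S'}"
  have "ideal ?T R" by (rule A.colon_ideal[OF submodule_carrier[OF S] S'])
  moreover have "\<mu> l \<in> ?T" if l: "l < e" for l
  proof -
    have kl: "k + l < k + e" using l by simp
    have "(\<lambda>x. \<mu> l \<odot>\<^bsub>Amb\<^esub> x) ` ?S = Y (k + l) ` ?S" by (simp add: Y_def)
    also have "\<dots> = mod_span R Amb (Y (k + l) ` case_prod h ` J n q)"
      by (rule mod_hom_span[OF Amb_module Amb_module Y_hom[OF kl] h_image])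
    also have "\<dots> \<subseteq> ?S'"
    proof (rule A.span_mono, rule subsetI)
      fix x assume "x \<in> Y (k + l) ` case_prod h ` J n q"
      then obtain i a where ia: "(i, a) \<in> J n q" "x = Y (k + l) (h i a)" by auto
      then have "x = case_prod h (i, incr (k + l) a)" using Y_h[OF kl] by simp
      moreover have "(i, incr (k + l) a) \<in> J n (Suc q)" using mono_index_incr_high[OF ia(1) _ kl] by simp
      ultimately show "x \<in> case_prod h ` J n (Suc q)" by (rule image_eqI)
    qed
    finally show ?thesis using \<mu> l by blast
  qed
  ultimately have "Idl (\<mu> ` {..<e}) \<subseteq> ?T" by (intro R.genideal_minimal) auto
  then have mT: "m \<subseteq> ?T" using \<mu>_gen by simp
  let ?T' = "{r \<in> carrier R. \<forall>x\<in>carrier (P n). r \<odot>\<^bsub>Amb\<^esub> x \<in> ?S'}"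
  have "Idl (m <#> ideal_pow R m q) \<subseteq> ?T'"
  proof (rule R.genideal_minimal[OF A.colon_ideal[OF submodule_carrier[OF P_sub] S']], rule subsetI)
    fix t assume "t \<in> m <#> ideal_pow R m q"
    then obtain i j where ij: "i \<in> m" "j \<in> ideal_pow R m q" "t = i \<otimes> j" by (auto simp: set_mult_def)
    have ic: "i \<in> carrier R" and jc: "j \<in> carrier R" using ij mT pow_carrier by auto
    have "t \<odot>\<^bsub>Amb\<^esub> x \<in> ?S'" if x: "x \<in> carrier (P n)" for x
    proof -
      have "j \<odot>\<^bsub>P n\<^esub> x \<in> ?S" using module.ideal_smult_incl[OF P_module ij(2) x] Suc.IH by blast
      then have "j \<odot>\<^bsub>Amb\<^esub> x \<in> ?S" by simp
      then have "i \<odot>\<^bsub>Amb\<^esub> (j \<odot>\<^bsub>Amb\<^esub> x) \<in> ?S'" using ij(1) mT by blast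
      moreover have "x \<in> carrier Amb" using x submodule_carrier[OF P_sub] by blast
      ultimately show ?thesis using A.smult_assoc1[OF ic jc] ij(3) by metis
    qed
    then show "t \<in> ?T'" using ij(3) ic jc by blast
  qed
  then have gens: "{r \<odot>\<^bsub>Amb\<^esub> x | r x. r \<in> ideal_pow R m (Suc q) \<and> x \<in> carrier (P n)} \<subseteq> ?S'"
    using R.ideal_prod_eq_genideal[OF m_ideal ideal_pow_ideal[OF is_cring m_ideal]] by auto
  have "ideal_smult R (ideal_pow R m (Suc q)) (P n)
      = mod_span R Amb {r \<odot>\<^bsub>Amb\<^esub> x | r x. r \<in> ideal_pow R m (Suc q) \<and> x \<in> carrier (P n)}"
    using A.ideal_smult_eq[OF P_sub pow_carrier[of "Suc q"], of n] by (simp only: fmod_restrict)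
  also have "\<dots> \<subseteq> ?S'" by (rule A.span_least[OF S' gens])
  finally show ?case .
qed

definition W where "W n q = \<Omega> n \<inter> ideal_smult R (ideal_pow R m q) (P n)"

lemma ideal_smult_P_sub: "submodule (ideal_smult R (ideal_pow R m q) (P n)) R Amb"
  using module.ideal_smult_submodule[OF P_module pow_carrier, of q n]
    module.submodule_sub_iff[OF Amb_module P_sub, of _ n] by (simp add: fmod_restrict)

lemma W_sub: "submodule (W n q) R Amb"
proof -
  interpret A: module R Amb by (rule Amb_module)
  note s = \<Omega>_sub[of n] ideal_smult_P_sub[of q n]
  show ?thesis
    unfolding W_def using submodule_carrier[OF s(1)]
      submodule_zero[OF s(1)] submodule_zero[OF s(2)] submodule_add[OF s(1)] submodule_add[OF s(2)]
      submodule_smult[OF s(1)] submodule_smult[OF s(2)]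
    by (intro A.submodule_intro) auto
qed

lemma bigraded: "bigraded_submodules R Amb h Y b k (k + e) W"
proof (intro bigraded_submodules.intro bigraded_submodules_axioms.intro)
  show "module R Amb" by (rule Amb_module)
  show "noetherian_ring R" by (rule noeth_local_ringD[OF loc])
  show "h i a \<in> carrier Amb" for i a by (rule h_closed)
  show "Y j \<in> mod_hom R Amb Amb" if "j < k + e" for j by (rule Y_hom[OF that])
  show "Y j (h i a) = h i (incr j a)" if "j < k + e" for i j a by (rule Y_h[OF that])
  show "submodule (W n q) R Amb" for n q by (rule W_sub)
  show "W n q \<subseteq> mod_span R Amb (case_prod h ` J n q)" for n q
    using pow_smult_span unfolding W_def by blast
  show "Y j ` W n q \<subseteq> W (Suc n) q" if "j < k" for j n q
    using that \<Omega>_shift mod_hom_ideal_smult_subset[OF P_module P_module shift_P_hom[OF that] pow_carrier]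
    by (auto simp: W_def Y_def)
  show "Y j ` W n q \<subseteq> W n (Suc q)" if j: "k \<le> j" "j < k + e" for j n q
  proof
    interpret P: module R "P n" by (rule P_module)
    let ?r = "\<mu> (j - k)"
    have "?r \<in> Idl (\<mu> ` {..<e})" using j by (intro subsetD[OF R.genideal_self[OF \<mu>]]) auto
    then have rm: "?r \<in> m" using \<mu>_gen by simp
    have rc: "?r \<in> carrier R" by (rule \<mu>_closed[OF j])
    have raise: "ideal_smult R (ideal_pow R m q) (P n)
        \<subseteq> {x \<in> carrier (P n). ?r \<odot>\<^bsub>P n\<^esub> x \<in> ideal_smult R (ideal_pow R m (Suc q)) (P n)}"
    proof (rule P.ideal_smult_least)
      show "submodule {x \<in> carrier (P n). ?r \<odot>\<^bsub>P n\<^esub> x \<in> ideal_smult R (ideal_pow R m (Suc q)) (P n)} R (P n)"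
        by (rule vimage_submodule[OF P_module P_module P.smult_hom[OF rc] P.ideal_smult_submodule[OF pow_carrier]])
      fix s x assume s: "s \<in> ideal_pow R m q" and x: "x \<in> carrier (P n)"
      have sc: "s \<in> carrier R" using s pow_carrier by blast
      have "?r \<otimes> s \<in> ideal_pow R m (Suc q)" using rm s by (auto intro: ideal_prod.prod)
      from P.ideal_smult_incl[OF this x] show "s \<odot>\<^bsub>P n\<^esub> x \<in> {x \<in> carrier (P n). ?r \<odot>\<^bsub>P n\<^esub> x \<in> ideal_smult R (ideal_pow R m (Suc q)) (P n)}"
        unfolding P.smult_assoc1[OF rc sc x] using P.smult_closed[OF sc x] by blast
    qed
    fix y assume "y \<in> Y j ` W n q"
    then obtain x where x: "x \<in> \<Omega> n" "x \<in> ideal_smult R (ideal_pow R m q) (P n)" "y = ?r \<odot>\<^bsub>P n\<^esub> x"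
      using j by (auto simp: W_def Y_def)
    then show "y \<in> W n (Suc q)"
      using raise submodule_smult[OF \<Omega>_sub_P rc x(1)] unfolding W_def by blast
  qed
qed simp

text \<open>For large \<open>n\<close> the syzygies of degree \<open>n + 1\<close> in \<open>m\<^bsup>q+1\<^esup>\<close> times the cover are sums of variables times
  such syzygies of degree \<open>n\<close>, uniformly in \<open>q\<close>. If the latter lie in \<open>m\<^sup>q\<close> times the syzygies, so do
  the former.\<close>

theorem syzygies_eventually_generated:
  "\<exists>B. (\<forall>n\<ge>B. \<Omega> (Suc n) = mod_span R Amb (\<Union>j<k. shift R j ` \<Omega> n))
     \<and> (\<forall>n\<ge>B. tor_maps_vanish R m (I n) (\<Omega> n) \<longrightarrow> tor_maps_vanish R m (I (Suc n)) (\<Omega> (Suc n)))"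
proof -
  interpret A: module R Amb by (rule Amb_module)
  obtain B where B: "\<And>n q Z. n \<ge> B \<Longrightarrow> submodule Z R Amb \<Longrightarrow> (\<And>j. j < k \<Longrightarrow> shift R j ` W n q \<subseteq> Z)
      \<Longrightarrow> W (Suc n) q \<subseteq> Z"
  proof -
    from bigraded_submodules.eventually_generated[OF bigraded] obtain B where
      "\<forall>n\<ge>B. \<forall>q Z. submodule Z R Amb \<longrightarrow> (\<forall>j<k. Y j ` W n q \<subseteq> Z) \<longrightarrow> W (Suc n) q \<subseteq> Z" ..
    then show thesis by (intro that[of B]) (auto simp: Y_def)
  qed
  have W0: "W n 0 = \<Omega> n" for n
    using module.ideal_smult_carrier[OF P_module] by (auto simp: W_def \<Omega>_iff)
  have "\<Omega> (Suc n) = mod_span R Amb (\<Union>j<k. shift R j ` \<Omega> n)" if "n \<ge> B" for n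
  proof
    have sub: "(\<Union>j<k. shift R j ` \<Omega> n) \<subseteq> \<Omega> (Suc n)" using \<Omega>_shift by auto
    then show "mod_span R Amb (\<Union>j<k. shift R j ` \<Omega> n) \<subseteq> \<Omega> (Suc n)"
      by (rule A.span_least[OF \<Omega>_sub])
    have "(\<Union>j<k. shift R j ` \<Omega> n) \<subseteq> carrier Amb" using sub submodule_carrier[OF \<Omega>_sub] by blast
    from A.span_submodule[OF this] show "\<Omega> (Suc n) \<subseteq> mod_span R Amb (\<Union>j<k. shift R j ` \<Omega> n)"
      using B[OF that, of "mod_span R Amb (\<Union>j<k. shift R j ` \<Omega> n)" 0] A.span_incl[of "\<Union>j<k. shift R j ` \<Omega> n"]
      unfolding W0 by blast
  qed
  moreover have "tor_maps_vanish R m (I (Suc n)) (\<Omega> (Suc n))"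
    if n: "n \<ge> B" and T: "tor_maps_vanish R m (I n) (\<Omega> n)" for n
    unfolding tor_maps_vanish_def
  proof
    fix q
    let ?Z = "\<lambda>n. ideal_smult R (ideal_pow R m q) (sub_fmod R (I n) (\<Omega> n))"
    note S = sub_fmod_module[OF is_cring \<Omega>_sub_P]
    have eq: "sub_fmod R (I n) (\<Omega> n) = Amb\<lparr>carrier := \<Omega> n\<rparr>" for n by (simp add: fmod_def)
    have "submodule (?Z (Suc n)) R Amb"
      using module.ideal_smult_submodule[OF S pow_carrier] A.submodule_sub_iff[OF \<Omega>_sub]
      unfolding eq by blast
    moreover have "shift R j ` W n (Suc q) \<subseteq> ?Z (Suc n)" if j: "j < k" for j
    proof -
      have "W n (Suc q) \<subseteq> ?Z n" using T unfolding tor_maps_vanish_def W_def by blast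
      moreover have "shift R j \<in> mod_hom R (sub_fmod R (I n) (\<Omega> n)) (sub_fmod R (I (Suc n)) (\<Omega> (Suc n)))"
        using \<Omega>_shift[OF j] submodule_carrier[OF \<Omega>_sub_P]
        by (intro mod_hom_into_sub mod_hom_restrict[OF shift_P_hom[OF j]]) auto
      ultimately show ?thesis
        using mod_hom_ideal_smult_subset[OF S S _ pow_carrier] by blast
    qed
    ultimately show "\<Omega> (Suc n) \<inter> ideal_smult R (ideal_pow R m (Suc q)) (P (Suc n)) \<subseteq> ?Z (Suc n)"
      using B[OF n, of "?Z (Suc n)" "Suc q"] unfolding W_def by blast
  qed
  ultimately show ?thesis by blast
qed

end

text \<open>Truncated to large degrees, the syzygies form a graded system for the same variables, now inside
  polynomial vectors. The construction can therefore be iterated without a change of type.\<close>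

lemma (in graded_system) syzygy_system:
  "\<exists>(I :: nat \<Rightarrow> (nat \<times> (nat \<Rightarrow> nat)) set) \<pi> B.
     (\<forall>n. cover R (I n) (\<pi> n) (M\<lparr>carrier := C n\<rparr>))
   \<and> (\<forall>n\<ge>B. tor_maps_vanish R m (I n) (syzygy R (I n) (\<pi> n) (M\<lparr>carrier := C n\<rparr>))
        \<longrightarrow> tor_maps_vanish R m (I (Suc n)) (syzygy R (I (Suc n)) (\<pi> (Suc n)) (M\<lparr>carrier := C (Suc n)\<rparr>)))
   \<and> graded_system R (fmod R UNIV) m k (shift R) (\<lambda>n. syzygy R (I (B + n)) (\<pi> (B + n)) (M\<lparr>carrier := C (B + n)\<rparr>))"
proof -
  from C_fg obtain A where A: "finite A" "A \<subseteq> C 0" "mod_span R (M\<lparr>carrier := C 0\<rparr>) A = C 0"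
    unfolding fin_gen_def by auto
  from ex_bij_betw_nat_finite[OF A(1)] obtain g where "bij_betw g {0..<card A} A" by blast
  then have g: "g ` {..<card A} = A" by (simp add: bij_betw_def atLeast0LessThan)
  obtain D where D: "D \<subseteq> carrier R" "finite D" "m = Idl D"
    using noetherian_ring.finetely_gen noeth_local_ringD(2,4)[OF loc] by blast
  from ex_bij_betw_nat_finite[OF D(2)] obtain \<mu> where "bij_betw \<mu> {0..<card D} D" by blast
  then have \<mu>: "\<mu> ` {..<card D} = D" by (simp add: bij_betw_def atLeast0LessThan)
  interpret G: generated_graded_system R M m k X C "card A" g "card D" \<mu>
    using A D g \<mu> span_sub[OF C_sub A(2)]
    by (intro generated_graded_system.intro graded_system_axioms generated_graded_system_axioms.intro) auto
  obtain B where B: "\<forall>n\<ge>B. G.\<Omega> (Suc n) = mod_span R G.Amb (\<Union>j<k. shift R j ` G.\<Omega> n)"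
    "\<forall>n\<ge>B. tor_maps_vanish R m (G.I n) (G.\<Omega> n) \<longrightarrow> tor_maps_vanish R m (G.I (Suc n)) (G.\<Omega> (Suc n))"
    using G.syzygies_eventually_generated by blast
  have "graded_system R G.Amb m k (shift R) (\<lambda>n. G.\<Omega> (B + n))"
  proof (intro graded_system.intro graded_system_axioms.intro)
    show "module R G.Amb" by (rule G.Amb_module)
    show "shift R j \<in> mod_hom R G.Amb G.Amb" for j by (rule shift_hom[OF is_cring])
    show "shift R i (shift R j x) = shift R j (shift R i x)" for i j x by (rule shift_comm)
    show "submodule (G.\<Omega> (B + n)) R G.Amb" for n by (rule G.\<Omega>_sub)
    show "fin_gen R (G.Amb\<lparr>carrier := G.\<Omega> (B + 0)\<rparr>)"
      using sub_fmod_fin_gen[OF is_cring noeth_local_ringD(2)[OF loc] G.I_finite G.\<Omega>_sub_P, of B]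
      by (simp add: fmod_def)
    show "G.\<Omega> (B + Suc n) = mod_span R G.Amb (\<Union>j<k. shift R j ` G.\<Omega> (B + n))" for n
      using B(1) by simp
  qed (rule loc)
  then show ?thesis
    using G.\<pi>_cover B(2) unfolding G.\<Omega>_def by (intro exI[of _ G.I] exI[of _ G.\<pi>] exI[of _ B]) blast
qed

definition eventually_decided :: "(nat \<Rightarrow> bool) \<Rightarrow> bool"
  where "eventually_decided Q \<longleftrightarrow> (\<exists>N. (\<forall>n\<ge>N. Q n) \<or> (\<forall>n\<ge>N. \<not> Q n))"

lemma eventually_decided_mono:
  assumes "\<And>n. n \<ge> B \<Longrightarrow> Q n \<Longrightarrow> Q (Suc n)"
  shows "eventually_decided Q"
proof (cases "\<exists>n\<ge>B. Q n")
  case True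
  then obtain N where N: "N \<ge> B" "Q N" by blast
  have "Q n" if "n \<ge> N" for n
    using that by (induction n rule: dec_induct) (use N assms in auto)
  then show ?thesis unfolding eventually_decided_def by blast
qed (auto simp: eventually_decided_def)

lemma eventually_decided_shift:
  assumes "eventually_decided (\<lambda>n. Q (B + n))"
  shows "eventually_decided Q"
proof -
  obtain N where N: "(\<forall>n\<ge>N. Q (B + n)) \<or> (\<forall>n\<ge>N. \<not> Q (B + n))"
    using assms unfolding eventually_decided_def by blast
  have "\<exists>n'\<ge>N. n = B + n'" if "n \<ge> B + N" for n
    using that by (intro exI[of _ "n - B"]) auto
  with N show ?thesis unfolding eventually_decided_def by (intro exI[of _ "B + N"]) metis
qed

text \<open>In homological degree 1 vanishing for one large \<open>n\<close> implies vanishing for \<open>n + 1\<close>. Higher degrees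
  reduce to this case by dimension shifting.\<close>

lemma (in graded_system) tor_vanish_eventually_decided_step:
  assumes IH: "\<And>j C'. i = Suc j \<Longrightarrow> graded_system R (fmod R UNIV) m k (shift R) C' \<Longrightarrow>
      eventually_decided (\<lambda>n. tor_vanish_at R m ((fmod R UNIV)\<lparr>carrier := C' n\<rparr>) j)"
  shows "eventually_decided (\<lambda>n. tor_vanish_at R m (M\<lparr>carrier := C n\<rparr>) i)"
  using syzygy_system
proof (elim exE conjE)
  fix I :: "nat \<Rightarrow> (nat \<times> (nat \<Rightarrow> nat)) set" and \<pi> B
  let ?\<Omega> = "\<lambda>n. syzygy R (I n) (\<pi> n) (M\<lparr>carrier := C n\<rparr>)"
  assume c: "\<forall>n. cover R (I n) (\<pi> n) (M\<lparr>carrier := C n\<rparr>)"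
    and T: "\<forall>n\<ge>B. tor_maps_vanish R m (I n) (?\<Omega> n) \<longrightarrow> tor_maps_vanish R m (I (Suc n)) (?\<Omega> (Suc n))"
    and S: "graded_system R (fmod R UNIV) m k (shift R) (\<lambda>n. ?\<Omega> (B + n))"
  note c = c[rule_format]
  show ?thesis
  proof (cases i)
    case 0
    show ?thesis
      unfolding 0 tor_vanish_at_0[OF loc component_module c]
      by (rule eventually_decided_mono[of B]) (use T in blast)
  next
    case (Suc j)
    have eq: "sub_fmod R (I n) U = (fmod R UNIV)\<lparr>carrier := U\<rparr>" for n U by (simp add: fmod_def)
    have vanish: "tor_vanish_at R m (M\<lparr>carrier := C n\<rparr>) (Suc j)
        \<longleftrightarrow> tor_vanish_at R m ((fmod R UNIV)\<lparr>carrier := ?\<Omega> n\<rparr>) j" for n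
      using tor_vanish_at_Suc[OF loc component_module c, of n j] unfolding eq .
    show ?thesis
      unfolding Suc
    proof (rule eventually_decided_shift[of _ B])
      show "eventually_decided (\<lambda>n. tor_vanish_at R m (M\<lparr>carrier := C (B + n)\<rparr>) (Suc j))"
        unfolding vanish by (rule IH[OF Suc S])
    qed
  qed
qed

theorem (in graded_system) tor_vanish_eventually_decided:
  "eventually_decided (\<lambda>n. tor_vanish_at R m (M\<lparr>carrier := C n\<rparr>) i)"
proof -
  have "eventually_decided (\<lambda>n. tor_vanish_at R m ((fmod R UNIV)\<lparr>carrier := C' n\<rparr>) j)"
    if "graded_system R (fmod R UNIV) m k (shift R) C'" for C' j
    using that
  proof (induction j arbitrary: C')
    case 0
    show ?case by (rule graded_system.tor_vanish_eventually_decided_step[OF 0]) simp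
  next
    case (Suc j)
    show ?case
      by (rule graded_system.tor_vanish_eventually_decided_step[OF Suc.prems]) (use Suc.IH in simp)
  qed
  then show ?thesis by (rule tor_vanish_eventually_decided_step)
qed

section \<open>Components of a finitely generated graded module\<close>

text \<open>The elements of degree \<open>n\<close> that arise from homogeneous generators \<open>G\<close> under scalars from \<open>R\<close> and the
  algebra generators \<open>A\<close> of degree 1. Working with this closure avoids the decomposition of
  elements of the algebra into homogeneous components.\<close>

inductive generated_part ::
  "('a, 'r) ring_scheme \<Rightarrow> ('a \<Rightarrow> 's) \<Rightarrow> ('s, 'c, 'm) module_scheme \<Rightarrow> 's set \<Rightarrow> (int \<times> 'c) set
    \<Rightarrow> int \<Rightarrow> 'c \<Rightarrow> bool"
  for R \<phi> C A G where
    gen: "(e, g) \<in> G \<Longrightarrow> generated_part R \<phi> C A G e g"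
  | zero: "generated_part R \<phi> C A G n \<zero>\<^bsub>C\<^esub>"
  | neg: "generated_part R \<phi> C A G n x \<Longrightarrow> generated_part R \<phi> C A G n (\<ominus>\<^bsub>C\<^esub> x)"
  | add: "generated_part R \<phi> C A G n x \<Longrightarrow> generated_part R \<phi> C A G n y
      \<Longrightarrow> generated_part R \<phi> C A G n (x \<oplus>\<^bsub>C\<^esub> y)"
  | smult: "r \<in> carrier R \<Longrightarrow> generated_part R \<phi> C A G n x
      \<Longrightarrow> generated_part R \<phi> C A G n (\<phi> r \<odot>\<^bsub>C\<^esub> x)"
  | act: "a \<in> A \<Longrightarrow> generated_part R \<phi> C A G n x
      \<Longrightarrow> generated_part R \<phi> C A G (n + 1) (a \<odot>\<^bsub>C\<^esub> x)"

locale fin_gen_graded_module = module S C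
  for S :: "('s, 't) ring_scheme" and C :: "('s, 'c, 'x) module_scheme" (structure) +
  fixes R :: "('a, 'r) ring_scheme" and \<phi> :: "'a \<Rightarrow> 's" and Sg :: "nat \<Rightarrow> 's set" and Cg :: "int \<Rightarrow> 'c set"
    and A :: "'s set"
  assumes R: "cring R" and std: "standard_graded_algebra R S \<phi> Sg"
    and grad: "graded_module S Sg C Cg" and fg: "fin_gen S C"
    and A_fin: "finite A" and A_Sg: "A \<subseteq> Sg 1"
    and A_gen: "generate_ring S (\<phi> ` carrier R \<union> A) = carrier S"
begin

abbreviation MR where "MR \<equiv> restrict_scalars \<phi> C (carrier C)"

lemma Sg_carrier: "Sg i \<subseteq> carrier S"
  using std unfolding standard_graded_algebra_def internal_direct_sum_def
  by (auto dest: additive_subgroup.a_subset)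

lemma \<phi>: "r \<in> carrier R \<Longrightarrow> \<phi> r \<in> Sg 0" "\<phi> \<one>\<^bsub>R\<^esub> = \<one>\<^bsub>S\<^esub>"
  "r \<in> carrier R \<Longrightarrow> s \<in> carrier R \<Longrightarrow> \<phi> (r \<otimes>\<^bsub>R\<^esub> s) = \<phi> r \<otimes>\<^bsub>S\<^esub> \<phi> s"
  "r \<in> carrier R \<Longrightarrow> s \<in> carrier R \<Longrightarrow> \<phi> (r \<oplus>\<^bsub>R\<^esub> s) = \<phi> r \<oplus>\<^bsub>S\<^esub> \<phi> s"
  using std unfolding standard_graded_algebra_def ring_iso_def ring_hom_def by auto

lemma \<phi>_closed: "r \<in> carrier R \<Longrightarrow> \<phi> r \<in> carrier S"
  using \<phi>(1) Sg_carrier by blast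

lemma A_closed: "a \<in> A \<Longrightarrow> a \<in> carrier S"
  using A_Sg Sg_carrier by blast

lemma MR_simps: "carrier MR = carrier C" "\<zero>\<^bsub>MR\<^esub> = \<zero>" "x \<oplus>\<^bsub>MR\<^esub> y = x \<oplus> y"
  "r \<odot>\<^bsub>MR\<^esub> x = \<phi> r \<odot> x" "MR\<lparr>carrier := N\<rparr> = restrict_scalars \<phi> C N"
  by (simp_all add: restrict_scalars_def)

lemma MR_module: "module R MR"
proof (rule moduleI)
  show "abelian_group MR"
    by (rule abelian_groupI) (auto simp: MR_simps M.a_ac intro: bexI[of _ "\<ominus> _"] M.l_neg)
qed (auto simp: MR_simps R \<phi> \<phi>_closed smult_l_distr smult_r_distr smult_assoc1)

lemma Cg_subgroup: "additive_subgroup (Cg n) C"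
  using grad unfolding graded_module_def internal_direct_sum_def by blast

lemma Cg_act: "s \<in> Sg i \<Longrightarrow> x \<in> Cg n \<Longrightarrow> s \<odot> x \<in> Cg (int i + n)"
  using grad unfolding graded_module_def by blast

lemma Cg_decomp: "x \<in> carrier C \<Longrightarrow> \<exists>!c. (\<forall>i. c i \<in> Cg i) \<and> finite {i. c i \<noteq> \<zero>}
          \<and> x = (\<Oplus> i\<in>{i. c i \<noteq> \<zero>}. c i)"
  using grad unfolding graded_module_def internal_direct_sum_def by blast

lemma Cg_closed: "x \<in> Cg n \<Longrightarrow> x \<in> carrier C"
  using additive_subgroup.a_subset[OF Cg_subgroup] by blast

lemma Cg_submodule: "submodule (Cg n) R MR"
proof (rule module.submodule_intro[OF MR_module])
  show "r \<odot>\<^bsub>MR\<^esub> x \<in> Cg n" if "r \<in> carrier R" "x \<in> Cg n" for r x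
    using Cg_act[OF \<phi>(1)[OF that(1)] that(2)] by (simp add: MR_simps)
qed (use Cg_closed additive_subgroup.zero_closed[OF Cg_subgroup] additive_subgroup.a_closed[OF Cg_subgroup]
    in \<open>auto simp: MR_simps\<close>)

lemma act_hom: "a \<in> A \<Longrightarrow> (\<lambda>x. a \<odot> x) \<in> mod_hom R MR MR"
  using mod_hom_smult[OF smult_hom[OF A_closed] \<phi>_closed] A_closed
  by (intro mod_homI) (auto simp: MR_simps smult_r_distr)

lemma generated_part_Cg:
  assumes G: "\<And>e g. (e, g) \<in> G \<Longrightarrow> g \<in> Cg e" and P: "generated_part R \<phi> C A G n x"
  shows "x \<in> Cg n"
  using P
proof (induction rule: generated_part.induct)
  case (smult r n x)
  then show ?case using Cg_act[OF \<phi>(1)[OF smult(1)] smult(3)] by simp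
next
  case (act a n x)
  then show ?case using Cg_act[of a 1 x n] A_Sg by (auto simp: add.commute)
qed (auto intro: G additive_subgroup.zero_closed[OF Cg_subgroup]
    additive_subgroup.a_closed[OF Cg_subgroup] additive_subgroup.a_inv_closed[OF Cg_subgroup])

text \<open>The homogeneous components of a finite generating set generate. Sums of elements of the sets
  \<open>generated_part\<close> form a submodule, because the algebra is generated by \<open>R\<close> and \<open>A\<close>; it
  contains the generators, hence everything. Uniqueness of homogeneous decompositions then
  gives the claim in each degree.\<close>

lemma homogeneous_generators:
  obtains G where "finite G" "\<And>e g. (e, g) \<in> G \<Longrightarrow> g \<in> Cg e"
    "\<And>n x. x \<in> Cg n \<Longrightarrow> generated_part R \<phi> C A G n x"
proof -
  from fg obtain D where D: "finite D" "D \<subseteq> carrier C" "mod_span S C D = carrier C"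
    unfolding fin_gen_def by blast
  have "\<forall>x\<in>D. \<exists>c. (\<forall>i. c i \<in> Cg i) \<and> finite {i. c i \<noteq> \<zero>} \<and> x = (\<Oplus> i\<in>{i. c i \<noteq> \<zero>}. c i)"
    using Cg_decomp D(2) by blast
  from bchoice[OF this] obtain c where c: "\<And>x i. x \<in> D \<Longrightarrow> c x i \<in> Cg i"
    "\<And>x. x \<in> D \<Longrightarrow> finite {i. c x i \<noteq> \<zero>}"
    "\<And>x. x \<in> D \<Longrightarrow> x = (\<Oplus> i\<in>{i. c x i \<noteq> \<zero>}. c x i)" by blast
  define G where "G = (\<Union>x\<in>D. (\<lambda>i. (i, c x i)) ` {i. c x i \<noteq> \<zero>})"
  have G_fin: "finite G" unfolding G_def using D(1) c(2) by blast
  have G_Cg: "g \<in> Cg e" if "(e, g) \<in> G" for e g using that c(1) by (auto simp: G_def)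
  let ?P = "generated_part R \<phi> C A G"
  have P_Cg: "x \<in> Cg n" if "?P n x" for n x using generated_part_Cg[OF G_Cg that] .
  have Pc: "x \<in> carrier C" if "?P n x" for n x using P_Cg[OF that] by (rule Cg_closed)
  define Z where "Z = {x. \<exists>F c. finite F \<and> (\<forall>i. ?P i (c i)) \<and> (\<forall>i. i \<notin> F \<longrightarrow> c i = \<zero>)
      \<and> x = (\<Oplus> i\<in>F. c i)}"
  have ZI: "(\<Oplus> i\<in>F. c i) \<in> Z"
    if "finite F" "\<And>i. ?P i (c i)" "\<And>i. i \<notin> F \<Longrightarrow> c i = \<zero>" for F c
    using that unfolding Z_def by blast
  have Zc: "x \<in> carrier C" if "x \<in> Z" for x
    using that Pc unfolding Z_def by (auto intro!: M.finsum_closed)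
  have ext: "(\<Oplus> i\<in>F. c i) = (\<Oplus> i\<in>F'. c i)"
    if "finite F'" "F \<subseteq> F'" "\<And>i. i \<notin> F \<Longrightarrow> c i = \<zero>" "\<And>i. c i \<in> carrier C" for F F' :: "int set" and c
    using that by (intro M.add.finprod_mono_neutral_cong_left) auto
  have Z_zero: "\<zero> \<in> Z"
    using ZI[of "{}" "\<lambda>_. \<zero>"] by (simp add: generated_part.zero)
  have Z_add: "x \<oplus> y \<in> Z" if "x \<in> Z" "y \<in> Z" for x y
  proof -
    from that(1) obtain F c where x: "finite F" "\<And>i. ?P i (c i)" "\<And>i. i \<notin> F \<Longrightarrow> c i = \<zero>"
      "x = (\<Oplus> i\<in>F. c i)" unfolding Z_def by blast
    from that(2) obtain F' c' where y: "finite F'" "\<And>i. ?P i (c' i)" "\<And>i. i \<notin> F' \<Longrightarrow> c' i = \<zero>"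
      "y = (\<Oplus> i\<in>F'. c' i)" unfolding Z_def by blast
    have "x = (\<Oplus> i\<in>F \<union> F'. c i)" unfolding x(4) using x(1,3) y(1) Pc[OF x(2)] by (intro ext) auto
    moreover have "y = (\<Oplus> i\<in>F \<union> F'. c' i)" unfolding y(4) using x(1) y(1,3) Pc[OF y(2)] by (intro ext) auto
    ultimately have "x \<oplus> y = (\<Oplus> i\<in>F \<union> F'. c i \<oplus> c' i)"
      using Pc[OF x(2)] Pc[OF y(2)] by (simp add: M.finsum_addf)
    also have "\<dots> \<in> Z" using x y by (intro ZI) (auto intro: generated_part.add)
    finally show ?thesis .
  qed
  have Z_map: "s \<odot> x \<in> Z" if s: "s \<in> carrier S" and x: "x \<in> Z"
    and P: "\<And>i y. ?P i y \<Longrightarrow> ?P (i + d) (s \<odot> y)" for s x d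
  proof -
    from x obtain F c where x: "finite F" "\<And>i. ?P i (c i)" "\<And>i. i \<notin> F \<Longrightarrow> c i = \<zero>"
      "x = (\<Oplus> i\<in>F. c i)" unfolding Z_def by blast
    note cc = Pc[OF x(2)]
    have "s \<odot> x = (\<Oplus> i\<in>F. s \<odot> c i)"
      unfolding x(4) using x(1) s cc by (intro finsum_smult_ldistr) auto
    also have "\<dots> = (\<Oplus> i\<in>F. (\<lambda>i. s \<odot> c (i - d)) (i + d))" by simp
    also have "\<dots> = (\<Oplus> i\<in>(\<lambda>i. i + d) ` F. s \<odot> c (i - d))"
      using s cc by (intro M.finsum_reindex[symmetric]) (auto simp: inj_on_def)
    also have "\<dots> \<in> Z"
    proof (rule ZI)
      show "?P i (s \<odot> c (i - d))" for i using P[OF x(2)[of "i - d"]] by simp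
      show "s \<odot> c (i - d) = \<zero>" if "i \<notin> (\<lambda>i. i + d) ` F" for i
      proof -
        have "i - d \<notin> F" using that by (metis diff_add_cancel image_eqI)
        then show ?thesis using x(3) s by simp
      qed
    qed (use x(1) in simp)
    finally show ?thesis .
  qed
  have Z_neg: "\<ominus> x \<in> Z" if "x \<in> Z" for x
  proof -
    have neg: "(\<ominus>\<^bsub>S\<^esub> \<one>\<^bsub>S\<^esub>) \<odot> y = \<ominus> y" if "y \<in> carrier C" for y
      using that by (simp add: smult_l_minus)
    have "(\<ominus>\<^bsub>S\<^esub> \<one>\<^bsub>S\<^esub>) \<odot> x \<in> Z"
      by (rule Z_map[OF _ that, of _ 0]) (auto simp: neg Pc intro: generated_part.neg)
    then show ?thesis using neg[OF Zc[OF that]] by simp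
  qed
  have "s \<in> generate_ring S (\<phi> ` carrier R \<union> A) \<Longrightarrow> \<forall>x\<in>Z. s \<odot> x \<in> Z" for s
  proof (induction s rule: generate_ring.induct)
    case one
    then show ?case using Zc by simp
  next
    case (incl s)
    then show ?case
    proof
      assume "s \<in> \<phi> ` carrier R"
      then obtain r where "r \<in> carrier R" "s = \<phi> r" by blast
      then show ?case
        by (intro ballI Z_map[of s _ 0]) (auto simp: \<phi>_closed intro: generated_part.smult)
    next
      assume "s \<in> A"
      then show ?case
        by (intro ballI Z_map[of s _ 1]) (auto simp: A_closed intro: generated_part.act)
    qed
  next
    case (a_inv s)
    then have "s \<in> carrier S" using A_gen by blast
    then show ?case using a_inv Z_neg Zc by (auto simp: smult_l_minus)
  next
    case (eng_add s t)
    then have "s \<in> carrier S" "t \<in> carrier S" using A_gen by blast+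
    then show ?case using eng_add Z_add Zc by (auto simp: smult_l_distr)
  next
    case (eng_mult s t)
    then have "s \<in> carrier S" "t \<in> carrier S" using A_gen by blast+
    then show ?case using eng_mult Zc by (auto simp: smult_assoc1)
  qed
  then have "submodule Z S C"
    using A_gen Zc Z_zero Z_add by (intro submodule_intro) auto
  moreover have "D \<subseteq> Z"
  proof
    fix x assume x: "x \<in> D"
    have "?P i (c x i)" for i
      using x by (cases "c x i = \<zero>") (auto simp: G_def intro!: generated_part.zero generated_part.gen)
    then have "(\<Oplus> i\<in>{i. c x i \<noteq> \<zero>}. c x i) \<in> Z" using c(2)[OF x] by (intro ZI) auto
    then show "x \<in> Z" using c(3)[OF x] by simp
  qed
  ultimately have all: "carrier C \<subseteq> Z" using span_least D(3) by blast
  have "?P n x" if x: "x \<in> Cg n" for n x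
  proof -
    from all Cg_closed[OF x] have "x \<in> Z" by blast
    then obtain F c where c: "finite F" "\<And>i. ?P i (c i)" "\<And>i. i \<notin> F \<Longrightarrow> c i = \<zero>"
      "x = (\<Oplus> i\<in>F. c i)" unfolding Z_def by blast
    let ?d = "\<lambda>i. if i = n then x else \<zero>"
    have sub: "{i. c i \<noteq> \<zero>} \<subseteq> F" using c(3) by blast
    define Q where "Q c \<longleftrightarrow> (\<forall>i. c i \<in> Cg i) \<and> finite {i. c i \<noteq> \<zero>}
      \<and> x = (\<Oplus> i\<in>{i. c i \<noteq> \<zero>}. c i)" for c
    have "x = (\<Oplus> i\<in>{i. c i \<noteq> \<zero>}. c i)"
      unfolding c(4) using c(1) sub Pc[OF c(2)] by (intro ext[symmetric]) auto
    then have "Q c"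
      unfolding Q_def using P_Cg[OF c(2)] finite_subset[OF sub c(1)] by blast
    have "(\<Oplus> i\<in>{i. ?d i \<noteq> \<zero>}. ?d i) = (\<Oplus> i\<in>{n}. ?d i)"
      using Cg_closed[OF x] by (intro ext) auto
    then have "x = (\<Oplus> i\<in>{i. ?d i \<noteq> \<zero>}. ?d i)" using Cg_closed[OF x] by simp
    moreover have "finite {i. ?d i \<noteq> \<zero>}" by (rule finite_subset[of _ "{n}"]) auto
    moreover have "?d i \<in> Cg i" for i using x additive_subgroup.zero_closed[OF Cg_subgroup] by auto
    ultimately have "Q ?d" unfolding Q_def by blast
    moreover have "\<exists>!c. Q c" unfolding Q_def by (rule Cg_decomp[OF Cg_closed[OF x]])
    ultimately have "c = ?d" using \<open>Q c\<close> by blast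
    then have "c n = x" by simp
    then show ?thesis using c(2)[of n] by simp
  qed
  then show thesis using that G_fin G_Cg by blast
qed

lemma generated_part_span:
  assumes G: "\<And>e g. (e, g) \<in> G \<Longrightarrow> g \<in> Cg e"
    and "generated_part R \<phi> C A G n x"
  shows "x \<in> mod_span R MR ({g. (n, g) \<in> G} \<union> (\<Union>a\<in>A. (\<lambda>y. a \<odot> y) ` Cg (n - 1)))"
  using assms(2)
proof (induction rule: generated_part.induct)
  interpret MR: module R MR by (rule MR_module)
  let ?T = "\<lambda>n. {g. (n, g) \<in> G} \<union> (\<Union>a\<in>A. (\<lambda>y. a \<odot> y) ` Cg (n - 1))"
  have "?T n \<subseteq> carrier MR" for n
    using G Cg_closed A_closed by (auto simp: MR_simps)
  note sT = MR.span_submodule[OF this]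
  {
    case (gen e g)
    then show ?case using MR.span_incl[of "?T e"] by blast
  next
    case (zero n)
    then show ?case using submodule_zero[OF sT, of n] by (simp add: MR_simps)
  next
    case (neg n x)
    have "x \<in> carrier C" using subsetD[OF submodule_carrier[OF sT] neg(2)] by (simp add: MR_simps)
    moreover have "\<ominus>\<^bsub>MR\<^esub> x = \<ominus> x" by (simp add: a_inv_def restrict_scalars_def m_inv_def)
    ultimately show ?case using submodule_neg[OF sT neg(2)] by simp
  next
    case (add n x y)
    then show ?case using submodule_add[OF sT, of x n y] by (simp add: MR_simps)
  next
    case (smult r n x)
    then show ?case using submodule_smult[OF sT, of r x n] by (simp add: MR_simps)
  next
    case (act a n x)
    have "x \<in> Cg n" using generated_part_Cg[OF G] act(2) by blast
    with act(1) have "a \<odot> x \<in> ?T (n + 1)" by auto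
    then show ?case using MR.span_incl[of "?T (n + 1)"] by blast
  }
qed

text \<open>Beyond the degrees of all generators, each component is obtained from the previous one by the
  action of \<open>A\<close>. Finite generation over \<open>R\<close> propagates upwards from below the lowest generator,
  where the components vanish.\<close>

lemma eventually_graded_system:
  assumes loc: "noeth_local_ring R m"
  obtains N a k where "graded_system R MR m k (\<lambda>j x. a j \<odot> x) (\<lambda>n. Cg (N + int n))"
proof -
  interpret MR: module R MR by (rule MR_module)
  obtain G where G: "finite G" "\<And>e g. (e, g) \<in> G \<Longrightarrow> g \<in> Cg e"
    "\<And>n x. x \<in> Cg n \<Longrightarrow> generated_part R \<phi> C A G n x" using homogeneous_generators by blast
  let ?T = "\<lambda>n. {g. (n, g) \<in> G} \<union> (\<Union>a\<in>A. (\<lambda>y. a \<odot> y) ` Cg (n - 1))"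
  have act_Cg: "a \<odot> y \<in> Cg n" if "a \<in> A" "y \<in> Cg (n - 1)" for a y n
    using Cg_act[of a 1 y "n - 1"] A_Sg that by auto
  have span: "Cg n = mod_span R MR (?T n)" for n
  proof
    show "Cg n \<subseteq> mod_span R MR (?T n)" using generated_part_span[OF G(2) G(3)] by blast
    show "mod_span R MR (?T n) \<subseteq> Cg n"
      using G(2) act_Cg by (intro MR.span_least[OF Cg_submodule]) auto
  qed
  \<comment> \<open>Inserting 0 only serves to make the sets nonempty.\<close>
  define hi where "hi = Max (insert 0 (fst ` G))"
  define lo where "lo = Min (insert 0 (fst ` G))"
  have hi: "e \<le> hi" and lo: "lo \<le> e" if "(e, g) \<in> G" for e g
    unfolding hi_def lo_def using G(1) that by (force intro!: Max_ge Min_le)+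
  have low: "x = \<zero>" if "generated_part R \<phi> C A G n x" "n < lo" for n x
    using that
  proof (induction rule: generated_part.induct)
    case (gen e g)
    then show ?case using lo by force
  next
    case (smult r n x)
    then show ?case using \<phi>_closed by simp
  next
    case (act a n x)
    then show ?case using A_closed by simp
  qed auto
  have fg: "\<exists>T. finite T \<and> T \<subseteq> Cg n \<and> Cg n = mod_span R MR T" if "lo - 1 \<le> n" for n
    using that
  proof (induction n rule: int_ge_induct)
    case base
    have "Cg (lo - 1) = {\<zero>}"
      using low[OF G(3), of _ "lo - 1"] additive_subgroup.zero_closed[OF Cg_subgroup] by auto
    then show ?case using MR.span_empty by (intro exI[of _ "{}"]) (auto simp: MR_simps)
  next
    case (step n)
    then obtain T where T: "finite T" "T \<subseteq> Cg n" "Cg n = mod_span R MR T" by blast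
    let ?U = "{g. (n + 1, g) \<in> G} \<union> (\<Union>a\<in>A. (\<lambda>y. a \<odot> y) ` T)"
    have "{g. (n + 1, g) \<in> G} \<subseteq> snd ` G" by force
    then have "finite ?U" using finite_subset G(1) A_fin T(1) by auto
    moreover have U: "?U \<subseteq> Cg (n + 1)" using G(2) act_Cg[of _ _ "n + 1"] T(2) by auto
    moreover have "Cg (n + 1) = mod_span R MR ?U"
    proof
      show "mod_span R MR ?U \<subseteq> Cg (n + 1)" by (rule MR.span_least[OF Cg_submodule U])
      have Uc: "?U \<subseteq> carrier MR" using U submodule_carrier[OF Cg_submodule] by (rule subset_trans)
      have Tc: "T \<subseteq> carrier MR" using T(2) Cg_closed by (auto simp: MR_simps)
      have "(\<lambda>y. a \<odot> y) ` Cg n \<subseteq> mod_span R MR ?U" if "a \<in> A" for a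
        unfolding T(3) mod_hom_span[OF MR_module MR_module act_hom[OF that] Tc]
        using that by (intro MR.span_mono) blast
      then have "?T (n + 1) \<subseteq> mod_span R MR ?U" using MR.span_incl[of ?U] by auto
      then show "Cg (n + 1) \<subseteq> mod_span R MR ?U"
        unfolding span[of "n + 1"] by (rule MR.span_span_least[OF Uc])
    qed
    ultimately show ?case by blast
  qed
  from ex_bij_betw_nat_finite[OF A_fin] obtain a where "bij_betw a {0..<card A} A" by blast
  then have a: "a ` {..<card A} = A" by (simp add: bij_betw_def atLeast0LessThan)
  then have aA: "a j \<in> A" if "j < card A" for j using that by blast
  have lohi: "lo \<le> hi" unfolding lo_def hi_def using G(1)
    by (meson Max_ge Min_le finite_imageI finite_insert insertI1 order_trans)
  have "graded_system R MR m (card A) (\<lambda>j x. a j \<odot> x) (\<lambda>n. Cg (hi + int n))"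
  proof (intro graded_system.intro graded_system_axioms.intro)
    show "module R MR" by (rule MR_module)
    show "(\<lambda>x. a j \<odot> x) \<in> mod_hom R MR MR" if "j < card A" for j by (rule act_hom[OF aA[OF that]])
    show "a i \<odot> (a j \<odot> x) = a j \<odot> (a i \<odot> x)"
      if "i < card A" "j < card A" "x \<in> carrier MR" for i j x
      using A_closed[OF aA] that by (metis MR_simps(1) R.m_comm smult_assoc1)
    show "submodule (Cg (hi + int n)) R MR" for n by (rule Cg_submodule)
    obtain T where T: "finite T" "T \<subseteq> Cg hi" "Cg hi = mod_span R MR T" using fg[of hi] lohi by auto
    show "fin_gen R (MR\<lparr>carrier := Cg (hi + int 0)\<rparr>)"
      unfolding fin_gen_def using T MR.span_sub[OF Cg_submodule T(2)] by (intro exI[of _ T]) simp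
    show "Cg (hi + int (Suc n)) = mod_span R MR (\<Union>j<card A. (\<lambda>x. a j \<odot> x) ` Cg (hi + int n))" for n
    proof -
      have "{g. (hi + int (Suc n), g) \<in> G} = {}" using hi by force
      moreover have "hi + int (Suc n) - 1 = hi + int n" by simp
      moreover have "(\<Union>j<card A. (\<lambda>x. a j \<odot> x) ` Cg (hi + int n))
          = (\<Union>s\<in>a ` {..<card A}. (\<lambda>x. s \<odot> x) ` Cg (hi + int n))" by simp
      ultimately show ?thesis using span[of "hi + int (Suc n)"] by (simp only: a Un_empty_left)
    qed
  qed (rule loc)
  then show thesis using that by blast
qed

end

section \<open>Eventual constancy of the linearity defect\<close>

lemma (in graded_system) component_fin_gen: "fin_gen R (M\<lparr>carrier := C n\<rparr>)"
  using syzygy_system cover_fin_gen[OF component_module] by blast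

text \<open>The global linearity defect ranges over modules of one fixed carrier type, so the bound is first
  applied to an isomorphic copy.\<close>

lemma tor_vanish_at_ge_gl_ld:
  assumes loc: "noeth_local_ring R m" and gl: "gl_ld R m \<le> enat g"
    and M: "module R M" and fg: "fin_gen R M" and j: "g \<le> j"
  shows "tor_vanish_at R m M j"
proof -
  from fin_gen_representative[OF M fg] obtain M' :: "('a, (nat \<Rightarrow> 'a) set) module" and h where
    M': "module R M'" "fin_gen R M'" "h \<in> mod_hom R M M'" "bij_betw h (carrier M) (carrier M')" by blast
  have "tor_vanish_at R m M' j"
  proof (rule ccontr)
    assume "\<not> ?thesis"
    then have "enat (Suc j) \<le> ld R m M'"
      unfolding ld_eq[OF loc M'(1,2)] by (intro Sup_upper) blast
    also have "\<dots> \<le> gl_ld R m" unfolding gl_ld_def using M'(1,2) by (intro Sup_upper) blast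
    also note gl
    finally show False using j by simp
  qed
  then show ?thesis by (rule tor_vanish_at_iso[OF loc M fg M'(1,3,4)])
qed

text \<open>Only the finitely many homological degrees up to the global linearity defect matter, and in each of
  them vanishing does not depend on \<open>n\<close> for large \<open>n\<close>.\<close>

theorem (in graded_system) ld_eventually_constant:
  assumes gl: "gl_ld R m < \<infinity>"
  shows "\<exists>l N. \<forall>n\<ge>N. ld R m (M\<lparr>carrier := C n\<rparr>) = l"
proof -
  from gl obtain g where g: "gl_ld R m = enat g" by auto
  have "\<forall>i. \<exists>N b. \<forall>n\<ge>N. tor_vanish_at R m (M\<lparr>carrier := C n\<rparr>) i = b"
    using tor_vanish_eventually_decided unfolding eventually_decided_def by metis
  from choice[OF this] obtain N where N: "\<And>i. \<exists>b. \<forall>n\<ge>N i. tor_vanish_at R m (M\<lparr>carrier := C n\<rparr>) i = b"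
    by blast
  from choice[of "\<lambda>i b. \<forall>n\<ge>N i. tor_vanish_at R m (M\<lparr>carrier := C n\<rparr>) i = b"] N
  obtain b where b: "\<And>i n. n \<ge> N i \<Longrightarrow> tor_vanish_at R m (M\<lparr>carrier := C n\<rparr>) i = b i" by blast
  have "ld R m (M\<lparr>carrier := C n\<rparr>) = Sup {enat (Suc j) | j. j < g \<and> \<not> b j}"
    if n: "n \<ge> (\<Sum>i<g. N i)" for n
  proof -
    have "tor_vanish_at R m (M\<lparr>carrier := C n\<rparr>) j \<longleftrightarrow> \<not> (j < g \<and> \<not> b j)" for j
    proof (cases "j < g")
      case True
      then have "N j \<le> (\<Sum>i<g. N i)" by (intro member_le_sum) auto
      then show ?thesis using b[of j n] n True by simp
    next
      case False
      then show ?thesis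
        using tor_vanish_at_ge_gl_ld[OF loc _ component_module component_fin_gen, of g j n] g by simp
    qed
    then show ?thesis unfolding ld_eq[OF loc component_module component_fin_gen] by simp
  qed
  then show ?thesis by blast
qed

theorem theorem1p2:
  fixes R :: "('a, 'r) ring_scheme" and m :: "'a set"
    and S :: "('s, 't) ring_scheme" and \<phi> :: "'a \<Rightarrow> 's" and Sg :: "nat \<Rightarrow> 's set"
    and C :: "('s, 'c, 'x) module_scheme" and Cg :: "int \<Rightarrow> 'c set"
  assumes "noeth_local_ring R m"
    and "gl_ld R m < \<infinity>"
    and "standard_graded_algebra R S \<phi> Sg"
    and "graded_module S Sg C Cg"
    and "fin_gen S C"
  shows "\<exists>l::enat. \<exists>N::int. \<forall>n\<ge>N. ld R m (restrict_scalars \<phi> C (Cg n)) = l"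
proof -
  obtain A where A: "finite A" "A \<subseteq> Sg 1" "generate_ring S (\<phi> ` carrier R \<union> A) = carrier S"
    using assms(3) unfolding standard_graded_algebra_def by blast
  have "module S C" using assms(4) by (simp add: graded_module_def)
  then interpret fin_gen_graded_module S C R \<phi> Sg Cg A
    using assms A noeth_local_ringD(1)
    by (intro fin_gen_graded_module.intro fin_gen_graded_module_axioms.intro) auto
  obtain N a k where "graded_system R MR m k (\<lambda>j x. a j \<odot>\<^bsub>C\<^esub> x) (\<lambda>n. Cg (N + int n))"
    using eventually_graded_system[OF assms(1)] .
  from graded_system.ld_eventually_constant[OF this assms(2)] obtain l n0 where
    l: "\<And>n. n \<ge> n0 \<Longrightarrow> ld R m (restrict_scalars \<phi> C (Cg (N + int n))) = l"
    unfolding MR_simps(5) by blast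
  have "ld R m (restrict_scalars \<phi> C (Cg n)) = l" if "n \<ge> N + int n0" for n
    using l[of "nat (n - N)"] that by simp
  then show ?thesis by blast
qed

end
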